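(* Let $G$ be a group having a nilpotent normal subgroup of finite index. If $G$ has no proper contranormal subgroups, then $G$ is nilpotent.
   Context: A subgroup $H$ of a group $G$ is called contranormal in $G$ if $H^G = G$, where $H^G=\langle x^{-1}hx \mid h\in H, x\in G\rangle$ is the normal closure of $H$ in $G$. A proper contranormal subgroup is a contranormal subgroup $H\neq G$. *)

theory Defs
  imports "HOL-Algebra.Algebra"
begin

definition commutator_sub :: "('a, 'b) monoid_scheme \<Rightarrow> 'a set \<Rightarrow> 'a set \<Rightarrow> 'a set" where
  "commutator_sub G H K =
     generate G {h \<otimes>\<^bsub>G\<^esub> k \<otimes>\<^bsub>G\<^esub> inv\<^bsub>G\<^esub> h \<otimes>\<^bsub>G\<^esub> inv\<^bsub>G\<^esub> k | h k. h \<in> H \<and> k \<in> K}"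

(* Lower central series: gamma_1 = G, gamma_{i+1} = [gamma_i, G] (indexed from 0) *)
fun lower_central :: "('a, 'b) monoid_scheme \<Rightarrow> nat \<Rightarrow> 'a set" where
  "lower_central G 0 = carrier G"
| "lower_central G (Suc n) = commutator_sub G (lower_central G n) (carrier G)"

definition nilpotent_group :: "('a, 'b) monoid_scheme \<Rightarrow> bool" where
  "nilpotent_group G \<longleftrightarrow> group G \<and> (\<exists>n. lower_central G n = {\<one>\<^bsub>G\<^esub>})"

definition normal_closure :: "('a, 'b) monoid_scheme \<Rightarrow> 'a set \<Rightarrow> 'a set" where
  "normal_closure G H =
     generate G {inv\<^bsub>G\<^esub> x \<otimes>\<^bsub>G\<^esub> h \<otimes>\<^bsub>G\<^esub> x | h x. h \<in> H \<and> x \<in> carrier G}"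

definition contranormal :: "'a set \<Rightarrow> ('a, 'b) monoid_scheme \<Rightarrow> bool" where
  "contranormal H G \<longleftrightarrow> subgroup H G \<and> normal_closure G H = carrier G"

end

theory Submission
  imports Defs
begin

text \<open>
  A finite group without proper contranormal subgroups has only normal Sylow subgroups, because the
  normalizer of a Sylow subgroup is contranormal (Frattini argument). Hence every finite quotient of
  \<open>G\<close> is nilpotent; in particular \<open>G / N\<close> is. By P. Hall's criterion one may replace \<open>G\<close> by
  \<open>G / [N, N]\<close>, so let \<open>A\<close> be an abelian normal subgroup of finite index.

  If \<open>D \<le> A\<close> is normal in \<open>G\<close> and \<open>A = D [A, G]\<close>, then the subgroup generated by \<open>D\<close> and a
  finite transversal of \<open>A\<close> is contranormal, so \<open>A / D\<close> is finitely generated; a nontrivial finite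
  quotient of it would contradict nilpotency of finite quotients of \<open>G\<close>. So \<open>A = D [A, G]\<close> forces \<open>D = A\<close>.

  Let \<open>z\<close> act on \<open>A\<close> as a central element of prime order \<open>p\<close> of the acting finite nilpotent group, and
  let \<open>\<phi> a = [z, a]\<close>, a \<open>G\<close>-endomorphism of \<open>A\<close>. The norm of \<open>z\<close> shows that \<open>p\<close>-th powers in \<open>\<phi> A\<close> lie in
  \<open>[\<phi> A, G]\<close>, so they form a superfluous submodule of \<open>\<phi> A\<close>; equivalently, \<open>\<phi> A\<close> has no nontrivial
  \<open>p\<close>-divisible \<open>G\<close>-quotient. This forces \<open>\<phi> A\<close> to have exponent a power of \<open>p\<close>: an unbounded
  module would have a quotient with finite socle and unbounded exponent, hence a \<open>p\<close>-divisible one. As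
  \<open>\<phi>\<close> raised to the power \<open>p\<close> maps \<open>A\<close> into \<open>p\<close>-th powers, \<open>\<phi>\<close> is nilpotent. Induction on the acting
  group, through \<open>A / \<phi> A\<close>, gives \<open>[A, G, \<dots>, G] = 1\<close>.
\<close>

section \<open>Iterated commutators, contranormal subgroups and quotients\<close>

text \<open>The obstacle is that \<open>A\<close> may be infinite and of unbounded exponent. The
  tool against this is a Zorn argument: if \<open>D\<close> is maximal among the subgroups avoiding
  \<open>c\<close>, every nontrivial subgroup of \<open>A / D\<close> contains the image of
  \<open>c\<close>, so \<open>A / D\<close> is cyclic of prime power order or quasicyclic, with
  socle generated by \<open>c\<close>. Such a \<open>D\<close> need not be invariant under
  \<open>G\<close>. But \<open>G\<close> induces only finitely many operators on \<open>A\<close>,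
  so the largest invariant subgroup of \<open>D\<close> is a finite intersection of preimages of
  \<open>D\<close>, and the quotient by it embeds in a finite power of \<open>A / D\<close>: finite
  index and finite socle survive. The assumption on contranormal subgroups is transported to
  quotients only. Hence the last induction enlarges a normal subgroup \<open>B \<subseteq> A\<close>
  of \<open>G\<close> until all of \<open>G\<close> acts trivially on \<open>A / B\<close>, and then
  returns from \<open>B [z, A]\<close> to \<open>B\<close>. Superfluity of \<open>[A, G]\<close> in
  \<open>A\<close> reaches the image of \<open>\<phi>\<close> because that image is a quotient of
  \<open>A\<close>.\<close>

definition contranormal_free :: "('a, 'b) monoid_scheme \<Rightarrow> bool" where
  "contranormal_free G \<longleftrightarrow> (\<forall>H. contranormal H G \<longrightarrow> H = carrier G)"

text \<open>Starting the series at \<open>K\<close> instead of \<open>G\<close> splits the goal: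
  finite quotients bring \<open>lower_central\<close> into \<open>N\<close>, and what remains is a
  statement about \<open>iter_comm G N\<close>.\<close>

definition iter_comm :: "('a, 'b) monoid_scheme \<Rightarrow> 'a set \<Rightarrow> nat \<Rightarrow> 'a set" where
  "iter_comm G K n = ((\<lambda>L. commutator_sub G L (carrier G)) ^^ n) K"

lemma iter_comm_0 [simp]: "iter_comm G K 0 = K"
  by (simp add: iter_comm_def)

lemma iter_comm_Suc: "iter_comm G K (Suc n) = commutator_sub G (iter_comm G K n) (carrier G)"
  by (simp add: iter_comm_def)

lemma iter_comm_add: "iter_comm G K (m + n) = iter_comm G (iter_comm G K m) n"
  by (simp add: iter_comm_def funpow_add add.commute[of m n])

lemma lower_central_eq_iter_comm: "lower_central G n = iter_comm G (carrier G) n"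
  by (induction n) (simp_all add: iter_comm_Suc)

context group
begin

lemma inv_cancel_left: "\<lbrakk>x \<in> carrier G; y \<in> carrier G\<rbrakk> \<Longrightarrow> inv x \<otimes> (x \<otimes> y) = y"
  by (simp flip: m_assoc)

lemma cancel_inv_left: "\<lbrakk>x \<in> carrier G; y \<in> carrier G\<rbrakk> \<Longrightarrow> x \<otimes> (inv x \<otimes> y) = y"
  by (simp flip: m_assoc)

lemmas word_simps = m_assoc inv_mult_group inv_cancel_left cancel_inv_left

lemma conj_mult:
  "\<lbrakk>g \<in> carrier G; x \<in> carrier G; y \<in> carrier G\<rbrakk>
    \<Longrightarrow> g \<otimes> (x \<otimes> y) \<otimes> inv g = (g \<otimes> x \<otimes> inv g) \<otimes> (g \<otimes> y \<otimes> inv g)"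
  by (simp add: word_simps)

lemma commutator_sub_subgroup:
  assumes "H \<subseteq> carrier G" "K \<subseteq> carrier G"
  shows "subgroup (commutator_sub G H K) G"
  unfolding commutator_sub_def using assms by (intro generate_is_subgroup) (auto intro!: m_closed inv_closed)

lemma commutator_sub_incl:
  assumes "h \<in> H" "k \<in> K"
  shows "h \<otimes> k \<otimes> inv h \<otimes> inv k \<in> commutator_sub G H K"
  unfolding commutator_sub_def using assms by (intro generate.incl) auto

lemma commutator_sub_leI:
  assumes "subgroup M G" "\<And>h k. \<lbrakk>h \<in> H; k \<in> K\<rbrakk> \<Longrightarrow> h \<otimes> k \<otimes> inv h \<otimes> inv k \<in> M"
  shows "commutator_sub G H K \<subseteq> M"
  unfolding commutator_sub_def using assms by (intro generate_subgroup_incl) auto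

lemma commutator_sub_mono:
  assumes "H \<subseteq> H'" "K \<subseteq> K'"
  shows "commutator_sub G H K \<subseteq> commutator_sub G H' K'"
  unfolding commutator_sub_def using assms by (intro mono_generate) auto

lemma normal_subset: "N \<lhd> G \<Longrightarrow> N \<subseteq> carrier G"
  by (simp add: normal_imp_subgroup subgroup.subset)

lemma commutator_sub_normal:
  assumes "H \<lhd> G" "K \<lhd> G"
  shows "commutator_sub G H K \<lhd> G"
  unfolding commutator_sub_def
proof (rule normal_generateI)
  show "{h \<otimes> k \<otimes> inv h \<otimes> inv k |h k. h \<in> H \<and> k \<in> K} \<subseteq> carrier G"
    using normal_subset[OF assms(1)] normal_subset[OF assms(2)] by (auto intro!: m_closed inv_closed)
next
  fix c g assume c: "c \<in> {h \<otimes> k \<otimes> inv h \<otimes> inv k |h k. h \<in> H \<and> k \<in> K}" and g: "g \<in> carrier G"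
  then obtain h k where hk: "h \<in> H" "k \<in> K" "c = h \<otimes> k \<otimes> inv h \<otimes> inv k" by auto
  have hk': "h \<in> carrier G" "k \<in> carrier G"
    using hk normal_subset[OF assms(1)] normal_subset[OF assms(2)] by auto
  let ?h = "g \<otimes> h \<otimes> inv g" and ?k = "g \<otimes> k \<otimes> inv g"
  have "?h \<in> H" "?k \<in> K" using hk g assms by (auto simp: normal_inv_iff)
  moreover have "g \<otimes> c \<otimes> inv g = ?h \<otimes> ?k \<otimes> inv ?h \<otimes> inv ?k"
    using hk' g by (simp add: hk(3) word_simps)
  ultimately show "g \<otimes> c \<otimes> inv g \<in> {h \<otimes> k \<otimes> inv h \<otimes> inv k |h k. h \<in> H \<and> k \<in> K}" by blast
qed

lemma commutator_sub_le_left: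
  assumes "H \<lhd> G" "K \<subseteq> carrier G"
  shows "commutator_sub G H K \<subseteq> H"
proof (rule commutator_sub_leI)
  show sH: "subgroup H G" using assms(1) by (rule normal_imp_subgroup)
  fix h k assume hk: "h \<in> H" "k \<in> K"
  hence c: "h \<in> carrier G" "k \<in> carrier G" using assms normal_subset by auto
  have "k \<otimes> inv h \<otimes> inv k \<in> H"
    using hk c assms sH by (auto simp: normal_inv_iff subgroup.m_inv_closed)
  hence "h \<otimes> (k \<otimes> inv h \<otimes> inv k) \<in> H" using sH hk by (simp add: subgroup.m_closed)
  thus "h \<otimes> k \<otimes> inv h \<otimes> inv k \<in> H" using c by (simp add: m_assoc)
qed

lemma commutator_sub_commute:
  assumes "H \<subseteq> carrier G" "K \<subseteq> carrier G"
  shows "commutator_sub G H K = commutator_sub G K H"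
proof -
  have "commutator_sub G A B \<subseteq> commutator_sub G B A" if "A \<subseteq> carrier G" "B \<subseteq> carrier G" for A B
  proof (rule commutator_sub_leI)
    show s: "subgroup (commutator_sub G B A) G" by (rule commutator_sub_subgroup) fact+
    fix h k assume hk: "h \<in> A" "k \<in> B"
    hence c: "h \<in> carrier G" "k \<in> carrier G" using that by auto
    have "inv (k \<otimes> h \<otimes> inv k \<otimes> inv h) \<in> commutator_sub G B A"
      using s commutator_sub_incl[OF hk(2,1)] by (rule subgroup.m_inv_closed)
    thus "h \<otimes> k \<otimes> inv h \<otimes> inv k \<in> commutator_sub G B A" using c by (simp add: word_simps)
  qed
  thus ?thesis using assms by blast
qed

lemma iter_comm_normal: "K \<lhd> G \<Longrightarrow> iter_comm G K n \<lhd> G"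
  by (induction n) (auto simp: iter_comm_Suc intro: commutator_sub_normal normal_self)

lemma iter_comm_mono: "K \<subseteq> L \<Longrightarrow> iter_comm G K n \<subseteq> iter_comm G L n"
  by (induction n) (simp_all add: iter_comm_Suc commutator_sub_mono)

lemma iter_comm_antimono:
  assumes "K \<lhd> G" "m \<le> n"
  shows "iter_comm G K n \<subseteq> iter_comm G K m"
  using assms(2)
proof (induction rule: dec_induct)
  case (step k)
  have "iter_comm G K (Suc k) \<subseteq> iter_comm G K k"
    unfolding iter_comm_Suc by (intro commutator_sub_le_left iter_comm_normal assms(1)) auto
  thus ?case using step.IH by blast
qed simp

lemma normal_closure_normal:
  assumes "H \<subseteq> carrier G"
  shows "normal_closure G H \<lhd> G"
  unfolding normal_closure_def
proof (rule normal_generateI)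
  show "{inv x \<otimes> h \<otimes> x |h x. h \<in> H \<and> x \<in> carrier G} \<subseteq> carrier G" using assms by (auto intro!: m_closed inv_closed)
next
  fix c g assume c: "c \<in> {inv x \<otimes> h \<otimes> x |h x. h \<in> H \<and> x \<in> carrier G}" and g: "g \<in> carrier G"
  then obtain h x where hx: "h \<in> H" "x \<in> carrier G" "c = inv x \<otimes> h \<otimes> x" by auto
  have "g \<otimes> c \<otimes> inv g = inv (x \<otimes> inv g) \<otimes> h \<otimes> (x \<otimes> inv g)"
    using hx g assms by (auto simp: word_simps subset_iff)
  thus "g \<otimes> c \<otimes> inv g \<in> {inv x \<otimes> h \<otimes> x |h x. h \<in> H \<and> x \<in> carrier G}" using hx g by blast
qed

lemma subset_normal_closure:
  assumes "H \<subseteq> carrier G"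
  shows "H \<subseteq> normal_closure G H"
proof
  fix h assume h: "h \<in> H"
  hence "h = inv \<one> \<otimes> h \<otimes> \<one>" using assms by auto
  hence "h \<in> {inv x \<otimes> h \<otimes> x |h x. h \<in> H \<and> x \<in> carrier G}" using h one_closed by blast
  thus "h \<in> normal_closure G H" unfolding normal_closure_def by (rule generate.incl)
qed

lemma normal_closure_minimal:
  assumes "K \<lhd> G" "H \<subseteq> K"
  shows "normal_closure G H \<subseteq> K"
  unfolding normal_closure_def
  using assms by (intro generate_subgroup_incl) (auto simp: normal_imp_subgroup normal.inv_op_closed1)

text \<open>The normal closure is the least normal subgroup above \<open>H\<close>, so
  contranormality becomes a statement about normal subgroups; generators of the closure do not occur
  again.\<close>

lemma contranormal_iff:
  "contranormal H G \<longleftrightarrow> subgroup H G \<and> (\<forall>K. K \<lhd> G \<longrightarrow> H \<subseteq> K \<longrightarrow> K = carrier G)"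
proof (cases "subgroup H G")
  case True
  hence H: "H \<subseteq> carrier G" by (rule subgroup.subset)
  show ?thesis
  proof
    assume "contranormal H G"
    hence "normal_closure G H = carrier G" by (simp add: contranormal_def)
    thus "subgroup H G \<and> (\<forall>K. K \<lhd> G \<longrightarrow> H \<subseteq> K \<longrightarrow> K = carrier G)"
      using True normal_closure_minimal[of _ H] normal_subset by (metis subset_antisym)
  next
    assume "subgroup H G \<and> (\<forall>K. K \<lhd> G \<longrightarrow> H \<subseteq> K \<longrightarrow> K = carrier G)"
    thus "contranormal H G"
      using True normal_closure_normal[OF H] subset_normal_closure[OF H] by (auto simp: contranormal_def)
  qed
qed (simp add: contranormal_def)

lemma contranormal_freeD:
  assumes "contranormal_free G" "subgroup H G" "\<And>K. \<lbrakk>K \<lhd> G; H \<subseteq> K\<rbrakk> \<Longrightarrow> K = carrier G"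
  shows "H = carrier G"
  using assms by (auto simp: contranormal_free_def contranormal_iff)

lemma subgroup_rcos_eq_iff:
  assumes "subgroup M G" "x \<in> carrier G" "y \<in> carrier G"
  shows "M #> x = M #> y \<longleftrightarrow> x \<otimes> inv y \<in> M"
proof
  assume "M #> x = M #> y"
  hence "x \<in> M #> y" using rcos_self[OF assms(2,1)] by simp
  thus "x \<otimes> inv y \<in> M" using subgroup.rcos_module[OF assms(1) is_group assms(3,2)] by simp
next
  assume "x \<otimes> inv y \<in> M"
  hence "x \<in> M #> y" using subgroup.rcos_module[OF assms(1) is_group assms(3,2)] by simp
  thus "M #> x = M #> y" using repr_independence[OF _ assms(3,1)] by simp
qed

text \<open>Finite index is handled through \<open>T\<close>, which may contain several elements of
  one coset: images and products of such sets can then be reused without choosing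
  representatives.\<close>

lemma finite_rcosets_iff:
  assumes "subgroup A G"
  shows "finite (rcosets A) \<longleftrightarrow>
    (\<exists>T. finite T \<and> T \<subseteq> carrier G \<and> (\<forall>g\<in>carrier G. \<exists>a\<in>A. \<exists>t\<in>T. g = a \<otimes> t))"
proof
  assume fin: "finite (rcosets A)"
  define r where "r C = (SOME x. x \<in> carrier G \<and> C = A #> x)" for C
  have r: "r C \<in> carrier G \<and> C = A #> r C" if "C \<in> rcosets A" for C
    unfolding r_def by (rule someI_ex) (use that in \<open>auto simp: RCOSETS_def\<close>)
  have "\<exists>a\<in>A. \<exists>t\<in>r ` (rcosets A). g = a \<otimes> t" if g: "g \<in> carrier G" for g
  proof -
    have C: "A #> g \<in> rcosets A" using g by (simp add: rcosetsI assms subgroup.subset)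
    have "g \<in> A #> r (A #> g)" using r[OF C] rcos_self[OF g assms] by auto
    thus ?thesis using C by (auto simp: r_coset_def)
  qed
  thus "\<exists>T. finite T \<and> T \<subseteq> carrier G \<and> (\<forall>g\<in>carrier G. \<exists>a\<in>A. \<exists>t\<in>T. g = a \<otimes> t)"
    using fin r by (intro exI[of _ "r ` (rcosets A)"]) auto
next
  assume "\<exists>T. finite T \<and> T \<subseteq> carrier G \<and> (\<forall>g\<in>carrier G. \<exists>a\<in>A. \<exists>t\<in>T. g = a \<otimes> t)"
  then obtain T where T: "finite T" "T \<subseteq> carrier G" "\<forall>g\<in>carrier G. \<exists>a\<in>A. \<exists>t\<in>T. g = a \<otimes> t" by auto
  have "rcosets A \<subseteq> (\<lambda>t. A #> t) ` T"
  proof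
    fix C assume "C \<in> rcosets A"
    then obtain g where g: "g \<in> carrier G" "C = A #> g" by (auto simp: RCOSETS_def)
    then obtain a t where at: "a \<in> A" "t \<in> T" "g = a \<otimes> t" using T by blast
    have "a \<in> carrier G" "t \<in> carrier G" using at T subgroup.subset[OF assms] by auto
    hence "A #> g = A #> t"
      using at g by (simp add: subgroup_rcos_eq_iff[OF assms] m_assoc)
    thus "C \<in> (\<lambda>t. A #> t) ` T" using g at by auto
  qed
  thus "finite (rcosets A)" using T(1) finite_surj by blast
qed

end

section \<open>Subgroups, the hypothesis and commutator series in quotients\<close>

context normal
begin

lemma Mod_group_hom: "group_hom G (G Mod H) (\<lambda>x. H #> x)"
  by (simp add: group_hom_def group_hom_axioms_def factorgroup_is_group r_coset_hom_Mod)

lemma rcos_eq_one_iff: "x \<in> carrier G \<Longrightarrow> H #> x = H \<longleftrightarrow> x \<in> H"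
  using coset_join1[OF _ _ is_subgroup] coset_join2[OF _ is_subgroup] by metis

lemma Mod_preimage_subgroup:
  assumes "subgroup K (G Mod H)"
  shows "subgroup {x \<in> carrier G. H #> x \<in> K} G"
proof -
  interpret h: group_hom G "G Mod H" "\<lambda>x. H #> x" by (rule Mod_group_hom)
  interpret K: subgroup K "G Mod H" by fact
  show ?thesis
  proof (rule subgroup.intro)
    show "\<one> \<in> {x \<in> carrier G. H #> x \<in> K}" using K.one_closed h.hom_one by simp
    fix x y assume "x \<in> {x \<in> carrier G. H #> x \<in> K}" "y \<in> {x \<in> carrier G. H #> x \<in> K}"
    thus "x \<otimes> y \<in> {x \<in> carrier G. H #> x \<in> K}" using K.m_closed[of "H #> x" "H #> y"] h.hom_mult[of x y] by simp
  next
    fix x assume "x \<in> {x \<in> carrier G. H #> x \<in> K}"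
    thus "inv x \<in> {x \<in> carrier G. H #> x \<in> K}" using K.m_inv_closed[of "H #> x"] h.hom_inv[of x] by simp
  qed auto
qed

lemma Mod_image_normal: "K \<lhd> G \<Longrightarrow> (\<lambda>x. H #> x) ` K \<lhd> G Mod H"
  by (rule normal.surj_hom_normal_subgroup[OF _ Mod_group_hom]) (simp_all add: carrier_FactGroup)

text \<open>The preimage \<open>L\<close> of a contranormal \<open>K\<close> is contranormal: a
  normal \<open>M\<close> above \<open>L\<close> maps to a normal subgroup above \<open>K\<close>,
  hence onto the whole quotient, and \<open>M\<close> contains the kernel \<open>H\<close>.\<close>

lemma contranormal_free_Mod:
  assumes "contranormal_free G"
  shows "contranormal_free (G Mod H)"
  unfolding contranormal_free_def
proof (intro allI impI)
  interpret Q: group "G Mod H" by (rule factorgroup_is_group)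
  interpret h: group_hom G "G Mod H" "\<lambda>x. H #> x" by (rule Mod_group_hom)
  fix K assume K: "contranormal K (G Mod H)"
  hence sK: "subgroup K (G Mod H)" by (simp add: contranormal_def)
  define L where "L = {x \<in> carrier G. H #> x \<in> K}"
  have L: "subgroup L G" unfolding L_def using sK by (rule Mod_preimage_subgroup)
  have HL: "H \<subseteq> L"
  proof
    fix x assume "x \<in> H"
    thus "x \<in> L" using rcos_eq_one_iff[of x] subgroup.one_closed[OF sK] by (simp add: L_def)
  qed
  have KL: "K = (\<lambda>x. H #> x) ` L"
    using subgroup.subset[OF sK] by (auto simp: L_def carrier_FactGroup)
  have "L = carrier G"
  proof (rule contranormal_freeD[OF assms L])
    fix M assume M: "M \<lhd> G" "L \<subseteq> M"
    have "K \<subseteq> (\<lambda>x. H #> x) ` M" unfolding KL using M(2) by (rule image_mono)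
    hence img: "(\<lambda>x. H #> x) ` M = carrier (G Mod H)"
      using K Mod_image_normal[OF M(1)] by (simp add: Q.contranormal_iff)
    have "x \<in> M" if x: "x \<in> carrier G" for x
    proof -
      obtain m where m: "m \<in> M" "H #> x = H #> m"
        using img x unfolding carrier_FactGroup by (metis imageE imageI)
      have mc: "m \<in> carrier G" using m M normal_subset by auto
      have "x \<otimes> inv m \<in> M"
        using subgroup_rcos_eq_iff[OF is_subgroup x mc] m HL M by auto
      hence "x \<otimes> inv m \<otimes> m \<in> M" using m M by (simp add: normal_imp_subgroup subgroup.m_closed)
      thus "x \<in> M" using x mc by (simp add: m_assoc)
    qed
    thus "M = carrier G" using normal_subset[OF M(1)] by auto
  qed
  thus "K = carrier (G Mod H)" using KL by (simp add: carrier_FactGroup)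
qed

lemma commutator_sub_Mod:
  assumes "K \<subseteq> carrier G" "L \<subseteq> carrier G"
  shows "commutator_sub (G Mod H) ((\<lambda>x. H #> x) ` K) ((\<lambda>x. H #> x) ` L) = (\<lambda>x. H #> x) ` commutator_sub G K L"
proof -
  interpret h: group_hom G "G Mod H" "\<lambda>x. H #> x" by (rule Mod_group_hom)
  let ?S = "{k \<otimes> l \<otimes> inv k \<otimes> inv l |k l. k \<in> K \<and> l \<in> L}"
  have "?S \<subseteq> carrier G" using assms by (auto intro!: m_closed inv_closed)
  have eq: "(H #> x) \<otimes>\<^bsub>G Mod H\<^esub> (H #> y) \<otimes>\<^bsub>G Mod H\<^esub> inv\<^bsub>G Mod H\<^esub> (H #> x) \<otimes>\<^bsub>G Mod H\<^esub> inv\<^bsub>G Mod H\<^esub> (H #> y)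
     = H #> (x \<otimes> y \<otimes> inv x \<otimes> inv y)" if "x \<in> K" "y \<in> L" for x y
  proof -
    have "x \<in> carrier G" "y \<in> carrier G" using that assms by auto
    thus ?thesis by (simp only: h.hom_mult h.hom_inv m_closed inv_closed)
  qed
  have "{x \<otimes>\<^bsub>G Mod H\<^esub> y \<otimes>\<^bsub>G Mod H\<^esub> inv\<^bsub>G Mod H\<^esub> x \<otimes>\<^bsub>G Mod H\<^esub> inv\<^bsub>G Mod H\<^esub> y |x y.
     x \<in> (\<lambda>x. H #> x) ` K \<and> y \<in> (\<lambda>x. H #> x) ` L} = (\<lambda>x. H #> x) ` ?S" (is "?A = _")
  proof
    show "?A \<subseteq> (\<lambda>x. H #> x) ` ?S" using eq by blast
    show "(\<lambda>x. H #> x) ` ?S \<subseteq> ?A"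
    proof clarify
      fix x y assume "x \<in> K" "y \<in> L"
      thus "\<exists>a b. H #> (x \<otimes> y \<otimes> inv x \<otimes> inv y) = a \<otimes>\<^bsub>G Mod H\<^esub> b \<otimes>\<^bsub>G Mod H\<^esub> inv\<^bsub>G Mod H\<^esub> a \<otimes>\<^bsub>G Mod H\<^esub> inv\<^bsub>G Mod H\<^esub> b \<and>
        a \<in> (\<lambda>x. H #> x) ` K \<and> b \<in> (\<lambda>x. H #> x) ` L"
        by (intro exI[of _ "H #> x"] exI[of _ "H #> y"]) (simp only: eq imageI simp_thms)
    qed
  qed
  thus ?thesis unfolding commutator_sub_def using h.generate_img[OF \<open>?S \<subseteq> carrier G\<close>] by simp
qed

lemma iter_comm_Mod:
  assumes "K \<lhd> G"
  shows "iter_comm (G Mod H) ((\<lambda>x. H #> x) ` K) n = (\<lambda>x. H #> x) ` iter_comm G K n"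
proof (induction n)
  case (Suc n)
  have "iter_comm G K n \<subseteq> carrier G" using iter_comm_normal[OF assms] normal_subset by blast
  thus ?case
    by (simp only: iter_comm_Suc Suc.IH carrier_FactGroup commutator_sub_Mod order_refl)
qed simp

lemma iter_comm_Mod_subset_iff:
  assumes "K \<lhd> G" "H \<subseteq> L" "subgroup L G"
  shows "iter_comm (G Mod H) ((\<lambda>x. H #> x) ` K) n \<subseteq> (\<lambda>x. H #> x) ` L \<longleftrightarrow> iter_comm G K n \<subseteq> L"
proof
  assume *: "iter_comm (G Mod H) ((\<lambda>x. H #> x) ` K) n \<subseteq> (\<lambda>x. H #> x) ` L"
  show "iter_comm G K n \<subseteq> L"
  proof
    fix x assume x: "x \<in> iter_comm G K n"
    hence xc: "x \<in> carrier G" using iter_comm_normal[OF assms(1)] normal_subset by blast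
    obtain l where l: "l \<in> L" "H #> x = H #> l" using * x by (auto simp: iter_comm_Mod[OF assms(1)])
    have lc: "l \<in> carrier G" using l subgroup.subset[OF assms(3)] by auto
    have "x \<otimes> inv l \<in> L" using l assms subgroup_rcos_eq_iff[OF is_subgroup xc lc] by auto
    hence "x \<otimes> inv l \<otimes> l \<in> L" using l assms by (simp add: subgroup.m_closed)
    thus "x \<in> L" using xc lc by (simp add: m_assoc)
  qed
qed (auto simp: iter_comm_Mod[OF assms(1)])

lemma iter_comm_Mod_trivial_iff:
  assumes "K \<lhd> G"
  shows "iter_comm (G Mod H) ((\<lambda>x. H #> x) ` K) n = {\<one>\<^bsub>G Mod H\<^esub>} \<longleftrightarrow> iter_comm G K n \<subseteq> H"
proof -
  have "H #> x = H" if "x \<in> H" for x using rcos_eq_one_iff[of x] that by simp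
  moreover have "\<one> \<in> H" by (rule subgroup.one_closed[OF is_subgroup])
  ultimately have "(\<lambda>x. H #> x) ` H = {H}" by (metis (no_types, lifting) empty_iff image_is_empty image_constant_conv image_cong)
  moreover have "H \<in> (\<lambda>x. H #> x) ` iter_comm G K n"
    using subgroup.one_closed[OF normal_imp_subgroup[OF iter_comm_normal[OF assms]]] subset
    by (metis coset_mult_one image_eqI)
  ultimately show ?thesis
    using iter_comm_Mod_subset_iff[OF assms order_refl is_subgroup, of n]
    unfolding iter_comm_Mod[OF assms, of n] one_FactGroup by (metis empty_iff subset_singletonD subset_refl)
qed

end

section \<open>Centralizers modulo a normal subgroup\<close>

definition centr :: "('a, 'b) monoid_scheme \<Rightarrow> 'a set \<Rightarrow> 'a set" where
  "centr G A = {g \<in> carrier G. \<forall>a\<in>A. g \<otimes>\<^bsub>G\<^esub> a \<otimes>\<^bsub>G\<^esub> inv\<^bsub>G\<^esub> g = a}"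

lemma (in group) conj_conj:
  "\<lbrakk>g \<in> carrier G; h \<in> carrier G; a \<in> carrier G\<rbrakk>
    \<Longrightarrow> g \<otimes> (h \<otimes> a \<otimes> inv h) \<otimes> inv g = (g \<otimes> h) \<otimes> a \<otimes> inv (g \<otimes> h)"
  by (simp add: word_simps)

lemma (in group) centr_normal:
  assumes A: "A \<lhd> G"
  shows "centr G A \<lhd> G"
proof (rule normal_invI)
  have Ac: "a \<in> carrier G" if "a \<in> A" for a using that normal_subset[OF A] by blast
  have conj: "g \<otimes> a \<otimes> inv g \<in> A" if "g \<in> carrier G" "a \<in> A" for g a
    using that A by (simp add: normal_inv_iff)
  have mult: "x \<otimes> y \<in> centr G A" if "x \<in> centr G A" "y \<in> centr G A" for x y
  proof -
    have c: "x \<in> carrier G" "y \<in> carrier G" using that by (auto simp: centr_def)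
    have "(x \<otimes> y) \<otimes> a \<otimes> inv (x \<otimes> y) = a" if a: "a \<in> A" for a
      using conj_conj[OF c Ac[OF a]] \<open>x \<in> centr G A\<close> \<open>y \<in> centr G A\<close> a by (simp add: centr_def)
    thus ?thesis using c by (simp add: centr_def)
  qed
  show "subgroup (centr G A) G"
  proof (rule subgroup.intro)
    show "\<one> \<in> centr G A" using Ac by (simp add: centr_def)
    fix x assume x: "x \<in> centr G A"
    hence c: "x \<in> carrier G" by (simp add: centr_def)
    have "inv x \<otimes> a \<otimes> inv (inv x) = a" if a: "a \<in> A" for a
    proof -
      have "inv x \<otimes> (x \<otimes> a \<otimes> inv x) \<otimes> inv (inv x) = a"
        using conj_conj[of "inv x" x a] c Ac[OF a] by simp
      thus ?thesis using x a by (simp add: centr_def)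
    qed
    thus "inv x \<in> centr G A" using c by (simp add: centr_def)
  qed (use mult in \<open>auto simp: centr_def\<close>)
  fix g x assume g: "g \<in> carrier G" and x: "x \<in> centr G A"
  hence c: "x \<in> carrier G" by (simp add: centr_def)
  have "(g \<otimes> x \<otimes> inv g) \<otimes> a \<otimes> inv (g \<otimes> x \<otimes> inv g) = a" if a: "a \<in> A" for a
  proof -
    have "(g \<otimes> x \<otimes> inv g) \<otimes> a \<otimes> inv (g \<otimes> x \<otimes> inv g) =
      g \<otimes> (x \<otimes> (inv g \<otimes> a \<otimes> inv (inv g)) \<otimes> inv x) \<otimes> inv g"
      using g c Ac[OF a] by (simp add: word_simps)
    also have "\<dots> = g \<otimes> (inv g \<otimes> a \<otimes> inv (inv g)) \<otimes> inv g"
      using x conj[of "inv g" a] g a by (simp add: centr_def)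
    also have "\<dots> = a" using g Ac[OF a] by (simp add: word_simps)
    finally show ?thesis .
  qed
  thus "g \<otimes> x \<otimes> inv g \<in> centr G A" using g c by (simp add: centr_def)
qed

lemma (in normal) Mod_preimage_normal:
  assumes "K \<lhd> G Mod H"
  shows "{x \<in> carrier G. H #> x \<in> K} \<lhd> G"
proof (rule normal_invI)
  interpret Q: group "G Mod H" by (rule factorgroup_is_group)
  interpret h: group_hom G "G Mod H" "\<lambda>x. H #> x" by (rule Mod_group_hom)
  show "subgroup {x \<in> carrier G. H #> x \<in> K} G"
    by (rule Mod_preimage_subgroup[OF normal_imp_subgroup[OF assms]])
  fix g x assume g: "g \<in> carrier G" and x: "x \<in> {x \<in> carrier G. H #> x \<in> K}"
  have "H #> (g \<otimes> x \<otimes> inv g) = (H #> g) \<otimes>\<^bsub>G Mod H\<^esub> (H #> x) \<otimes>\<^bsub>G Mod H\<^esub> inv\<^bsub>G Mod H\<^esub> (H #> g)"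
    using g x h.hom_mult h.hom_inv m_closed inv_closed by (metis (no_types, lifting) mem_Collect_eq)
  moreover have "H #> g \<in> carrier (G Mod H)" using g by (rule h.hom_closed)
  hence "(H #> g) \<otimes>\<^bsub>G Mod H\<^esub> (H #> x) \<otimes>\<^bsub>G Mod H\<^esub> inv\<^bsub>G Mod H\<^esub> (H #> g) \<in> K"
    using x assms unfolding Q.normal_inv_iff by blast
  ultimately show "g \<otimes> x \<otimes> inv g \<in> {x \<in> carrier G. H #> x \<in> K}" using g x by simp
qed

text \<open>For \<open>A = carrier G\<close> this is the preimage of the centre of
  \<open>G Mod M\<close>; for \<open>M \<subseteq> A\<close> it is the kernel of the action on
  \<open>A / M\<close>. It lives in \<open>G\<close> itself, so kernels for different
  \<open>M\<close> can be compared.\<close>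

definition centr_mod :: "('a, 'b) monoid_scheme \<Rightarrow> 'a set \<Rightarrow> 'a set \<Rightarrow> 'a set" where
  "centr_mod G A M = {g \<in> carrier G. \<forall>a\<in>A. g \<otimes>\<^bsub>G\<^esub> a \<otimes>\<^bsub>G\<^esub> inv\<^bsub>G\<^esub> g \<otimes>\<^bsub>G\<^esub> inv\<^bsub>G\<^esub> a \<in> M}"

lemma (in normal) rcos_mem_centr_iff:
  assumes A: "A \<subseteq> carrier G" and g: "g \<in> carrier G"
  shows "H #> g \<in> centr (G Mod H) ((\<lambda>x. H #> x) ` A) \<longleftrightarrow> g \<in> centr_mod G A H"
proof -
  interpret h: group_hom G "G Mod H" "\<lambda>x. H #> x" by (rule Mod_group_hom)
  have "(H #> g) \<otimes>\<^bsub>G Mod H\<^esub> (H #> a) \<otimes>\<^bsub>G Mod H\<^esub> inv\<^bsub>G Mod H\<^esub> (H #> g) = H #> a \<longleftrightarrow>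
      g \<otimes> a \<otimes> inv g \<otimes> inv a \<in> H" if a: "a \<in> A" for a
  proof -
    have ac: "a \<in> carrier G" using a A by blast
    have "(H #> g) \<otimes>\<^bsub>G Mod H\<^esub> (H #> a) \<otimes>\<^bsub>G Mod H\<^esub> inv\<^bsub>G Mod H\<^esub> (H #> g) = H #> (g \<otimes> a \<otimes> inv g)"
      using g ac h.hom_mult h.hom_inv m_closed inv_closed by metis
    thus ?thesis using subgroup_rcos_eq_iff[OF is_subgroup, of "g \<otimes> a \<otimes> inv g" a] g ac by simp
  qed
  moreover have "H #> g \<in> carrier (G Mod H)" using g by (rule h.hom_closed)
  ultimately show ?thesis using g by (simp add: centr_mod_def centr_def)
qed

lemma (in group) centr_mod_normal:
  assumes A: "A \<lhd> G" and M: "M \<lhd> G"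
  shows "centr_mod G A M \<lhd> G"
proof -
  interpret M: normal M G by (rule M)
  interpret Q: group "G Mod M" by (rule M.factorgroup_is_group)
  have "centr_mod G A M = {g \<in> carrier G. M #> g \<in> centr (G Mod M) ((\<lambda>x. M #> x) ` A)}"
    using M.rcos_mem_centr_iff[OF normal_subset[OF A]] by (auto simp: centr_mod_def)
  thus ?thesis by (simp add: M.Mod_preimage_normal Q.centr_normal M.Mod_image_normal[OF A])
qed

lemma (in normal) finite_rcosets_Mod:
  assumes A: "subgroup A G" "finite (rcosets A)"
  shows "finite (rcosets\<^bsub>G Mod H\<^esub> ((\<lambda>x. H #> x) ` A))"
proof -
  interpret Q: group "G Mod H" by (rule factorgroup_is_group)
  interpret h: group_hom G "G Mod H" "\<lambda>x. H #> x" by (rule Mod_group_hom)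
  obtain T where T: "finite T" "T \<subseteq> carrier G" "\<And>g. g \<in> carrier G \<Longrightarrow> \<exists>a\<in>A. \<exists>t\<in>T. g = a \<otimes> t"
    using A finite_rcosets_iff by metis
  have "\<exists>a\<in>(\<lambda>x. H #> x) ` A. \<exists>t\<in>(\<lambda>x. H #> x) ` T. q = a \<otimes>\<^bsub>G Mod H\<^esub> t" if q: "q \<in> carrier (G Mod H)" for q
  proof -
    obtain g where g: "g \<in> carrier G" "q = H #> g" using q by (auto simp: carrier_FactGroup)
    obtain a t where at: "a \<in> A" "t \<in> T" "g = a \<otimes> t" using T(3)[OF g(1)] by blast
    have "a \<in> carrier G" "t \<in> carrier G" using at T(2) subgroup.subset[OF A(1)] by auto
    hence "q = (H #> a) \<otimes>\<^bsub>G Mod H\<^esub> (H #> t)" using h.hom_mult[of a t] at(3) g(2) by simp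
    thus ?thesis using at by blast
  qed
  moreover have "(\<lambda>x. H #> x) ` T \<subseteq> carrier (G Mod H)" using T(2) by (auto simp: carrier_FactGroup)
  moreover have "finite ((\<lambda>x. H #> x) ` T)" using T(1) by simp
  ultimately show ?thesis
    using Q.finite_rcosets_iff[OF h.subgroup_img_is_subgroup[OF A(1)]] by blast
qed

section \<open>Finite quotients\<close>

text \<open>Elements of \<open>BijGroup E\<close> are extensional, whence the restriction to
  \<open>E\<close>. Bijectivity comes from the action of the inverse of \<open>g\<close>, so only
  the action laws have to be supplied.\<close>

lemma group_actionI:
  assumes "group G"
    and closed: "\<And>g x. \<lbrakk>g \<in> carrier G; x \<in> E\<rbrakk> \<Longrightarrow> act g x \<in> E"
    and one: "\<And>x. x \<in> E \<Longrightarrow> act \<one>\<^bsub>G\<^esub> x = x"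
    and mult: "\<And>g h x. \<lbrakk>g \<in> carrier G; h \<in> carrier G; x \<in> E\<rbrakk> \<Longrightarrow> act (g \<otimes>\<^bsub>G\<^esub> h) x = act g (act h x)"
  shows "group_action G E (\<lambda>g. \<lambda>x\<in>E. act g x)"
proof -
  interpret group G by fact
  have inv1: "act (inv\<^bsub>G\<^esub> g) (act g x) = x" "act g (act (inv\<^bsub>G\<^esub> g) x) = x"
    if "g \<in> carrier G" "x \<in> E" for g x
    using that mult[of "inv\<^bsub>G\<^esub> g" g x] mult[of g "inv\<^bsub>G\<^esub> g" x] one[of x] by simp_all
  have bij: "(\<lambda>x\<in>E. act g x) \<in> Bij E" if g: "g \<in> carrier G" for g
  proof -
    have "bij_betw (act g) E E"
      using g closed inv1 by (intro bij_betw_byWitness[where f' = "act (inv\<^bsub>G\<^esub> g)"]) auto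
    thus ?thesis by (simp add: Bij_def bij_betw_restrict_eq)
  qed
  have "(\<lambda>g. \<lambda>x\<in>E. act g x) \<in> hom G (BijGroup E)"
  proof (rule homI)
    fix g h assume gh: "g \<in> carrier G" "h \<in> carrier G"
    have "(\<lambda>x\<in>E. act (g \<otimes>\<^bsub>G\<^esub> h) x) = compose E (\<lambda>x\<in>E. act g x) (\<lambda>x\<in>E. act h x)"
      using gh closed mult by (auto simp: compose_def restrict_def)
    thus "(\<lambda>x\<in>E. act (g \<otimes>\<^bsub>G\<^esub> h) x) = (\<lambda>x\<in>E. act g x) \<otimes>\<^bsub>BijGroup E\<^esub> (\<lambda>x\<in>E. act h x)"
      using bij gh by (simp add: BijGroup_def)
  qed (use bij in \<open>simp add: BijGroup_def\<close>)
  thus ?thesis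
    by (simp add: group_action_def group_hom_def group_hom_axioms_def group_BijGroup is_group)
qed

text \<open>The non-fixed points split into orbits whose sizes are powers of \<open>p\<close> other
  than 1. Counting them instead of the fixed points avoids subtraction.\<close>

lemma (in group_action) p_group_dvd_card_non_fixed:
  assumes "Factorial_Ring.prime p" "order G = p ^ a" "finite E"
  shows "p dvd card (E - {x \<in> E. \<forall>g\<in>carrier G. \<phi> g x = x})" (is "_ dvd card (E - ?F)")
proof -
  interpret group G using group_hom group_hom.axioms(1) by auto
  let ?C = "(\<lambda>x. orbit G \<phi> x) ` (E - ?F)"
  have orbE: "orbit G \<phi> x \<subseteq> E" if "x \<in> E" for x
    using that element_image by (auto simp: orbit_def)
  have fix_orb: "orbit G \<phi> x = {x}" if "x \<in> ?F" for x
    using that by (auto simp: orbit_def intro: exI[of _ \<one>])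
  have "\<Union>?C = E - ?F"
  proof
    show "\<Union>?C \<subseteq> E - ?F"
    proof
      fix y assume "y \<in> \<Union>?C"
      then obtain x where x: "x \<in> E" "x \<notin> ?F" and y: "y \<in> orbit G \<phi> x" by blast
      have yE: "y \<in> E" using orbE x y by blast
      have "x \<in> orbit G \<phi> y" using orbit_sym[OF x(1) yE y] .
      have "y \<notin> ?F"
      proof
        assume "y \<in> ?F"
        hence "x = y" using fix_orb[of y] \<open>x \<in> orbit G \<phi> y\<close> by simp
        thus False using x \<open>y \<in> ?F\<close> by simp
      qed
      thus "y \<in> E - ?F" using yE by simp
    qed
    show "E - ?F \<subseteq> \<Union>?C" using orbit_refl by auto
  qed
  moreover have "p dvd card (\<Union>?C)"
  proof (rule dvd_partition)
    show "finite (\<Union>?C)" using \<open>\<Union>?C = E - ?F\<close> assms(3) by simp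
    show "\<forall>c\<in>?C. p dvd card c"
    proof
      fix c assume "c \<in> ?C"
      then obtain x where x: "x \<in> E" "x \<notin> ?F" and c: "c = orbit G \<phi> x" by blast
      have "card (orbit G \<phi> x) dvd p ^ a"
        using orbit_stabilizer_theorem[OF x(1)] assms(2) by (metis dvd_triv_left)
      then obtain i where i: "card (orbit G \<phi> x) = p ^ i"
        using divides_primepow_nat[OF assms(1)] by blast
      have "i \<noteq> 0"
      proof
        assume "i = 0"
        hence "card (orbit G \<phi> x) = 1" using i by simp
        then obtain y where "orbit G \<phi> x = {y}" by (meson card_1_singletonE)
        hence "orbit G \<phi> x = {x}" using orbit_refl[OF x(1)] by simp
        hence "\<phi> g x = x" if "g \<in> carrier G" for g using that by (auto simp: orbit_def)
        thus False using x by simp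
      qed
      thus "p dvd card c" using i c by simp
    qed
    have "orbit G \<phi> x \<in> orbits G E \<phi>" if "x \<in> E" for x using that by (auto simp: orbits_def)
    thus "\<forall>c1\<in>?C. \<forall>c2\<in>?C. c1 \<noteq> c2 \<longrightarrow> c1 \<inter> c2 = {}"
      using disjoint_union by (metis (no_types, lifting) Diff_iff imageE)
  qed
  ultimately show ?thesis by simp
qed

context group
begin

lemma subgroup_card_dvd:
  assumes "finite (carrier G)" "subgroup H G"
  shows "card H dvd order G"
  using lagrange[OF assms(2)] by (metis dvd_triv_right)

text \<open>\<open>P\<close> acts on the right cosets of \<open>S\<close> by translation, through
  \<open>inv g\<close> to obtain a left action. Their number is prime to \<open>p\<close>, so some
  \<open>S #> g\<close> is fixed, which says that \<open>g\<close> conjugates \<open>P\<close> into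
  \<open>S\<close>.\<close>

lemma p_subgroup_conj_into:
  assumes fin: "finite (carrier G)" and p: "Factorial_Ring.prime p"
    and P: "subgroup P G" "card P = p ^ a" and S: "subgroup S G" "\<not> p dvd card (rcosets S)"
  shows "\<exists>g\<in>carrier G. \<forall>x\<in>P. g \<otimes> x \<otimes> inv g \<in> S"
proof -
  interpret P: subgroup P G by fact
  let ?P = "G\<lparr>carrier := P\<rparr>"
  have Pc: "x \<in> carrier G" if "x \<in> P" for x using that by simp
  have SG: "S \<subseteq> carrier G" using S by (simp add: subgroup.subset)
  have "group_action ?P (rcosets S) (\<lambda>g. \<lambda>C\<in>rcosets S. C #> inv g)"
  proof (rule group_actionI)
    show "group ?P" using P(1) by (simp add: subgroup_imp_group)
    fix g C assume "g \<in> carrier ?P" "C \<in> rcosets S"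
    then obtain x where x: "x \<in> carrier G" "C = S #> x" "g \<in> carrier G" by (auto simp: RCOSETS_def)
    hence "C #> inv g = S #> (x \<otimes> inv g)" by (simp add: coset_mult_assoc SG)
    thus "C #> inv g \<in> rcosets S" using x SG by (auto intro!: rcosetsI)
  next
    fix C assume "C \<in> rcosets S"
    hence "C \<subseteq> carrier G" using S(1) by (simp add: subgroup.rcosets_carrier)
    thus "C #> inv \<one>\<^bsub>?P\<^esub> = C" by simp
  next
    fix g h C assume gh: "g \<in> carrier ?P" "h \<in> carrier ?P" and "C \<in> rcosets S"
    hence "C \<subseteq> carrier G" using S(1) by (simp add: subgroup.rcosets_carrier)
    thus "C #> inv (g \<otimes>\<^bsub>?P\<^esub> h) = C #> inv h #> inv g"
      using gh by (simp add: coset_mult_assoc inv_mult_group)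
  qed
  then interpret act: group_action ?P "rcosets S" "\<lambda>g. \<lambda>C\<in>rcosets S. C #> inv g" .
  have finE: "finite (rcosets S)"
    using fin by (simp add: RCOSETS_def)
  let ?F = "{C \<in> rcosets S. \<forall>g\<in>carrier ?P. (\<lambda>C\<in>rcosets S. C #> inv g) C = C}"
  have "p dvd card (rcosets S - ?F)"
    by (rule act.p_group_dvd_card_non_fixed[OF p _ finE]) (simp add: order_def P(2))
  hence "?F \<noteq> {}" using S(2) by (metis Diff_empty)
  then obtain C where C: "C \<in> rcosets S" "\<And>x. x \<in> P \<Longrightarrow> C #> inv x = C" by auto
  then obtain g where g: "g \<in> carrier G" "C = S #> g" by (auto simp: RCOSETS_def)
  have "g \<otimes> x \<otimes> inv g \<in> S" if x: "x \<in> P" for x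
  proof -
    have "S #> (g \<otimes> x) = S #> g"
      using C(2)[OF P.m_inv_closed[OF x]] x g SG by (simp add: coset_mult_assoc)
    thus ?thesis using subgroup_rcos_eq_iff[OF S(1), of "g \<otimes> x" g] x g by simp
  qed
  thus ?thesis using g by blast
qed

lemma conj_image_subgroup:
  assumes "subgroup S G" "g \<in> carrier G"
  shows "subgroup ((\<lambda>s. g \<otimes> s \<otimes> inv g) ` S) G"
proof -
  have "group_hom G G (\<lambda>s. g \<otimes> s \<otimes> inv g)"
    using assms(2) by (simp add: group_hom_def group_hom_axioms_def hom_def conj_mult)
  thus ?thesis using assms(1) by (rule group_hom.subgroup_img_is_subgroup)
qed

lemma conj_inj_on: "\<lbrakk>S \<subseteq> carrier G; g \<in> carrier G\<rbrakk> \<Longrightarrow> inj_on (\<lambda>s. g \<otimes> s \<otimes> inv g) S"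
  by (rule inj_onI) (metis conjugation_is_inj subsetD)

text \<open>Frattini argument: the normalizer of a Sylow subgroup is contranormal.\<close>

lemma contranormal_free_sylow_normal:
  assumes fin: "finite (carrier G)" and free: "contranormal_free G" and p: "Factorial_Ring.prime p"
    and S: "subgroup S G" "card S = p ^ a" and ord: "order G = p ^ a * m" "\<not> p dvd m"
  shows "S \<lhd> G"
proof -
  interpret S: subgroup S G by fact
  have SG: "S \<subseteq> carrier G" by (rule S.subset)
  have finS: "finite S" using fin SG finite_subset by blast
  define N where "N = {g \<in> carrier G. (\<lambda>s. g \<otimes> s \<otimes> inv g) ` S = S}"
  have memN: "g \<in> N" if g: "g \<in> carrier G" and *: "\<And>s. s \<in> S \<Longrightarrow> g \<otimes> s \<otimes> inv g \<in> S" for g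
  proof -
    have "(\<lambda>s. g \<otimes> s \<otimes> inv g) ` S \<subseteq> S" using * by (rule image_subsetI)
    hence "(\<lambda>s. g \<otimes> s \<otimes> inv g) ` S = S"
      using conj_inj_on[OF SG g] by (rule endo_inj_surj[OF finS])
    thus ?thesis using g by (simp add: N_def)
  qed
  have conjN: "g \<otimes> s \<otimes> inv g \<in> S" if "g \<in> N" "s \<in> S" for g s
    using that unfolding N_def by blast
  have "subgroup N G"
  proof (rule subgroup.intro)
    show "N \<subseteq> carrier G" by (auto simp: N_def)
    show "\<one> \<in> N" by (rule memN) auto
    fix g h assume gh: "g \<in> N" "h \<in> N"
    hence c: "g \<in> carrier G" "h \<in> carrier G" by (auto simp: N_def)
    show "g \<otimes> h \<in> N"
    proof (rule memN)
      fix s assume s: "s \<in> S"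
      have "g \<otimes> h \<otimes> s \<otimes> inv (g \<otimes> h) = g \<otimes> (h \<otimes> s \<otimes> inv h) \<otimes> inv g"
        using c s by (simp add: word_simps)
      thus "g \<otimes> h \<otimes> s \<otimes> inv (g \<otimes> h) \<in> S" using conjN gh s by simp
    qed (use c in simp)
  next
    fix g assume g: "g \<in> N"
    hence c: "g \<in> carrier G" by (simp add: N_def)
    show "inv g \<in> N"
    proof (rule memN)
      fix s assume "s \<in> S"
      then obtain t where t: "t \<in> S" "s = g \<otimes> t \<otimes> inv g" using g unfolding N_def by blast
      hence "inv g \<otimes> s \<otimes> inv (inv g) = t" using c by (simp add: word_simps)
      thus "inv g \<otimes> s \<otimes> inv (inv g) \<in> S" using t by simp
    qed (use c in simp)
  qed
  have "N = carrier G"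
  proof (rule contranormal_freeD[OF free \<open>subgroup N G\<close>])
    fix K assume K: "K \<lhd> G" "N \<subseteq> K"
    have sK: "subgroup K G" using K by (simp add: normal_imp_subgroup)
    have SK: "S \<subseteq> K"
    proof
      fix s assume "s \<in> S"
      hence "s \<in> N" by (intro memN) auto
      thus "s \<in> K" using K by blast
    qed
    let ?K = "G\<lparr>carrier := K\<rparr>"
    interpret K: group ?K using sK by (rule subgroup_imp_group)
    have KG: "K \<subseteq> carrier G" using K normal_subset by blast
    have sKS: "subgroup S ?K" using S(1) SK sK by (simp add: subgroup_incl)
    \<comment> \<open>The index of \<open>S\<close> in \<open>K\<close> divides its index
      \<open>m\<close> in \<open>G\<close>, so \<open>S\<close> is a Sylow subgroup of
      \<open>K\<close> as well.\<close>
    have "card (rcosets\<^bsub>?K\<^esub> S) * p ^ a dvd p ^ a * m"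
      using K.lagrange[OF sKS] S(2) subgroup_card_dvd[OF fin sK] ord by (simp add: order_def)
    hence "card (rcosets\<^bsub>?K\<^esub> S) dvd m" using p by (simp add: mult.commute prime_gt_0_nat)
    hence ndvd: "\<not> p dvd card (rcosets\<^bsub>?K\<^esub> S)" using ord dvd_trans by blast
    have "g \<in> K" if g: "g \<in> carrier G" for g
    proof -
      let ?P = "(\<lambda>s. g \<otimes> s \<otimes> inv g) ` S"
      have PK: "?P \<subseteq> K" using K(1) SK g by (auto simp: normal_inv_iff)
      have "subgroup ?P ?K" using conj_image_subgroup[OF S(1) g] PK sK by (simp add: subgroup_incl)
      moreover have "card ?P = p ^ a" using card_image[OF conj_inj_on[OF SG g]] S(2) by simp
      moreover have "finite (carrier ?K)" using fin KG finite_subset by auto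
      \<comment> \<open>\<open>k\<close> moves the conjugate of \<open>S\<close> by \<open>g\<close>
        back into \<open>S\<close>, so \<open>k \<otimes> g\<close> normalizes \<open>S\<close> and
        lies in \<open>N \<subseteq> K\<close>; cancelling \<open>k \<in> K\<close> gives
        \<open>g \<in> K\<close>.\<close>
      ultimately obtain k where k: "k \<in> K" "\<And>x. x \<in> ?P \<Longrightarrow> k \<otimes> x \<otimes> inv\<^bsub>?K\<^esub> k \<in> S"
        using K.p_subgroup_conj_into[OF _ p _ _ sKS ndvd, of ?P a] by auto
      have kc: "k \<in> carrier G" using k KG by blast
      have "k \<otimes> g \<in> N"
      proof (rule memN)
        fix s assume s: "s \<in> S"
        have "k \<otimes> (g \<otimes> s \<otimes> inv g) \<otimes> inv k \<in> S" using k s m_inv_consistent[OF sK k(1)] by auto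
        thus "k \<otimes> g \<otimes> s \<otimes> inv (k \<otimes> g) \<in> S" using kc g s by (simp add: word_simps)
      qed (use kc g in simp)
      hence "inv k \<otimes> (k \<otimes> g) \<in> K" using K(2) k sK by (auto intro: subgroup.m_closed subgroup.m_inv_closed)
      thus "g \<in> K" using kc g by (simp add: inv_cancel_left)
    qed
    thus "K = carrier G" using KG by blast
  qed
  thus "S \<lhd> G" using conjN S(1) by (intro normal_invI) auto
qed

text \<open>All Sylow subgroups are normal. A nontrivial \<open>x\<close> in the centre of one of
  them, \<open>S\<close>, commutes with \<open>S\<close> and also with the Sylow subgroups for the
  other primes, since these meet \<open>S\<close> trivially. So the order of the centralizer of
  \<open>x\<close> is divisible by every prime power in \<open>order G\<close>.\<close>

lemma contranormal_free_center_nontrivial: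
  assumes fin: "finite (carrier G)" and free: "contranormal_free G" and nt: "carrier G \<noteq> {\<one>}"
  shows "\<exists>x\<in>carrier G. x \<noteq> \<one> \<and> (\<forall>g\<in>carrier G. x \<otimes> g = g \<otimes> x)"
proof -
  have ord0: "order G \<noteq> 0" using fin order_gt_0_iff_finite by simp
  have sylow: "\<exists>S. S \<lhd> G \<and> card S = q ^ multiplicity q (order G)" if q: "Factorial_Ring.prime q" for q
  proof -
    obtain m where m: "order G = q ^ multiplicity q (order G) * m" "\<not> q dvd m"
      using multiplicity_decompose'[of "order G" q] ord0 q by (metis not_prime_unit)
    then obtain S where S: "subgroup S G" "card S = q ^ multiplicity q (order G)"
      using sylow_thm[OF q is_group _ fin] by blast
    thus ?thesis using contranormal_free_sylow_normal[OF fin free q S m] by blast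
  qed
  have "order G \<noteq> 1" using nt order_one_triv_iff by simp
  then obtain p where p: "Factorial_Ring.prime p" "p dvd order G" using prime_factor_nat by blast
  obtain S where S: "S \<lhd> G" "card S = p ^ multiplicity p (order G)" using sylow[OF p(1)] by blast
  interpret S: subgroup S G using S by (simp add: normal_imp_subgroup)
  have "multiplicity p (order G) > 0"
    using p ord0 prime_multiplicity_gt_zero_iff by blast
  hence pS: "p dvd card S" using S by simp
  let ?S = "G\<lparr>carrier := S\<rparr>"
  have finS: "finite S" using fin S.subset finite_subset by blast
  have "group_action ?S S (\<lambda>g. \<lambda>x\<in>S. g \<otimes> x \<otimes> inv g)"
    by (rule group_actionI) (auto simp: word_simps S.subgroup_is_group)
  then interpret act: group_action ?S S "\<lambda>g. \<lambda>x\<in>S. g \<otimes> x \<otimes> inv g" .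
  \<comment> \<open>\<open>?F\<close> is the centre of \<open>S\<close>, seen as the fixed points of
    conjugation; it contains \<open>\<one>\<close> and its size is divisible by
    \<open>p\<close>.\<close>
  let ?F = "{x \<in> S. \<forall>g\<in>carrier ?S. (\<lambda>x\<in>S. g \<otimes> x \<otimes> inv g) x = x}"
  have "p dvd card (S - ?F)"
    by (rule act.p_group_dvd_card_non_fixed[OF p(1) _ finS]) (simp add: order_def S(2))
  moreover have "card S = card (S - ?F) + card ?F"
    using finS by (subst card_Diff_subset) (auto simp: card_mono)
  ultimately have "p dvd card ?F" using pS by (simp add: dvd_add_right_iff)
  moreover have one: "\<one> \<in> ?F" by simp
  ultimately have "?F \<noteq> {\<one>}" using p(1) not_prime_1 by (intro notI) simp
  then obtain x where x: "x \<in> ?F" "x \<noteq> \<one>" using one by blast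
  have xS: "x \<in> S" "x \<in> carrier G" using x by auto
  define C where "C = {g \<in> carrier G. x \<otimes> g = g \<otimes> x}"
  have C: "subgroup C G"
  proof (rule subgroup.intro)
    fix g h assume "g \<in> C" "h \<in> C"
    hence gh: "g \<in> carrier G" "h \<in> carrier G" "x \<otimes> g = g \<otimes> x" "x \<otimes> h = h \<otimes> x" by (auto simp: C_def)
    have "x \<otimes> (g \<otimes> h) = g \<otimes> (x \<otimes> h)" using gh xS by (metis m_assoc)
    hence "x \<otimes> (g \<otimes> h) = g \<otimes> h \<otimes> x" using gh xS by (simp add: m_assoc)
    thus "g \<otimes> h \<in> C" using gh by (simp add: C_def)
  next
    fix g assume "g \<in> C"
    hence g: "g \<in> carrier G" "x \<otimes> g = g \<otimes> x" by (auto simp: C_def)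
    have "inv g \<otimes> (x \<otimes> g) \<otimes> inv g = inv g \<otimes> (g \<otimes> x) \<otimes> inv g" using g by simp
    hence "inv g \<otimes> x = x \<otimes> inv g" using g(1) xS by (simp add: word_simps)
    thus "inv g \<in> C" using g by (simp add: C_def)
  qed (use xS in \<open>auto simp: C_def\<close>)
  have "order G dvd card C"
  proof (rule multiplicity_le_imp_dvd[OF ord0])
    fix q :: nat assume q: "Factorial_Ring.prime q"
    \<comment> \<open>For \<open>q = p\<close> the Sylow subgroup has to be the \<open>S\<close>
      whose centre contains \<open>x\<close>.\<close>
    obtain U where U: "U \<lhd> G" "card U = q ^ multiplicity q (order G)" "q = p \<longrightarrow> U = S"
      using sylow[OF q] S by (cases "q = p") auto
    interpret U: subgroup U G using U by (simp add: normal_imp_subgroup)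
    have "U \<subseteq> C"
    proof
      fix u assume u: "u \<in> U"
      show "u \<in> C"
      proof (cases "q = p")
        case True
        hence "u \<otimes> x \<otimes> inv u = x" using x u U by auto
        hence "u \<otimes> x \<otimes> inv u \<otimes> u = x \<otimes> u" by simp
        thus ?thesis using u xS by (simp add: C_def word_simps)
      next
        case False
        have sub: "subgroup (S \<inter> U) G" using subgroups_Inter_pair S.is_subgroup U.is_subgroup by blast
        have "card (S \<inter> U) dvd card S" "card (S \<inter> U) dvd card U"
          using group.subgroup_card_dvd[of ?S "S \<inter> U"] group.subgroup_card_dvd[of "G\<lparr>carrier := U\<rparr>" "S \<inter> U"]
            subgroup_incl[OF sub S.is_subgroup] subgroup_incl[OF sub U.is_subgroup]
            subgroup_imp_group[OF S.is_subgroup] subgroup_imp_group[OF U.is_subgroup]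
            finite_subset[OF S.subset fin] finite_subset[OF U.subset fin]
          by (simp_all add: order_def)
        moreover have "coprime (card S) (card U)"
          using False q p S U by (auto simp: primes_coprime)
        ultimately have "card (S \<inter> U) = 1" by (metis coprime_common_divisor_nat)
        then obtain y where "S \<inter> U = {y}" by (meson card_1_singletonE)
        hence SU: "S \<inter> U = {\<one>}" using S.one_closed U.one_closed by (metis IntI singletonD)
        have "x \<otimes> (u \<otimes> inv x \<otimes> inv u) \<in> S" "x \<otimes> u \<otimes> inv x \<otimes> inv u \<in> U"
          using x u xS S(1) U(1) by (auto simp: normal_inv_iff)
        hence "x \<otimes> u \<otimes> inv x \<otimes> inv u = \<one>" using SU xS u by (auto simp: m_assoc)
        hence "x \<otimes> u \<otimes> inv x \<otimes> inv u \<otimes> u \<otimes> x = u \<otimes> x" using xS u by simp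
        thus ?thesis using xS u by (simp add: C_def word_simps)
      qed
    qed
    hence "subgroup U (G\<lparr>carrier := C\<rparr>)" using C U.is_subgroup by (simp add: subgroup_incl)
    hence "card U dvd card C"
      using group.subgroup_card_dvd[OF subgroup_imp_group[OF C], of U]
        finite_subset[OF subgroup.subset[OF C] fin] by (simp add: order_def)
    moreover have "card C \<noteq> 0"
      using finite_subset[OF subgroup.subset[OF C] fin] subgroup.one_closed[OF C] by auto
    ultimately show "multiplicity q (order G) \<le> multiplicity q (card C)"
      using U(2) q by (metis multiplicity_geI not_prime_unit)
  qed
  hence "card C = order G"
    using subgroup_card_dvd[OF fin C] dvd_antisym by blast
  hence "C = carrier G" using card_subset_eq[OF fin subgroup.subset[OF C]] by (simp add: order_def)
  thus ?thesis using x xS by (auto simp: C_def)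
qed

text \<open>The upper central series of the finite quotient is climbed through preimages in
  \<open>G\<close>: if \<open>W\<close> is the preimage of the centre of \<open>G Mod Z\<close> and
  the lower central series reaches \<open>W\<close>, one more commutator takes it into
  \<open>Z\<close>. Fewer elements of \<open>T\<close> lie outside \<open>W\<close> than outside
  \<open>Z\<close>, because \<open>T\<close> represents all cosets of
  \<open>M \<subseteq> Z\<close>.\<close>

lemma contranormal_free_lower_central_subset:
  assumes free: "contranormal_free G" and M: "M \<lhd> G" "finite (rcosets M)"
  shows "\<exists>n. lower_central G n \<subseteq> M"
proof -
  obtain T where T: "finite T" "T \<subseteq> carrier G" "\<And>g. g \<in> carrier G \<Longrightarrow> \<exists>a\<in>M. \<exists>t\<in>T. g = a \<otimes> t"
    using M finite_rcosets_iff normal_imp_subgroup by metis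
  have "\<exists>n. lower_central G n \<subseteq> Z" if "Z \<lhd> G" "M \<subseteq> Z" for Z
    using that
  proof (induction "card (T - Z)" arbitrary: Z rule: less_induct)
    case less
    interpret Z: normal Z G by (rule less.prems)
    show ?case
    proof (cases "Z = carrier G")
      case True
      thus ?thesis by (intro exI[of _ 0]) simp
    next
      case False
      interpret Q: group "G Mod Z" by (rule Z.factorgroup_is_group)
      have sZ: "subgroup Z G" by (rule Z.is_subgroup)
      have "rcosets Z \<subseteq> (\<lambda>t. Z #> t) ` T"
      proof
        fix C assume "C \<in> rcosets Z"
        then obtain g where g: "g \<in> carrier G" "C = Z #> g" by (auto simp: RCOSETS_def)
        then obtain a t where at: "a \<in> M" "t \<in> T" "g = a \<otimes> t" using T by blast
        have "a \<in> carrier G" "t \<in> carrier G" "a \<in> Z" using at T less.prems Z.subset by auto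
        hence "Z #> g = Z #> t" using at g by (simp add: subgroup_rcos_eq_iff[OF sZ] m_assoc)
        thus "C \<in> (\<lambda>t. Z #> t) ` T" using g at by auto
      qed
      hence "finite (rcosets Z)" using T(1) finite_surj by blast
      hence finQ: "finite (carrier (G Mod Z))" by (simp add: FactGroup_def)
      obtain y where "y \<in> carrier G" "y \<notin> Z" using False Z.subset by blast
      hence "Z #> y \<in> carrier (G Mod Z)" "Z #> y \<noteq> \<one>\<^bsub>G Mod Z\<^esub>"
        using Z.rcos_eq_one_iff by (auto simp: carrier_FactGroup)
      hence "carrier (G Mod Z) \<noteq> {\<one>\<^bsub>G Mod Z\<^esub>}" by blast
      then obtain X' where X': "X' \<in> carrier (G Mod Z)" "X' \<noteq> \<one>\<^bsub>G Mod Z\<^esub>"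
        "\<And>g. g \<in> carrier (G Mod Z) \<Longrightarrow> X' \<otimes>\<^bsub>G Mod Z\<^esub> g = g \<otimes>\<^bsub>G Mod Z\<^esub> X'"
        using Q.contranormal_free_center_nontrivial[OF finQ Z.contranormal_free_Mod[OF free]] by blast
      obtain x where x: "x \<in> carrier G" "X' = Z #> x" using X'(1) by (auto simp: carrier_FactGroup)
      have xZ: "x \<notin> Z" using X'(2) x Z.rcos_eq_one_iff by simp
      define W where "W = centr_mod G (carrier G) Z"
      have nW: "W \<lhd> G" unfolding W_def by (rule centr_mod_normal[OF normal_self less.prems(1)])
      have sW: "subgroup W G" using nW by (rule normal_imp_subgroup)
      have W_iff: "w \<in> W \<longleftrightarrow> (\<forall>g\<in>carrier G. w \<otimes> g \<otimes> inv w \<otimes> inv g \<in> Z)" if "w \<in> carrier G" for w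
        using that by (simp add: W_def centr_mod_def)
      have xW: "x \<in> W"
      proof -
        have "x \<otimes> g \<otimes> inv x \<otimes> inv g \<in> Z" if g: "g \<in> carrier G" for g
        proof -
          have "Z #> (x \<otimes> g) = Z #> (g \<otimes> x)"
            using X'(3)[of "Z #> g"] g x by (auto simp: carrier_FactGroup Z.rcos_sum)
          thus ?thesis using g x subgroup_rcos_eq_iff[OF sZ, of "x \<otimes> g" "g \<otimes> x"] by (simp add: word_simps)
        qed
        thus ?thesis using x W_iff by simp
      qed
      have ZW: "Z \<subseteq> W"
      proof
        fix z assume z: "z \<in> Z"
        have "z \<otimes> (g \<otimes> inv z \<otimes> inv g) \<in> Z" if "g \<in> carrier G" for g
          using that z by (intro Z.m_closed Z.inv_op_closed2) auto
        thus "z \<in> W" using z W_iff[of z] Z.subset by (auto simp: m_assoc)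
      qed
      obtain a t where at: "a \<in> M" "t \<in> T" "x = a \<otimes> t" using T(3)[OF x(1)] by blast
      have aZ: "a \<in> Z" using at less.prems by blast
      have tc: "t \<in> carrier G" using at T by blast
      have "t = inv a \<otimes> x" using at tc aZ by (simp add: inv_cancel_left)
      hence "t \<in> W" using sW xW ZW aZ by (auto intro: subgroup.m_closed subgroup.m_inv_closed)
      moreover have "t \<notin> Z" using xZ at(3) aZ by auto
      ultimately have "T - W \<subset> T - Z" using at(2) ZW by blast
      hence "card (T - W) < card (T - Z)" using T(1) by (simp add: psubset_card_mono)
      then obtain n where n: "lower_central G n \<subseteq> W" using less.hyps[of W] nW ZW less.prems by blast
      have "commutator_sub G W (carrier G) \<subseteq> Z"
      proof (rule commutator_sub_leI[OF sZ])
        fix w g assume "w \<in> W" "g \<in> carrier G"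
        thus "w \<otimes> g \<otimes> inv w \<otimes> inv g \<in> Z" using W_iff[of w] normal_subset[OF nW] by blast
      qed
      hence "lower_central G (Suc n) \<subseteq> Z" using commutator_sub_mono[OF n order_refl] by auto
      thus ?thesis by blast
    qed
  qed
  thus ?thesis using M(1) by blast
qed

end

section \<open>Abelian groups with finitely many operators\<close>

lemma (in group) subgroup_nat_pow_closed:
  assumes "subgroup H G" "h \<in> H"
  shows "h [^] (n::nat) \<in> H"
  using subgroup_int_pow_closed[OF assms, of "int n"] by (simp add: int_pow_int)

lemma (in group) subgroup_coprime_pow:
  assumes D: "subgroup D G" and y: "y \<in> carrier G" "y [^] (m::int) \<in> D" "y [^] (n::int) \<in> D"
    and "coprime m n"
  shows "y \<in> D"
proof -
  obtain u v where uv: "u * m + v * n = 1" using bezout_int[of m n] assms(5) by auto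
  have "(y [^] m) [^] u \<otimes> (y [^] n) [^] v \<in> D"
    by (rule subgroup.m_closed[OF D]; rule subgroup_int_pow_closed[OF D]; fact)
  also have "(y [^] m) [^] u \<otimes> (y [^] n) [^] v = y [^] (u * m + v * n)"
    using y(1) by (simp add: int_pow_pow int_pow_mult mult.commute)
  finally show ?thesis using uv y(1) by simp
qed

lemma (in group) subgroup_chain_Union:
  assumes "\<And>H. H \<in> \<C> \<Longrightarrow> subgroup H G" "\<C> \<noteq> {}"
    and chain: "\<And>H K. \<lbrakk>H \<in> \<C>; K \<in> \<C>\<rbrakk> \<Longrightarrow> H \<subseteq> K \<or> K \<subseteq> H"
  shows "subgroup (\<Union>\<C>) G"
proof (rule subgroup.intro)
  show "\<Union>\<C> \<subseteq> carrier G" using assms(1) subgroup.subset by blast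
  show "\<one> \<in> \<Union>\<C>" using assms(1,2) subgroup.one_closed by blast
  fix x assume "x \<in> \<Union>\<C>"
  then obtain H where "H \<in> \<C>" "x \<in> H" by blast
  thus "inv x \<in> \<Union>\<C>" using subgroup.m_inv_closed[OF assms(1)[of H], of x] by blast
next
  fix x y assume "x \<in> \<Union>\<C>" "y \<in> \<Union>\<C>"
  then obtain H K where HK: "H \<in> \<C>" "x \<in> H" "K \<in> \<C>" "y \<in> K" by blast
  then obtain L where "L \<in> \<C>" "x \<in> L" "y \<in> L" using chain[of H K] by blast
  thus "x \<otimes> y \<in> \<Union>\<C>" using subgroup.m_closed[OF assms(1)[of L], of x y] by blast
qed

section \<open>Subgroups maximal with respect to avoiding an element\<close>

context comm_group
begin

definition adjoin :: "'a set \<Rightarrow> 'a \<Rightarrow> 'a set" where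
  "adjoin D b = {d \<otimes> b [^] (n::int) | d n. d \<in> D}"

lemma adjoin_subgroup:
  assumes "subgroup D G" "b \<in> carrier G"
  shows "subgroup (adjoin D b) G"
proof (rule subgroup.intro)
  interpret D: subgroup D G by fact
  show "adjoin D b \<subseteq> carrier G" using assms(2) by (auto simp: adjoin_def)
  have "\<one> \<otimes> b [^] (0::int) \<in> adjoin D b" unfolding adjoin_def using D.one_closed by blast
  thus "\<one> \<in> adjoin D b" by simp
  fix x y assume "x \<in> adjoin D b" "y \<in> adjoin D b"
  then obtain d n e m where "d \<in> D" "e \<in> D" "x = d \<otimes> b [^] (n::int)" "y = e \<otimes> b [^] (m::int)"
    by (auto simp: adjoin_def)
  moreover from this have "x \<otimes> y = (d \<otimes> e) \<otimes> b [^] (n + m)"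
    using assms(2) by (simp add: int_pow_mult m_ac)
  ultimately show "x \<otimes> y \<in> adjoin D b" unfolding adjoin_def using D.m_closed by blast
next
  interpret D: subgroup D G by fact
  fix x assume "x \<in> adjoin D b"
  then obtain d n where "d \<in> D" "x = d \<otimes> b [^] (n::int)" by (auto simp: adjoin_def)
  moreover from this have "inv x = inv d \<otimes> b [^] (- n)"
    using assms(2) by (simp add: int_pow_neg inv_mult)
  ultimately show "inv x \<in> adjoin D b" unfolding adjoin_def using D.m_inv_closed by blast
qed

lemma adjoin_incl:
  assumes "subgroup D G" "b \<in> carrier G"
  shows "D \<subseteq> adjoin D b" "b \<in> adjoin D b"
proof -
  show "D \<subseteq> adjoin D b"
  proof
    fix d assume d: "d \<in> D"
    hence "d = d \<otimes> b [^] (0::int)" using assms subgroup.mem_carrier by fastforce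
    thus "d \<in> adjoin D b" unfolding adjoin_def using d by blast
  qed
  have "b = \<one> \<otimes> b [^] (1::int)" using assms(2) by simp
  thus "b \<in> adjoin D b" unfolding adjoin_def using subgroup.one_closed[OF assms(1)] by blast
qed

text \<open>Maximality is tested on extensions by one element, which is how it is used. In the
  quotient by \<open>D\<close> it says that every nontrivial subgroup contains the image of
  \<open>c\<close>.\<close>

definition max_avoiding :: "'a \<Rightarrow> 'a set \<Rightarrow> bool" where
  "max_avoiding c D \<longleftrightarrow> subgroup D G \<and> c \<in> carrier G \<and> c \<notin> D \<and> (\<forall>b\<in>carrier G. b \<notin> D \<longrightarrow> c \<in> adjoin D b)"

lemma max_avoiding_exists:
  assumes K: "subgroup K G" and c: "c \<in> carrier G" "c \<notin> K"
  shows "\<exists>D. K \<subseteq> D \<and> max_avoiding c D"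
proof -
  let ?A = "{D. subgroup D G \<and> K \<subseteq> D \<and> c \<notin> D}"
  have "\<exists>M\<in>?A. \<forall>Y\<in>?A. M \<subseteq> Y \<longrightarrow> Y = M"
  proof (rule subset_Zorn_nonempty)
    show "?A \<noteq> {}" using K c by blast
    fix \<C> assume ne: "\<C> \<noteq> {}" and ch: "subset.chain ?A \<C>"
    have sub: "\<C> \<subseteq> ?A" using ch by (simp add: subset.chain_def)
    have "subgroup (\<Union>\<C>) G"
    proof (rule subgroup_chain_Union)
      show "H \<subseteq> L \<or> L \<subseteq> H" if "H \<in> \<C>" "L \<in> \<C>" for H L
        using ch that by (auto simp: subset_chain_def)
    qed (use sub ne in auto)
    thus "\<Union>\<C> \<in> ?A" using sub ne by blast
  qed
  then obtain D where DA: "D \<in> ?A" and max': "\<forall>Y\<in>?A. D \<subseteq> Y \<longrightarrow> Y = D" by (rule bexE)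
  have D: "subgroup D G" "K \<subseteq> D" "c \<notin> D" using DA by auto
  have max: "Y = D" if "subgroup Y G" "K \<subseteq> Y" "c \<notin> Y" "D \<subseteq> Y" for Y
    using max' that by simp
  have "c \<in> adjoin D b" if b: "b \<in> carrier G" "b \<notin> D" for b
  proof (rule ccontr)
    assume "c \<notin> adjoin D b"
    hence "adjoin D b = D"
      using max[OF adjoin_subgroup[OF D(1) b(1)]] adjoin_incl[OF D(1) b(1)] D(2) by blast
    thus False using adjoin_incl(2)[OF D(1) b(1)] b by blast
  qed
  thus ?thesis using D c by (auto simp: max_avoiding_def)
qed

lemma max_avoiding_pow:
  assumes "max_avoiding c D" "b \<in> carrier G" "b \<notin> D"
  shows "\<exists>n::int. \<exists>d\<in>D. c = d \<otimes> b [^] n"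
  using assms by (auto simp: max_avoiding_def adjoin_def)

end

section \<open>Finitely many operators and invariant cores\<close>

locale endo_group = comm_group G for G (structure) +
  fixes \<Phi> :: "('a \<Rightarrow> 'a) set"
  assumes finite_endos: "finite \<Phi>"
    and endo_hom: "f \<in> \<Phi> \<Longrightarrow> f \<in> hom G G"
    and endo_comp: "\<lbrakk>f \<in> \<Phi>; g \<in> \<Phi>\<rbrakk> \<Longrightarrow> \<exists>h\<in>\<Phi>. \<forall>a\<in>carrier G. h a = f (g a)"
    and endo_id: "\<exists>e\<in>\<Phi>. \<forall>a\<in>carrier G. e a = a"
begin

lemma endo_group_hom: "f \<in> \<Phi> \<Longrightarrow> group_hom G G f"
  using endo_hom by (simp add: group_hom_def group_hom_axioms_def)

definition invariant :: "'a set \<Rightarrow> bool" where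
  "invariant D \<longleftrightarrow> subgroup D G \<and> (\<forall>f\<in>\<Phi>. \<forall>a\<in>D. f a \<in> D)"

text \<open>Closure of \<open>\<Phi>\<close> under composition makes this invariant, and the
  identity in \<open>\<Phi>\<close> puts it inside \<open>D\<close>: it is the largest invariant
  part of \<open>D\<close>, cut out by finitely many preimages of \<open>D\<close>.\<close>

definition core :: "'a set \<Rightarrow> 'a set" where
  "core D = {a \<in> carrier G. \<forall>f\<in>\<Phi>. f a \<in> D}"

lemma core_subset: "core D \<subseteq> D"
  using endo_id by (auto simp: core_def)

lemma core_subgroup:
  assumes "subgroup D G"
  shows "subgroup (core D) G"
proof (rule subgroup.intro)
  interpret D: subgroup D G by fact
  have hom: "f \<one> = \<one>" "a \<in> carrier G \<Longrightarrow> f (inv a) = inv (f a)"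
    "a \<in> carrier G \<Longrightarrow> b \<in> carrier G \<Longrightarrow> f (a \<otimes> b) = f a \<otimes> f b" if "f \<in> \<Phi>" for f a b
  proof -
    interpret f: group_hom G G f using that by (rule endo_group_hom)
    show "f \<one> = \<one>" "a \<in> carrier G \<Longrightarrow> f (inv a) = inv (f a)"
      "a \<in> carrier G \<Longrightarrow> b \<in> carrier G \<Longrightarrow> f (a \<otimes> b) = f a \<otimes> f b" by simp_all
  qed
  show "core D \<subseteq> carrier G" by (auto simp: core_def)
  show "\<one> \<in> core D"
  proof -
    have "f \<one> \<in> D" if "f \<in> \<Phi>" for f using hom(1)[OF that] by simp
    thus ?thesis by (simp add: core_def)
  qed
  show "a \<otimes> b \<in> core D" if ab: "a \<in> core D" "b \<in> core D" for a b
  proof -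
    have "f (a \<otimes> b) \<in> D" if "f \<in> \<Phi>" for f using hom(3)[OF that, of a b] ab that by (simp add: core_def)
    thus ?thesis using ab by (simp add: core_def)
  qed
  show "inv a \<in> core D" if a: "a \<in> core D" for a
  proof -
    have "f (inv a) \<in> D" if "f \<in> \<Phi>" for f using hom(2)[OF that, of a] a that by (simp add: core_def)
    thus ?thesis using a by (simp add: core_def)
  qed
qed

lemma core_invariant:
  assumes "subgroup D G"
  shows "invariant (core D)"
proof -
  have "f a \<in> core D" if f: "f \<in> \<Phi>" and a: "a \<in> core D" for f a
  proof -
    have ac: "a \<in> carrier G" using a by (simp add: core_def)
    have "g (f a) \<in> D" if g: "g \<in> \<Phi>" for g
    proof -
      obtain h where "h \<in> \<Phi>" "h a = g (f a)" using endo_comp[OF g f] ac by blast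
      thus ?thesis using a by (auto simp: core_def)
    qed
    thus ?thesis using hom_in_carrier[OF endo_hom[OF f] ac] by (simp add: core_def)
  qed
  thus ?thesis using core_subgroup[OF assms] by (simp add: invariant_def)
qed

text \<open>The coset of \<open>b\<close> modulo \<open>core D\<close> is determined by the cosets
  of all \<open>f b\<close> modulo \<open>D\<close>, and each of these has at most \<open>s\<close>
  possibilities. \<open>W\<close> is a socle in one application and the whole group in
  another.\<close>

lemma finite_core_cosets:
  assumes D: "subgroup D G" and c: "c \<in> carrier G" and W: "W \<subseteq> carrier G"
    and cov: "\<And>b f. \<lbrakk>b \<in> W; f \<in> \<Phi>\<rbrakk> \<Longrightarrow> \<exists>i<(s::nat). f b \<otimes> inv (c [^] i) \<in> D"
  shows "finite ((\<lambda>b. core D #> b) ` W)"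
proof -
  interpret D: subgroup D G by fact
  define \<iota> :: "'a \<Rightarrow> ('a \<Rightarrow> 'a) \<Rightarrow> nat" where "\<iota> b f = (SOME i. i < s \<and> f b \<otimes> inv (c [^] i) \<in> D)" for b f
  have \<iota>: "\<iota> b f < s \<and> f b \<otimes> inv (c [^] \<iota> b f) \<in> D" if "b \<in> W" "f \<in> \<Phi>" for b f
    unfolding \<iota>_def by (rule someI_ex) (rule cov[OF that])
  define h :: "'a \<Rightarrow> ('a \<Rightarrow> 'a) \<Rightarrow> nat" where "h b = restrict (\<iota> b) \<Phi>" for b
  have "h ` W \<subseteq> (\<Pi>\<^sub>E f\<in>\<Phi>. {..<s})" using \<iota> by (auto simp: h_def)
  hence fin: "finite (h ` W)" by (rule finite_subset) (simp add: finite_PiE finite_endos)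
  have eq: "core D #> b = core D #> b'" if b: "b \<in> W" "b' \<in> W" "h b = h b'" for b b'
  proof -
    have bc: "b \<in> carrier G" "b' \<in> carrier G" using b W by auto
    have "f (b \<otimes> inv b') \<in> D" if f: "f \<in> \<Phi>" for f
    proof -
      interpret f: group_hom G G f using f by (rule endo_group_hom)
      define i where "i = \<iota> b f"
      have "h b f = h b' f" using b(3) by simp
      hence i: "\<iota> b' f = i" using f by (simp add: h_def i_def)
      have "(f b \<otimes> inv (c [^] i)) \<otimes> inv (f b' \<otimes> inv (c [^] i)) \<in> D"
      proof (rule D.m_closed)
        show "f b \<otimes> inv (c [^] i) \<in> D" using \<iota>[OF b(1) f] by (simp add: i_def)
        have "f b' \<otimes> inv (c [^] i) \<in> D" using \<iota>[OF b(2) f] i by simp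
        thus "inv (f b' \<otimes> inv (c [^] i)) \<in> D" by (rule D.m_inv_closed)
      qed
      also have "(f b \<otimes> inv (c [^] i)) \<otimes> inv (f b' \<otimes> inv (c [^] i)) = f (b \<otimes> inv b')"
        using bc c by (simp add: word_simps m_comm[of "inv (f b')"])
      finally show ?thesis .
    qed
    hence "b \<otimes> inv b' \<in> core D" using bc by (simp add: core_def)
    thus ?thesis using bc subgroup_rcos_eq_iff[OF core_subgroup[OF D]] by simp
  qed
  have "(\<lambda>b. core D #> b) ` W \<subseteq> (\<lambda>k. core D #> (inv_into W h k)) ` (h ` W)"
  proof
    fix C assume "C \<in> (\<lambda>b. core D #> b) ` W"
    then obtain b where b: "b \<in> W" "C = core D #> b" by blast
    have "C = core D #> inv_into W h (h b)"
      using b eq[of "inv_into W h (h b)" b] by (simp add: inv_into_into f_inv_into_f)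
    thus "C \<in> (\<lambda>k. core D #> (inv_into W h k)) ` (h ` W)" using b by blast
  qed
  thus ?thesis using fin finite_surj by blast
qed

end

lemma antimono_finite_stabilises:
  fixes V :: "nat \<Rightarrow> 'a set"
  assumes "\<And>i j. i \<le> j \<Longrightarrow> V j \<subseteq> V i" "finite (V 0)"
  shows "\<exists>k. \<forall>j\<ge>k. V j = V k"
proof -
  obtain k where k: "\<And>j. card (V k) \<le> card (V j)"
    using ex_has_least_nat[of "\<lambda>_. True" 0 "\<lambda>k. card (V k)"] by blast
  have "V j = V k" if "j \<ge> k" for j
  proof (rule card_seteq)
    show "finite (V k)" using assms(1)[of 0 k] assms(2) finite_subset by blast
    show "V j \<subseteq> V k" using assms(1) that by blast
  qed (rule k)
  thus ?thesis by blast
qed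

lemma coprime_primeI:
  fixes p m :: "'a::{factorial_semiring_gcd}"
  assumes "Factorial_Ring.prime p" "\<not> p dvd m"
  shows "coprime m p"
  using prime_imp_coprime[OF assms] by (simp only: coprime_commute)

context comm_group
begin

lemma pow_divide:
  assumes "x \<in> carrier G" "y \<in> carrier G"
  shows "(x \<otimes> inv y) [^] (n::nat) = x [^] n \<otimes> inv (y [^] n)"
  using assms by (simp add: nat_pow_distrib nat_pow_inv)

lemma pow_preimage_subgroup:
  assumes "subgroup D G"
  shows "subgroup {a \<in> carrier G. a [^] (n::nat) \<in> D} G"
proof (rule subgroup.intro)
  interpret D: subgroup D G by fact
  show "inv x \<in> {a \<in> carrier G. a [^] n \<in> D}" if "x \<in> {a \<in> carrier G. a [^] n \<in> D}" for x
    using that by (simp add: nat_pow_inv)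
  show "x \<otimes> y \<in> {a \<in> carrier G. a [^] n \<in> D}"
    if "x \<in> {a \<in> carrier G. a [^] n \<in> D}" "y \<in> {a \<in> carrier G. a [^] n \<in> D}" for x y
    using that by (simp add: nat_pow_distrib)
  show "\<one> \<in> {a \<in> carrier G. a [^] n \<in> D}" by simp
qed auto

end

locale superfluous_pth_powers = endo_group +
  fixes p :: nat
  assumes prime_p: "Factorial_Ring.prime p"
    and superfluous: "\<And>D. \<lbrakk>invariant D; \<And>a. a \<in> carrier G \<Longrightarrow> \<exists>d\<in>D. \<exists>b\<in>carrier G. a = d \<otimes> b [^] p\<rbrakk>
      \<Longrightarrow> D = carrier G"
begin

lemma prime_int_p: "Factorial_Ring.prime (int p)"
  using prime_p by simp

text \<open>An element \<open>a\<close> without \<open>p\<close>-power order yields a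
  \<open>D\<close> modulo which all orders are prime to \<open>p\<close>. Then every element is a
  \<open>p\<close>-th power modulo \<open>D\<close>, and even modulo \<open>core D\<close>, so
  superfluity makes \<open>core D\<close> the whole group, against
  \<open>c \<notin> D\<close>.\<close>

lemma p_torsion:
  assumes a: "a \<in> carrier G"
  shows "\<exists>k. a [^] (p ^ k) = \<one>"
proof (rule ccontr)
  assume notor: "\<nexists>k. a [^] (p ^ k) = \<one>"
  \<comment> \<open>If \<open>a\<close> has finite order, \<open>c\<close> is a power of
    \<open>a\<close> whose order is prime to \<open>p\<close>, and \<open>K\<close> is trivial.
    Otherwise \<open>c = a\<close> and \<open>K\<close> is generated by
    \<open>a [^] (p + 1)\<close>, which misses \<open>a\<close>; the exponent \<open>p + 1\<close>
    is prime to \<open>p\<close>.\<close>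
  have "\<exists>c l K. c \<in> carrier G \<and> subgroup K G \<and> c \<notin> K \<and> c [^] (l::int) \<in> K \<and> coprime l (int p)"
  proof (cases "\<exists>n>0. a [^] (n::nat) = \<one>")
    case True
    then obtain n where n: "n > 0" "a [^] (n::nat) = \<one>" by blast
    obtain m where m: "n = p ^ multiplicity p n * m" "\<not> p dvd m"
      using multiplicity_decompose'[of n p] n prime_p by (metis not_prime_unit not_gr_zero)
    let ?c = "a [^] (p ^ multiplicity p n)"
    have "?c [^] m = \<one>" using n m(1) a by (metis nat_pow_pow)
    hence "?c [^] (int m) \<in> {\<one>}" by (simp add: int_pow_int)
    moreover have "coprime (int m) (int p)"
      using coprime_primeI[OF prime_p m(2)] by simp
    moreover have "?c \<notin> {\<one>}" using notor by simp
    ultimately show ?thesis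
      using a triv_subgroup by (intro exI[of _ ?c] exI[of _ "int m"] exI[of _ "{\<one>}"]) simp
  next
    case False
    let ?l = "int p + 1"
    have "a \<notin> adjoin {\<one>} (a [^] ?l)"
    proof
      assume "a \<in> adjoin {\<one>} (a [^] ?l)"
      then obtain n :: int where "a = (a [^] ?l) [^] n" using a by (auto simp: adjoin_def)
      hence "a [^] (?l * n) = a [^] (1::int)" using a by (simp add: int_pow_pow)
      hence "a [^] (?l * n - 1) = \<one>" using a int_pow_diff[of a "?l * n" 1] by simp
      hence "a [^] (1 - ?l * n) = \<one>" using a int_pow_neg[of a "?l * n - 1"] by simp
      hence z: "a [^] (nat \<bar>?l * n - 1\<bar>) = \<one>"
        using \<open>a [^] (?l * n - 1) = \<one>\<close> by (simp add: pow_nat abs_if)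
      have "?l * n \<noteq> 1"
      proof
        assume "?l * n = 1"
        hence "?l = 1 \<or> ?l = -1" by (meson zmult_eq_1_iff)
        thus False using prime_gt_0_nat[OF prime_p] by auto
      qed
      hence "nat \<bar>?l * n - 1\<bar> > 0" by simp
      thus False using False z by blast
    qed
    moreover have "a [^] ?l \<in> adjoin {\<one>} (a [^] ?l)"
      using adjoin_incl(2)[OF triv_subgroup] a by simp
    moreover have "subgroup (adjoin {\<one>} (a [^] ?l)) G"
      using adjoin_subgroup[OF triv_subgroup] a by simp
    moreover have "coprime ?l (int p)" by simp
    ultimately show ?thesis using a by blast
  qed
  then obtain c l K where cK: "c \<in> carrier G" "subgroup K G" "c \<notin> K" "c [^] (l::int) \<in> K"
    and l: "coprime l (int p)" by blast
  obtain D where D: "K \<subseteq> D" "max_avoiding c D" using max_avoiding_exists[OF cK(2,1,3)] by blast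
  hence sD: "subgroup D G" and cD: "c \<notin> D" by (auto simp: max_avoiding_def)
  interpret D: subgroup D G by (rule sD)
  have cl: "c [^] l \<in> D" using cK D by blast
  \<comment> \<open>No \<open>p\<close>-torsion modulo \<open>D\<close>: a counterexample
    \<open>y\<close> would give \<open>c [^] p \<in> D\<close>, and together with
    \<open>c [^] l \<in> D\<close> also \<open>c \<in> D\<close>.\<close>
  have ptf: "y \<in> D" if y: "y \<in> carrier G" "y [^] p \<in> D" for y
  proof (rule ccontr)
    assume "y \<notin> D"
    then obtain n :: int and d where d: "d \<in> D" "c = d \<otimes> y [^] n" using max_avoiding_pow[OF D(2) y(1)] by blast
    have "c [^] p = d [^] p \<otimes> (y [^] p) [^] n"
      using d y by (simp add: nat_pow_distrib) (simp add: int_pow_pow mult.commute flip: int_pow_int)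
    hence "c [^] (int p) \<in> D"
      using subgroup_nat_pow_closed[OF sD d(1), of p] subgroup_int_pow_closed[OF sD y(2), of n]
      by (simp add: int_pow_int)
    thus False using subgroup_coprime_pow[OF sD cK(1) cl _ l] cD by blast
  qed
  have ptf': "y \<in> D" if "y \<in> carrier G" "y [^] (p ^ k) \<in> D" for y k
    using that
  proof (induction k arbitrary: y)
    case (Suc k)
    have "(y [^] p) [^] (p ^ k) \<in> D" using Suc.prems by (simp add: nat_pow_pow)
    hence "y [^] p \<in> D" using Suc.IH Suc.prems(1) nat_pow_closed by blast
    thus ?case using ptf Suc.prems(1) by blast
  qed simp
  \<comment> \<open>Modulo \<open>D\<close>, \<open>c\<close> is a nonzero power of
    \<open>b\<close>, so \<open>b\<close> has finite order there; \<open>ptf'\<close> removes the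
    \<open>p\<close>-part of that order.\<close>
  have reg: "\<exists>s. coprime s p \<and> b [^] (s::nat) \<in> D" if b: "b \<in> carrier G" for b
  proof (cases "b \<in> D")
    case True
    thus ?thesis using b by (intro exI[of _ 1]) simp
  next
    case False
    then obtain n :: int and d where d: "d \<in> D" "c = d \<otimes> b [^] n" using max_avoiding_pow[OF D(2) b] by blast
    have "n \<noteq> 0" using d cD by auto
    have "c [^] l = d [^] l \<otimes> b [^] (n * l)"
      using d b by (simp add: int_pow_distrib int_pow_pow)
    hence "inv (d [^] l) \<otimes> c [^] l = b [^] (n * l)"
      using d b by (simp add: inv_cancel_left)
    hence bD: "b [^] (n * l) \<in> D"
      using cl d(1) subgroup_int_pow_closed[OF sD d(1), of l] by (metis D.m_closed D.m_inv_closed)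
    hence "b [^] (- (n * l)) \<in> D" using b by (simp add: int_pow_neg)
    hence bm: "b [^] (nat \<bar>n * l\<bar>) \<in> D" using bD by (simp add: pow_nat abs_if)
    have "l \<noteq> 0" using l prime_p by (auto simp: prime_nat_iff)
    hence nz: "nat \<bar>n * l\<bar> \<noteq> 0" using \<open>n \<noteq> 0\<close> by simp
    obtain s where s: "nat \<bar>n * l\<bar> = p ^ multiplicity p (nat \<bar>n * l\<bar>) * s" "\<not> p dvd s"
      using multiplicity_decompose'[OF nz] prime_p by (metis not_prime_unit)
    have "(b [^] s) [^] (p ^ multiplicity p (nat \<bar>n * l\<bar>)) \<in> D"
      using bm s(1) b by (simp add: nat_pow_pow mult.commute)
    hence "b [^] s \<in> D" using ptf' b by blast
    moreover have "coprime s p" by (rule coprime_primeI[OF prime_p s(2)])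
    ultimately show ?thesis by blast
  qed
  have "core D = carrier G"
  proof (rule superfluous[OF core_invariant[OF sD]])
    fix b assume b: "b \<in> carrier G"
    have "\<forall>f\<in>\<Phi>. \<exists>s. coprime s p \<and> f b [^] (s::nat) \<in> D"
      using reg hom_in_carrier[OF endo_hom b] by blast
    then obtain s where s: "\<And>f. f \<in> \<Phi> \<Longrightarrow> coprime (s f) p \<and> f b [^] (s f :: nat) \<in> D" by metis
    \<comment> \<open>One exponent serves all operators at once: a finite product, still prime to
      \<open>p\<close>. Bezout then writes \<open>b\<close> as an element of \<open>core D\<close>
      times a \<open>p\<close>-th power.\<close>
    define t where "t = (\<Prod>f\<in>\<Phi>. s f)"
    have t: "coprime t p" unfolding t_def using s by (intro prod_coprime_left) blast
    have "b [^] t \<in> core D"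
    proof -
      have "f (b [^] t) \<in> D" if f: "f \<in> \<Phi>" for f
      proof -
        interpret f: group_hom G G f using f by (rule endo_group_hom)
        have "t = s f * (\<Prod>g\<in>\<Phi> - {f}. s g)" unfolding t_def using f finite_endos by (rule prod.remove[rotated])
        hence "f (b [^] t) = (f b [^] s f) [^] (\<Prod>g\<in>\<Phi> - {f}. s g)"
          using b by (simp add: f.hom_nat_pow nat_pow_pow)
        thus ?thesis using s[OF f] subgroup_nat_pow_closed[OF sD] by simp
      qed
      thus ?thesis using b by (simp add: core_def)
    qed
    moreover obtain u v where uv: "u * int t + v * int p = 1"
      using bezout_int[of "int t" "int p"] t by (auto simp: coprime_iff_gcd_eq_1)
    have "(b [^] t) [^] u \<otimes> (b [^] v) [^] p = b [^] (u * int t + v * int p)"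
      using b by (simp add: int_pow_pow int_pow_mult mult.commute flip: int_pow_int)
    hence "b = (b [^] t) [^] u \<otimes> (b [^] v) [^] p" using uv b by simp
    moreover have "(b [^] t) [^] u \<in> core D"
      using subgroup_int_pow_closed[OF core_subgroup[OF sD]] \<open>b [^] t \<in> core D\<close> by blast
    ultimately show "\<exists>d\<in>core D. \<exists>y\<in>carrier G. b = d \<otimes> y [^] p" using b by (meson int_pow_closed)
  qed
  thus False using core_subset cD cK(1) by blast
qed

text \<open>Modulo \<open>D0\<close>, the intersections of the socle with the groups of \<open>p ^ k\<close>-th powers become stationary,
  which makes the group of \<open>p ^ k\<close>-th powers \<open>p\<close>-divisible for large \<open>k\<close>, hence trivial.\<close>

lemma bounded_mod_finite_socle:
  assumes D0: "invariant D0" and fin: "finite ((\<lambda>b. D0 #> b) ` {b \<in> carrier G. b [^] p \<in> D0})"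
  shows "\<exists>k. \<forall>a\<in>carrier G. a [^] (p ^ k) \<in> D0"
proof -
  have sD: "subgroup D0 G" using D0 by (simp add: invariant_def)
  interpret D: subgroup D0 G by (rule sD)
  \<comment> \<open>Read modulo \<open>D0\<close>: the elements of the socle that are
    \<open>p ^ k\<close>-th powers.\<close>
  define W where "W k = {b \<in> carrier G. b [^] p \<in> D0 \<and> (\<exists>d\<in>D0. \<exists>a\<in>carrier G. b = d \<otimes> a [^] (p ^ k))}" for k
  have Wanti: "W j \<subseteq> W i" if ij: "i \<le> j" for i j
  proof
    fix b assume "b \<in> W j"
    then obtain d a where da: "b \<in> carrier G" "b [^] p \<in> D0" "d \<in> D0" "a \<in> carrier G" "b = d \<otimes> a [^] (p ^ j)"
      by (auto simp: W_def)
    have "a [^] (p ^ j) = (a [^] (p ^ (j - i))) [^] (p ^ i)"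
      using da ij by (simp add: nat_pow_pow flip: power_add)
    hence "b = d \<otimes> (a [^] (p ^ (j - i))) [^] (p ^ i)" using da by simp
    thus "b \<in> W i" unfolding W_def using da(1-4) nat_pow_closed by blast
  qed
  let ?V = "\<lambda>k. (\<lambda>b. D0 #> b) ` W k"
  have "finite (?V 0)" by (rule finite_subset[OF _ fin]) (auto simp: W_def)
  then obtain k where k: "\<And>j. j \<ge> k \<Longrightarrow> ?V j = ?V k"
    using antimono_finite_stabilises[of ?V] Wanti by (meson image_mono)
  \<comment> \<open>Stationarity concerns the images modulo \<open>D0\<close>; since
    \<open>W j\<close> is a union of cosets of \<open>D0\<close>, the sets themselves agree.\<close>
  have Wk: "b \<in> W j" if b: "b \<in> W k" and j: "j \<ge> k" for b j
  proof -
    obtain b' where b': "b' \<in> W j" "D0 #> b = D0 #> b'" using k[OF j] b by blast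
    have c: "b \<in> carrier G" "b' \<in> carrier G" "b [^] p \<in> D0" using b b' by (auto simp: W_def)
    have e: "b \<otimes> inv b' \<in> D0" using subgroup_rcos_eq_iff[OF sD c(1,2)] b' by simp
    obtain d a where da: "d \<in> D0" "a \<in> carrier G" "b' = d \<otimes> a [^] (p ^ j)" using b' by (auto simp: W_def)
    have "b = (b \<otimes> inv b' \<otimes> d) \<otimes> a [^] (p ^ j)" using c da by (simp add: word_simps)
    moreover have "b \<otimes> inv b' \<otimes> d \<in> D0" by (rule D.m_closed[OF e da(1)])
    ultimately show ?thesis unfolding W_def using c da by blast
  qed
  \<comment> \<open>Induction on \<open>s\<close>. For \<open>Suc s\<close> the power
    \<open>x [^] (p ^ s)\<close> lies in the socle, hence equals
    \<open>y [^] (p ^ (Suc k + s))\<close> modulo \<open>D0\<close> for some \<open>y\<close>;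
    dividing \<open>x\<close> by \<open>y [^] (p ^ Suc k)\<close> lowers its order modulo
    \<open>D0\<close> to a divisor of \<open>p ^ s\<close>.\<close>
  have div: "\<exists>d\<in>D0. \<exists>y\<in>carrier G. x = d \<otimes> y [^] (p ^ Suc k)"
    if "x \<in> carrier G" "\<exists>d\<in>D0. \<exists>a\<in>carrier G. x = d \<otimes> a [^] (p ^ k)" "x [^] (p ^ s) \<in> D0" for x s
    using that
  proof (induction s arbitrary: x)
    case 0
    hence "x \<in> D0" "x = x \<otimes> \<one> [^] (p ^ Suc k)" by simp_all
    thus ?case by blast
  next
    case (Suc s)
    note x = Suc.prems(1)
    obtain d a where da: "d \<in> D0" "a \<in> carrier G" "x = d \<otimes> a [^] (p ^ k)" using Suc.prems(2) by blast
    have "(x [^] (p ^ s)) [^] p \<in> D0" using Suc.prems(3) x by (simp add: nat_pow_pow mult.commute)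
    moreover have "x [^] (p ^ s) = d [^] (p ^ s) \<otimes> a [^] (p ^ (k + s))"
      using da by (simp add: nat_pow_distrib nat_pow_pow power_add)
    ultimately have "x [^] (p ^ s) \<in> W (k + s)"
      unfolding W_def using da x subgroup_nat_pow_closed[OF sD da(1)] by blast
    hence "x [^] (p ^ s) \<in> W (Suc k + s)" using Wanti[of k "k + s"] Wk[of _ "Suc k + s"] by auto
    then obtain e y where ey: "e \<in> D0" "y \<in> carrier G" "x [^] (p ^ s) = e \<otimes> y [^] (p ^ (Suc k + s))"
      by (auto simp: W_def)
    let ?x = "x \<otimes> inv (y [^] (p ^ Suc k))"
    have "?x [^] (p ^ s) = e"
      using x ey by (simp add: pow_divide nat_pow_pow power_add m_assoc mult.assoc)
    moreover have "?x = d \<otimes> (a \<otimes> inv (y [^] p)) [^] (p ^ k)"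
      using da ey by (simp add: pow_divide nat_pow_pow m_assoc)
    ultimately obtain e' y' where e': "e' \<in> D0" "y' \<in> carrier G" "?x = e' \<otimes> y' [^] (p ^ Suc k)"
      using Suc.IH[of ?x] x da ey by (metis inv_closed m_closed nat_pow_closed)
    have "x = ?x \<otimes> y [^] (p ^ Suc k)" using x ey by (simp add: m_assoc)
    also have "\<dots> = e' \<otimes> (y' \<otimes> y) [^] (p ^ Suc k)"
      unfolding e'(3) using e' ey by (simp add: nat_pow_distrib m_assoc del: power_Suc)
    finally show ?case using e' ey by blast
  qed
  \<comment> \<open>By \<open>div\<close>, \<open>a\<close> and some \<open>y [^] p\<close> have the
    same \<open>p ^ k\<close>-th power modulo \<open>D0\<close>, so they differ by an element of
    \<open>D'\<close>: the group is \<open>D'\<close> times \<open>p\<close>-th powers.\<close>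
  define D' where "D' = {a \<in> carrier G. a [^] (p ^ k) \<in> D0}"
  have "D' = carrier G"
  proof (rule superfluous)
    have "f a [^] (p ^ k) \<in> D0" if "f \<in> \<Phi>" "a \<in> carrier G" "a [^] (p ^ k) \<in> D0" for f a
    proof -
      have "f (a [^] (p ^ k)) \<in> D0" using that D0 by (simp add: invariant_def)
      thus ?thesis using group_hom.hom_nat_pow[OF endo_group_hom[OF that(1)] that(2), of "p ^ k"] by simp
    qed
    thus "invariant D'"
      using pow_preimage_subgroup[OF sD, of "p ^ k"] hom_in_carrier[OF endo_hom] by (simp add: invariant_def D'_def)
    fix a assume a: "a \<in> carrier G"
    obtain t where t: "(a [^] (p ^ k)) [^] (p ^ t) = \<one>" using p_torsion[of "a [^] (p ^ k)"] a by blast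
    have "a [^] (p ^ k) = \<one> \<otimes> a [^] (p ^ k)" using a by simp
    then obtain d y where dy: "d \<in> D0" "y \<in> carrier G" "a [^] (p ^ k) = d \<otimes> y [^] (p ^ Suc k)"
      using div[of "a [^] (p ^ k)" t] a t D.one_closed by (metis nat_pow_closed)
    have "(a \<otimes> inv (y [^] p)) [^] (p ^ k) = d"
      using a dy by (simp add: pow_divide nat_pow_pow m_assoc)
    hence "a \<otimes> inv (y [^] p) \<in> D'" using a dy by (simp add: D'_def)
    moreover have "a = a \<otimes> inv (y [^] p) \<otimes> y [^] p" using a dy by (simp add: m_assoc)
    ultimately show "\<exists>d\<in>D'. \<exists>b\<in>carrier G. a = d \<otimes> b [^] p" using dy by blast
  qed
  thus ?thesis unfolding D'_def by blast
qed

text \<open>The socle modulo \<open>D\<close> is generated by the image of \<open>c\<close>. Applied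
  to every \<open>f b\<close>, this makes the socle modulo \<open>core D\<close> finite, and
  \<open>core D\<close> is invariant, so \<open>bounded_mod_finite_socle\<close> bounds the exponent
  there.\<close>

lemma bounded_mod_max_avoiding:
  assumes D: "max_avoiding c D" and cp: "c [^] p \<in> D"
  shows "\<exists>k. \<forall>a\<in>carrier G. a [^] (p ^ k) \<in> D"
proof -
  have sD: "subgroup D G" and cD: "c \<notin> D" and c: "c \<in> carrier G" using D by (auto simp: max_avoiding_def)
  interpret D: subgroup D G by (rule sD)
  have socle: "\<exists>i<p. y \<otimes> inv (c [^] i) \<in> D" if y: "y \<in> carrier G" "y [^] p \<in> D" for y
  proof (cases "y \<in> D")
    case True
    thus ?thesis using y prime_p by (intro exI[of _ 0]) (simp add: prime_gt_0_nat)
  next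
    case False
    then obtain n :: int and d where d: "d \<in> D" "c = d \<otimes> y [^] n" using max_avoiding_pow[OF D y(1)] by blast
    have "\<not> int p dvd n"
    proof
      assume "int p dvd n"
      then obtain m where "n = int p * m" by blast
      hence "y [^] n = (y [^] p) [^] m" using y by (simp add: int_pow_pow flip: int_pow_int)
      hence "c \<in> D" using d subgroup_int_pow_closed[OF sD y(2), of m] by simp
      thus False using cD by blast
    qed
    hence "coprime n (int p)" by (rule coprime_primeI[OF prime_int_p])
    \<comment> \<open>\<open>u\<close> inverts \<open>n\<close> modulo \<open>p\<close>, so
      \<open>y\<close> equals \<open>c [^] u\<close> modulo \<open>D\<close>; as
      \<open>c [^] p \<in> D\<close>, only \<open>u mod p\<close> matters.\<close>
    then obtain u v where uv: "u * n + v * int p = 1" using bezout_int[of n "int p"] by auto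
    define i where "i = nat (u mod int p)"
    have i: "i < p" "int i = u mod int p" unfolding i_def using prime_gt_0_nat[OF prime_p] by (auto simp: nat_less_iff)
    define q where "q = u div int p"
    have u: "u = int p * q + int i" unfolding i(2) q_def by simp
    have yn: "y [^] n = inv d \<otimes> c" using d y by (simp add: inv_cancel_left)
    have "y = y [^] (u * n + v * int p)" using uv y by simp
    also have "\<dots> = (y [^] n) [^] u \<otimes> (y [^] p) [^] v"
      using y by (simp add: int_pow_mult int_pow_pow mult.commute flip: int_pow_int)
    also have "(y [^] n) [^] u = inv d [^] u \<otimes> c [^] u"
      unfolding yn using d c by (simp add: int_pow_distrib)
    also have "c [^] u = (c [^] p) [^] q \<otimes> c [^] i"
      unfolding u using c by (simp add: int_pow_mult int_pow_pow flip: int_pow_int)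
    finally have y_eq: "y = inv d [^] u \<otimes> ((c [^] p) [^] q \<otimes> c [^] i) \<otimes> (y [^] p) [^] v" .
    have mem: "inv d [^] u \<in> D" "(c [^] p) [^] q \<in> D" "(y [^] p) [^] v \<in> D"
      using subgroup_int_pow_closed[OF sD] d cp y by auto
    hence "inv d [^] u \<otimes> (c [^] p) [^] q \<otimes> (y [^] p) [^] v \<in> D" by simp
    also have "inv d [^] u \<otimes> (c [^] p) [^] q \<otimes> (y [^] p) [^] v = y \<otimes> inv (c [^] i)"
    proof -
      have "inv d [^] u \<otimes> ((c [^] p) [^] q \<otimes> c [^] i) \<otimes> (y [^] p) [^] v =
         inv d [^] u \<otimes> (c [^] p) [^] q \<otimes> (y [^] p) [^] v \<otimes> c [^] i"
        using c d y(1) by (simp add: m_ac)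
      hence "y = inv d [^] u \<otimes> (c [^] p) [^] q \<otimes> (y [^] p) [^] v \<otimes> c [^] i" using y_eq by simp
      hence "y \<otimes> inv (c [^] i) = (inv d [^] u \<otimes> (c [^] p) [^] q \<otimes> (y [^] p) [^] v \<otimes> c [^] i) \<otimes> inv (c [^] i)"
        by simp
      also have "\<dots> = inv d [^] u \<otimes> (c [^] p) [^] q \<otimes> (y [^] p) [^] v"
        using c d y(1) by (simp add: m_assoc)
      finally show ?thesis by simp
    qed
    finally show ?thesis using i by blast
  qed
  let ?W = "{b \<in> carrier G. b [^] p \<in> core D}"
  have "finite ((\<lambda>b. core D #> b) ` ?W)"
  proof (rule finite_core_cosets[OF sD c])
    fix b f assume b: "b \<in> ?W" and f: "f \<in> \<Phi>"
    interpret f: group_hom G G f using f by (rule endo_group_hom)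
    have "f (b [^] p) \<in> D" using b f by (simp add: core_def)
    thus "\<exists>i<p. f b \<otimes> inv (c [^] i) \<in> D" using socle[of "f b"] b by (simp add: f.hom_nat_pow)
  qed auto
  then obtain k where "\<forall>a\<in>carrier G. a [^] (p ^ k) \<in> core D"
    using bounded_mod_finite_socle[OF core_invariant[OF sD]] by blast
  thus ?thesis using core_subset by blast
qed

text \<open>If the exponent were unbounded, one could build an ascending chain of bounded subgroups avoiding a
  fixed element \<open>c\<close> of order \<open>p\<close> modulo whose union \<open>c\<close> is a \<open>p ^ n\<close>-th power for every \<open>n\<close>.\<close>

theorem bounded_exponent: "\<exists>k. \<forall>a\<in>carrier G. a [^] (p ^ k) = \<one>"
proof (rule ccontr)
  assume "\<nexists>k. \<forall>a\<in>carrier G. a [^] (p ^ k) = \<one>"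
  hence unb: "\<exists>a\<in>carrier G. a [^] (p ^ k) \<noteq> \<one>" for k by blast
  \<comment> \<open>\<open>c\<close> is the last nontrivial term among the iterated
    \<open>p\<close>-th powers of a nontrivial element.\<close>
  obtain c where c: "c \<in> carrier G" "c \<noteq> \<one>" "c [^] p = \<one>"
  proof -
    obtain a where a: "a \<in> carrier G" "a [^] (p ^ 0) \<noteq> \<one>" using unb by blast
    define k where "k = (LEAST k. a [^] (p ^ k) = \<one>)"
    have k: "a [^] (p ^ k) = \<one>" unfolding k_def using p_torsion[OF a(1)] by (rule LeastI_ex)
    have "k \<noteq> 0" using a k by (intro notI) simp
    then obtain j where j: "k = Suc j" by (cases k) auto
    have "a [^] (p ^ j) \<noteq> \<one>" using not_less_Least[of j "\<lambda>k. a [^] (p ^ k) = \<one>"] j by (simp add: k_def)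
    moreover have "(a [^] (p ^ j)) [^] p = \<one>" using k a unfolding j by (simp add: nat_pow_pow mult.commute)
    ultimately show ?thesis using that a by blast
  qed
  \<comment> \<open>\<open>P\<close> describes the bounded subgroups that avoid \<open>c\<close>;
    \<open>Q n\<close> makes \<open>c\<close> a \<open>p ^ n\<close>-th power modulo the larger
    subgroup.\<close>
  define P where "P K \<longleftrightarrow> subgroup K G \<and> c \<notin> K \<and> (\<exists>s. \<forall>x\<in>K. x [^] (p ^ s) = \<one>)" for K
  define Q where "Q n K K' \<longleftrightarrow> K \<subseteq> K' \<and> (\<exists>a\<in>carrier G. a [^] (p ^ n) \<otimes> inv c \<in> K')" for n K K'
  have step: "\<exists>K'. P K' \<and> Q n K K'" if K: "P K" for K n
  proof -
    have sK: "subgroup K G" and cK: "c \<notin> K" using K by (auto simp: P_def)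
    obtain s where s: "\<And>x. x \<in> K \<Longrightarrow> x [^] (p ^ s) = \<one>" using K by (auto simp: P_def)
    obtain D where D: "K \<subseteq> D" "max_avoiding c D" using max_avoiding_exists[OF sK c(1) cK] by blast
    hence sD: "subgroup D G" and cD: "c \<notin> D" by (auto simp: max_avoiding_def)
    interpret D: subgroup D G by (rule sD)
    obtain k where k: "\<And>a. a \<in> carrier G \<Longrightarrow> a [^] (p ^ k) \<in> D"
      using bounded_mod_max_avoiding[OF D(2)] c by auto
    \<comment> \<open>In the exponent, \<open>k\<close> moves the power into \<open>D\<close>,
      \<open>n\<close> makes \<open>u\<close> a \<open>p ^ n\<close>-th power, and \<open>s\<close>
      keeps \<open>u\<close> out of \<open>K\<close>, where \<open>p ^ s\<close>-th powers
      vanish.\<close>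
    obtain a where a: "a \<in> carrier G" "a [^] (p ^ (k + n + s)) \<noteq> \<one>" using unb by blast
    define b where "b = a [^] (p ^ k)"
    define u where "u = b [^] (p ^ n)"
    have bD: "b \<in> D" using k a by (simp add: b_def)
    have bc: "b \<in> carrier G" using bD by simp
    have uD: "u \<in> D" unfolding u_def using subgroup_nat_pow_closed[OF sD bD] .
    have uc: "u \<in> carrier G" using uD by simp
    have "u [^] (p ^ s) \<noteq> \<one>" using a by (simp add: u_def b_def nat_pow_pow power_add mult.assoc)
    hence uK: "u \<notin> K" using s by blast
    define w where "w = u \<otimes> inv c"
    have wc: "w \<in> carrier G" using uc c by (simp add: w_def)
    define K' where "K' = adjoin K w"
    \<comment> \<open>If \<open>c = e \<otimes> w [^] i\<close>, then
      \<open>c [^] (i + 1) = e \<otimes> u [^] i\<close> lies in \<open>D\<close>, so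
      \<open>p\<close> divides \<open>i + 1\<close> and this power is trivial. Now
      \<open>u [^] i \<in> K\<close> with \<open>i\<close> prime to \<open>p\<close>, and
      \<open>u\<close>, being of \<open>p\<close>-power order, would lie in
      \<open>K\<close>.\<close>
    have "c \<notin> K'"
    proof
      assume "c \<in> K'"
      then obtain e and i :: int where ei: "e \<in> K" "c = e \<otimes> w [^] i" by (auto simp: K'_def adjoin_def)
      have ec: "e \<in> carrier G" using ei sK subgroup.mem_carrier by metis
      have wi: "w [^] i = u [^] i \<otimes> inv (c [^] i)"
        unfolding w_def using uc c(1) by (simp add: int_pow_distrib int_pow_inv)
      have "c \<otimes> c [^] i = (e \<otimes> w [^] i) \<otimes> c [^] i" using ei by simp
      also have "\<dots> = e \<otimes> u [^] i" using ec uc c(1) by (simp add: wi m_assoc)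
      finally have ce: "c [^] (i + 1) = e \<otimes> u [^] i" using c(1) by (simp add: int_pow_mult m_comm)
      hence ci: "c [^] (i + 1) \<in> D" using ei D(1) subgroup_int_pow_closed[OF sD uD, of i] by auto
      have cpD: "c [^] (int p) \<in> D" using c(3) by (simp add: int_pow_int)
      have dvd: "int p dvd i + 1"
      proof (rule ccontr)
        assume "\<not> int p dvd i + 1"
        hence "coprime (i + 1) (int p)" by (rule coprime_primeI[OF prime_int_p])
        thus False using subgroup_coprime_pow[OF sD c(1) ci cpD] cD by blast
      qed
      then obtain m where "i + 1 = int p * m" by blast
      hence "c [^] (i + 1) = (c [^] p) [^] m" using c(1) by (simp add: int_pow_pow flip: int_pow_int)
      hence "e \<otimes> u [^] i = \<one>" using ce c by simp
      hence "u [^] i = inv e" using ec uc by (metis inv_equality int_pow_closed inv_inv m_comm)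
      hence ui: "u [^] i \<in> K" using ei sK by (simp add: subgroup.m_inv_closed)
      obtain t where t: "u [^] (p ^ t) = \<one>" using p_torsion[OF uc] by blast
      hence ut: "u [^] (int (p ^ t)) \<in> K" using sK unfolding int_pow_int by (simp add: subgroup.one_closed)
      have "coprime i (int p)"
      proof (rule coprimeI)
        fix q assume "q dvd i" "q dvd int p"
        thus "is_unit q" using dvd by (metis dvd_add_right_iff dvd_trans)
      qed
      hence "coprime i (int (p ^ t))" by simp
      thus False using subgroup_coprime_pow[OF sK uc ui ut] uK by blast
    qed
    moreover have "\<exists>r. \<forall>x\<in>K'. x [^] (p ^ r) = \<one>"
    proof -
      obtain t where t: "w [^] (p ^ t) = \<one>" using p_torsion[OF wc] by blast
      have "x [^] (p ^ (s + t)) = \<one>" if x: "x \<in> K'" for x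
      proof -
        obtain e and i :: int where ei: "e \<in> K" "x = e \<otimes> w [^] i" using x by (auto simp: K'_def adjoin_def)
        have ec: "e \<in> carrier G" using ei sK subgroup.mem_carrier by metis
        have "e [^] (p ^ (s + t)) = (e [^] (p ^ s)) [^] (p ^ t)" using ec by (simp add: nat_pow_pow power_add)
        moreover have "(w [^] i) [^] (p ^ (s + t)) = ((w [^] (p ^ t)) [^] i) [^] (p ^ s)"
          using wc by (simp add: int_pow_pow power_add mult_ac flip: int_pow_int)
        ultimately show ?thesis using ei ec wc s[OF ei(1)] t by (simp add: nat_pow_distrib)
      qed
      thus ?thesis by blast
    qed
    moreover have "subgroup K' G" unfolding K'_def by (rule adjoin_subgroup[OF sK wc])
    ultimately have "P K'" by (simp add: P_def)
    moreover have "Q n K K'"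
      using adjoin_incl[OF sK wc] bc by (auto simp: Q_def K'_def w_def u_def)
    ultimately show ?thesis by blast
  qed
  have "P {\<one>}" using c triv_subgroup by (auto simp: P_def)
  then obtain F where F: "\<And>n. P (F n)" "\<And>n. Q n (F n) (F (Suc n))"
    using dependent_nat_choice[of "\<lambda>_. P" Q] step by metis
  have mono: "F i \<subseteq> F j" if "i \<le> j" for i j
    using that F(2) by (induction rule: dec_induct) (auto simp: Q_def)
  have "subgroup (\<Union>(range F)) G"
  proof (rule subgroup_chain_Union)
    show "H \<subseteq> K \<or> K \<subseteq> H" if "H \<in> range F" "K \<in> range F" for H K
      using that mono by (metis imageE linear)
  qed (use F(1) in \<open>auto simp: P_def\<close>)
  moreover have "c \<notin> \<Union>(range F)" using F(1) by (auto simp: P_def)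
  ultimately have "\<exists>D. \<Union>(range F) \<subseteq> D \<and> max_avoiding c D" using c(1) by (intro max_avoiding_exists)
  then obtain D where D: "\<Union>(range F) \<subseteq> D" "max_avoiding c D" by blast
  hence sD: "subgroup D G" and cD: "c \<notin> D" by (auto simp: max_avoiding_def)
  interpret D: subgroup D G by (rule sD)
  \<comment> \<open>The bound \<open>k\<close> for the limit \<open>D\<close> fails at stage
    \<open>k\<close>: there \<open>c\<close> differs from a \<open>p ^ k\<close>-th power, which is
    in \<open>D\<close>, by an element of \<open>D\<close>.\<close>
  obtain k where k: "\<And>a. a \<in> carrier G \<Longrightarrow> a [^] (p ^ k) \<in> D"
    using bounded_mod_max_avoiding[OF D(2)] c by auto
  obtain a where a: "a \<in> carrier G" "a [^] (p ^ k) \<otimes> inv c \<in> F (Suc k)" using F(2)[of k] by (auto simp: Q_def)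
  have "inv (a [^] (p ^ k) \<otimes> inv c) \<otimes> a [^] (p ^ k) \<in> D"
  proof (rule D.m_closed[OF D.m_inv_closed])
    show "a [^] (p ^ k) \<otimes> inv c \<in> D" using a D by blast
  qed (rule k[OF a(1)])
  hence "c \<in> D" using a c by (simp add: word_simps)
  thus False using cD by blast
qed

end

section \<open>Abelian normal subgroups of finite index\<close>

context comm_group
begin

text \<open>If the square of \<open>x\<close> is outside \<open>D\<close>, then \<open>x\<close>
  lies in the group generated by \<open>D\<close> and that square, so an odd, hence nonzero, power
  of \<open>x\<close> is in \<open>D\<close>.\<close>

lemma max_avoiding_torsion:
  assumes M: "max_avoiding x D"
  shows "\<exists>s>0. x [^] (s::int) \<in> D"
proof (cases "x [^] (2::int) \<in> D")
  case True
  thus ?thesis by (intro exI[of _ 2]) simp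
next
  case False
  have x: "x \<in> carrier G" and sD: "subgroup D G" using M by (auto simp: max_avoiding_def)
  interpret D: subgroup D G by (rule sD)
  obtain n :: int and d where d: "d \<in> D" "x = d \<otimes> (x [^] (2::int)) [^] n"
    using max_avoiding_pow[OF M _ False] x by auto
  have "x [^] (1 - 2 * n) = x \<otimes> inv (x [^] (2 * n))" using x int_pow_diff[of x 1 "2 * n"] by simp
  also have "\<dots> = d \<otimes> (x [^] (2::int)) [^] n \<otimes> inv (x [^] (2 * n))" using d(2) by simp
  also have "\<dots> = d" using x d(1) by (simp add: int_pow_pow m_assoc)
  finally have m: "x [^] (1 - 2 * n) \<in> D" using d by simp
  hence "x [^] (- (1 - 2 * n)) \<in> D" using int_pow_neg[OF x, of "1 - 2 * n"] D.m_inv_closed by simp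
  moreover have "1 - 2 * n > 0 \<or> - (1 - 2 * n) > 0" by presburger
  ultimately show ?thesis using m by blast
qed

text \<open>Together with \<open>max_avoiding_torsion\<close> this supplies the covering premise of
  \<open>finite_core_cosets\<close>.\<close>

lemma adjoin_cover:
  assumes sD: "subgroup D G" and x: "x \<in> carrier G" and s: "s > 0" "x [^] (s::int) \<in> D"
    and b: "b \<in> adjoin D x"
  shows "\<exists>i<nat s. b \<otimes> inv (x [^] i) \<in> D"
proof -
  interpret D: subgroup D G by (rule sD)
  obtain d and n :: int where d: "d \<in> D" "b = d \<otimes> x [^] n" using b by (auto simp: adjoin_def)
  define i where "i = nat (n mod s)"
  have i: "i < nat s" "int i = n mod s" using s(1) by (auto simp: i_def nat_less_iff)
  have "x [^] n = x [^] (s * (n div s) + int i)" unfolding i(2) by simp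
  also have "\<dots> = (x [^] s) [^] (n div s) \<otimes> x [^] i"
    using x by (simp add: int_pow_mult int_pow_pow int_pow_int)
  finally have "b \<otimes> inv (x [^] i) = d \<otimes> (x [^] s) [^] (n div s)"
    using d x by (simp add: m_assoc)
  moreover have "d \<otimes> (x [^] s) [^] (n div s) \<in> D"
    using D.m_closed[OF d(1) subgroup_int_pow_closed[OF sD s(2)]] .
  ultimately show ?thesis using i by auto
qed

end

locale virtually_abelian = group G for G (structure) +
  fixes A
  assumes A_normal: "A \<lhd> G"
    and A_comm: "\<lbrakk>a \<in> A; b \<in> A\<rbrakk> \<Longrightarrow> a \<otimes> b = b \<otimes> a"
    and A_index: "finite (rcosets A)"
begin

lemma A_subgroup: "subgroup A G"
  using A_normal by (rule normal_imp_subgroup)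

lemma A_carrier: "a \<in> A \<Longrightarrow> a \<in> carrier G"
  using normal_subset[OF A_normal] by blast

lemma A_conj: "\<lbrakk>g \<in> carrier G; a \<in> A\<rbrakk> \<Longrightarrow> g \<otimes> a \<otimes> inv g \<in> A"
  using A_normal by (simp add: normal_inv_iff)

lemma conj_A_trivial: "\<lbrakk>a \<in> A; b \<in> A\<rbrakk> \<Longrightarrow> a \<otimes> b \<otimes> inv a = b"
  using A_comm[of a b] A_carrier by (simp add: m_assoc)

lemma conj_mult_A:
  assumes "a \<in> A" "b \<in> A" "t \<in> carrier G"
  shows "(a \<otimes> t) \<otimes> b \<otimes> inv (a \<otimes> t) = t \<otimes> b \<otimes> inv t"
  using conj_A_trivial[OF assms(1) A_conj[OF assms(3,2)]] assms A_carrier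
  by (simp add: word_simps)

lemma finite_transversal:
  obtains T where "finite T" "T \<subseteq> carrier G" "\<And>g. g \<in> carrier G \<Longrightarrow> \<exists>a\<in>A. \<exists>t\<in>T. g = a \<otimes> t"
  using A_index finite_rcosets_iff[OF A_subgroup] by metis

lemma comm_group_sub:
  assumes "subgroup B G" "B \<subseteq> A"
  shows "comm_group (G\<lparr>carrier := B\<rparr>)"
  using assms A_comm by (intro group.group_comm_groupI subgroup_imp_group) auto

text \<open>Restriction to \<open>B\<close> identifies elements of \<open>G\<close> with the same
  action on \<open>B\<close>. For \<open>B \<subseteq> A\<close> the elements of \<open>A\<close>
  act trivially, so a transversal of \<open>A\<close> already gives every operator.\<close>

definition conj_endos :: "'a set \<Rightarrow> ('a \<Rightarrow> 'a) set" where
  "conj_endos B = (\<lambda>g. \<lambda>b\<in>B. g \<otimes> b \<otimes> inv g) ` carrier G"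

lemma conj_endo_group:
  assumes B: "B \<lhd> G" "B \<subseteq> A"
  shows "endo_group (G\<lparr>carrier := B\<rparr>) (conj_endos B)"
proof -
  interpret B: comm_group "G\<lparr>carrier := B\<rparr>" using B by (simp add: comm_group_sub normal_imp_subgroup)
  have conjB: "g \<otimes> b \<otimes> inv g \<in> B" if "g \<in> carrier G" "b \<in> B" for g b
    using that B by (simp add: normal_inv_iff)
  have Bc: "b \<in> carrier G" if "b \<in> B" for b using that B A_carrier by blast
  show ?thesis
  proof
    obtain T where T: "finite T" "T \<subseteq> carrier G" "\<And>g. g \<in> carrier G \<Longrightarrow> \<exists>a\<in>A. \<exists>t\<in>T. g = a \<otimes> t"
      by (rule finite_transversal) blast
    have "conj_endos B \<subseteq> (\<lambda>g. \<lambda>b\<in>B. g \<otimes> b \<otimes> inv g) ` T"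
    proof
      fix f assume "f \<in> conj_endos B"
      then obtain g where g: "g \<in> carrier G" "f = (\<lambda>b\<in>B. g \<otimes> b \<otimes> inv g)" by (auto simp: conj_endos_def)
      obtain a t where at: "a \<in> A" "t \<in> T" "g = a \<otimes> t" using T(3)[OF g(1)] by blast
      have "g \<otimes> b \<otimes> inv g = t \<otimes> b \<otimes> inv t" if "b \<in> B" for b
        using conj_mult_A[OF at(1), of b t] that B at T by auto
      hence "f = (\<lambda>b\<in>B. t \<otimes> b \<otimes> inv t)" unfolding g(2) by (rule restrict_ext)
      thus "f \<in> (\<lambda>g. \<lambda>b\<in>B. g \<otimes> b \<otimes> inv g) ` T" using at by blast
    qed
    thus "finite (conj_endos B)" using T(1) finite_surj by blast
  next
    fix f assume "f \<in> conj_endos B"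
    thus "f \<in> hom (G\<lparr>carrier := B\<rparr>) (G\<lparr>carrier := B\<rparr>)"
      using conjB Bc B.m_closed by (auto simp: conj_endos_def hom_def conj_mult)
  next
    fix f h assume "f \<in> conj_endos B" "h \<in> conj_endos B"
    then obtain x y where xy: "x \<in> carrier G" "y \<in> carrier G"
      "f = (\<lambda>b\<in>B. x \<otimes> b \<otimes> inv x)" "h = (\<lambda>b\<in>B. y \<otimes> b \<otimes> inv y)" by (auto simp: conj_endos_def)
    let ?k = "\<lambda>b\<in>B. (x \<otimes> y) \<otimes> b \<otimes> inv (x \<otimes> y)"
    have "?k \<in> conj_endos B" unfolding conj_endos_def using xy by blast
    moreover have "?k b = f (h b)" if b: "b \<in> B" for b
    proof -
      have "f (h b) = x \<otimes> (y \<otimes> b \<otimes> inv y) \<otimes> inv x" using xy conjB[OF xy(2) b] b by simp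
      thus ?thesis using b xy(1,2) Bc[OF b] by (simp add: word_simps)
    qed
    ultimately show "\<exists>k\<in>conj_endos B. \<forall>a\<in>carrier (G\<lparr>carrier := B\<rparr>). k a = f (h a)"
      by (intro bexI[of _ ?k]) simp_all
  next
    have "(\<lambda>b\<in>B. \<one> \<otimes> b \<otimes> inv \<one>) \<in> conj_endos B" unfolding conj_endos_def by blast
    thus "\<exists>e\<in>conj_endos B. \<forall>a\<in>carrier (G\<lparr>carrier := B\<rparr>). e a = a"
      using Bc by (intro bexI[of _ "\<lambda>b\<in>B. \<one> \<otimes> b \<otimes> inv \<one>"]) simp_all
  qed
qed

lemma invariant_iff_normal:
  assumes B: "B \<lhd> G" "B \<subseteq> A"
  shows "endo_group.invariant (G\<lparr>carrier := B\<rparr>) (conj_endos B) D \<longleftrightarrow> D \<lhd> G \<and> D \<subseteq> B"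
proof -
  interpret E: endo_group "G\<lparr>carrier := B\<rparr>" "conj_endos B" by (rule conj_endo_group) fact+
  have sB: "subgroup B G" using B by (simp add: normal_imp_subgroup)
  show ?thesis
  proof
    assume inv: "E.invariant D"
    hence sub: "subgroup D (G\<lparr>carrier := B\<rparr>)" by (simp add: E.invariant_def)
    hence DB: "D \<subseteq> B" using subgroup.subset by fastforce
    have sD: "subgroup D G" using incl_subgroup[OF sB sub] .
    moreover have "g \<otimes> d \<otimes> inv g \<in> D" if "g \<in> carrier G" "d \<in> D" for g d
    proof -
      have "(\<lambda>b\<in>B. g \<otimes> b \<otimes> inv g) \<in> conj_endos B" unfolding conj_endos_def using that by blast
      hence "(\<lambda>b\<in>B. g \<otimes> b \<otimes> inv g) d \<in> D" using inv that unfolding E.invariant_def by blast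
      thus ?thesis using that DB by auto
    qed
    ultimately show "D \<lhd> G \<and> D \<subseteq> B" using DB by (simp add: normal_invI)
  next
    assume D: "D \<lhd> G \<and> D \<subseteq> B"
    hence "subgroup D (G\<lparr>carrier := B\<rparr>)" using sB by (simp add: subgroup_incl normal_imp_subgroup)
    moreover have "f d \<in> D" if "f \<in> conj_endos B" "d \<in> D" for f d
      using that D by (auto simp: conj_endos_def normal_inv_iff)
    ultimately show "E.invariant D" by (simp add: E.invariant_def)
  qed
qed

text \<open>Every generator of \<open>[A, G]\<close> is a commutator with a transversal element, so
  a normal subgroup containing a transversal contains \<open>[A, G]\<close>.\<close>

lemma commutator_A_mult_transversal:
  assumes "a \<in> A" "b \<in> A" "t \<in> carrier G"
  shows "a \<otimes> (b \<otimes> t) \<otimes> inv a \<otimes> inv (b \<otimes> t) = a \<otimes> t \<otimes> inv a \<otimes> inv t"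
proof -
  have c: "a \<in> carrier G" "b \<in> carrier G" using assms A_carrier by auto
  have ia: "inv a \<in> A" using assms A_subgroup by (simp add: subgroup.m_inv_closed)
  have "a \<otimes> (b \<otimes> t) \<otimes> inv a \<otimes> inv (b \<otimes> t) = a \<otimes> ((b \<otimes> t) \<otimes> inv a \<otimes> inv (b \<otimes> t))"
    using c assms(3) by (simp add: m_assoc)
  also have "\<dots> = a \<otimes> (t \<otimes> inv a \<otimes> inv t)" using conj_mult_A[OF assms(2) ia assms(3)] by simp
  finally show ?thesis using c assms(3) by (simp add: m_assoc)
qed

text \<open>A subgroup generated by a finite transversal of \<open>A\<close> and by \<open>D\<close> is contranormal as soon as
  \<open>A = D [A, G]\<close>; hence it is \<open>G\<close>, and \<open>A\<close> is finitely generated modulo \<open>D\<close>.\<close>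

lemma finitely_generated_mod:
  assumes free: "contranormal_free G" and D: "D \<lhd> G" "D \<subseteq> A"
    and prod: "\<And>a. a \<in> A \<Longrightarrow> \<exists>d\<in>D. \<exists>c\<in>commutator_sub G A (carrier G). a = d \<otimes> c"
  shows "\<exists>F. finite F \<and> F \<subseteq> A \<and> generate G (F \<union> D) = A"
proof -
  obtain T where T: "finite T" "T \<subseteq> carrier G" "\<And>g. g \<in> carrier G \<Longrightarrow> \<exists>a\<in>A. \<exists>t\<in>T. g = a \<otimes> t"
    by (rule finite_transversal) blast
  \<comment> \<open>\<open>S\<close> holds the identity, the inverses and the pairwise products of
    \<open>T\<close>: the elements that must be rewritten as an element of \<open>E\<close> times
    one of \<open>T\<close> for \<open>H = E T\<close> to be a subgroup. \<open>Y\<close> collects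
    the factors in \<open>A\<close> that occur, and \<open>F\<close> their conjugates.\<close>
  define S where "S = {\<one>} \<union> (\<lambda>t. inv t) ` T \<union> (\<lambda>(s, t). s \<otimes> t) ` (T \<times> T)"
  define Y where "Y = A \<inter> (\<lambda>(s, t). s \<otimes> inv t) ` (S \<times> T)"
  define F where "F = (\<lambda>(t, y). t \<otimes> y \<otimes> inv t) ` (T \<times> Y)"
  have Tc: "t \<in> carrier G" if "t \<in> T" for t using that T by blast
  have Sc: "s \<in> carrier G" if "s \<in> S" for s using that Tc by (auto simp: S_def)
  have "finite F" unfolding F_def Y_def S_def using T(1) by auto
  have FA: "F \<subseteq> A" using Tc A_conj by (auto simp: F_def Y_def)
  have conjY: "g \<otimes> y \<otimes> inv g \<in> F" if g: "g \<in> carrier G" and y: "y \<in> Y" for g y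
  proof -
    obtain a t where at: "a \<in> A" "t \<in> T" "g = a \<otimes> t" using T(3)[OF g] by blast
    have "g \<otimes> y \<otimes> inv g = t \<otimes> y \<otimes> inv t"
      using conj_mult_A[OF at(1) _ Tc[OF at(2)], of y] y at(3) by (simp add: Y_def)
    thus ?thesis using at y by (auto simp: F_def)
  qed
  have conjF: "g \<otimes> x \<otimes> inv g \<in> F" if g: "g \<in> carrier G" and x: "x \<in> F" for g x
  proof -
    obtain t y where ty: "t \<in> T" "y \<in> Y" "x = t \<otimes> y \<otimes> inv t" using x by (auto simp: F_def)
    have "y \<in> carrier G" using ty A_carrier by (auto simp: Y_def)
    hence "g \<otimes> x \<otimes> inv g = (g \<otimes> t) \<otimes> y \<otimes> inv (g \<otimes> t)" using g Tc ty by (simp add: word_simps)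
    thus ?thesis using conjY[of "g \<otimes> t" y] g Tc ty by simp
  qed
  define E where "E = generate G (F \<union> D)"
  have FD: "F \<union> D \<subseteq> carrier G" using FA D A_carrier by blast
  have nE: "E \<lhd> G" unfolding E_def
    using conjF D(1) by (intro normal_generateI[OF FD]) (auto simp: normal_inv_iff)
  have sE: "subgroup E G" using nE by (rule normal_imp_subgroup)
  interpret E: subgroup E G by (rule sE)
  have EA: "E \<subseteq> A" unfolding E_def using FA D A_subgroup by (intro generate_subgroup_incl) auto
  have DE: "D \<subseteq> E" unfolding E_def by (auto intro: generate.incl)
  have YE: "Y \<subseteq> E"
  proof
    fix y assume y: "y \<in> Y"
    hence "\<one> \<otimes> y \<otimes> inv \<one> \<in> F" by (intro conjY) auto
    moreover have "y \<in> carrier G" using y A_carrier by (auto simp: Y_def)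
    ultimately show "y \<in> E" unfolding E_def by (auto intro: generate.incl)
  qed
  have conjE: "g \<otimes> e \<otimes> inv g \<in> E" if "g \<in> carrier G" "e \<in> E" for g e
    using that nE by (simp add: normal_inv_iff)
  define H where "H = {e \<otimes> t | e t. e \<in> E \<and> t \<in> T}"
  have HI: "e \<otimes> t \<in> H" if "e \<in> E" "t \<in> T" for e t using that by (auto simp: H_def)
  have S_decomp: "\<exists>e\<in>E. \<exists>t\<in>T. s = e \<otimes> t" if s: "s \<in> S" for s
  proof -
    obtain a t where at: "a \<in> A" "t \<in> T" "s = a \<otimes> t" using T(3)[OF Sc[OF s]] by blast
    have "a = s \<otimes> inv t" using at A_carrier Tc by (simp add: m_assoc)
    hence "a \<in> (\<lambda>(s, t). s \<otimes> inv t) ` (S \<times> T)" using at(2) s by (intro image_eqI[of _ _ "(s, t)"]) auto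
    hence "a \<in> E" using YE at(1) unfolding Y_def by blast
    thus ?thesis using at by blast
  qed
  have sH: "subgroup H G"
  proof (rule subgroup.intro)
    show "H \<subseteq> carrier G" using Tc by (auto simp: H_def)
    show "\<one> \<in> H" using S_decomp[of \<one>] by (auto simp: H_def S_def)
    fix x y assume "x \<in> H" "y \<in> H"
    then obtain e t e' t' where et: "e \<in> E" "t \<in> T" "x = e \<otimes> t" "e' \<in> E" "t' \<in> T" "y = e' \<otimes> t'"
      by (auto simp: H_def)
    have "t \<otimes> t' \<in> S" using et by (auto simp: S_def)
    then obtain e2 t2 where e2: "e2 \<in> E" "t2 \<in> T" "t \<otimes> t' = e2 \<otimes> t2" using S_decomp by blast
    have "x \<otimes> y = e \<otimes> (t \<otimes> e' \<otimes> inv t) \<otimes> (t \<otimes> t')"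
      using et Tc by (simp add: word_simps)
    also have "\<dots> = e \<otimes> (t \<otimes> e' \<otimes> inv t) \<otimes> e2 \<otimes> t2" using et Tc e2 by (simp add: m_assoc)
    finally show "x \<otimes> y \<in> H" using HI[of "e \<otimes> (t \<otimes> e' \<otimes> inv t) \<otimes> e2" t2] conjE[of t e'] et e2 Tc by simp
  next
    fix x assume "x \<in> H"
    then obtain e t where et: "e \<in> E" "t \<in> T" "x = e \<otimes> t" by (auto simp: H_def)
    have "inv t \<in> S" using et by (auto simp: S_def)
    then obtain e2 t2 where e2: "e2 \<in> E" "t2 \<in> T" "inv t = e2 \<otimes> t2" using S_decomp by blast
    have "inv x = (inv t \<otimes> inv e \<otimes> inv (inv t)) \<otimes> inv t" using et Tc by (simp add: word_simps)
    also have "\<dots> = (inv t \<otimes> inv e \<otimes> inv (inv t)) \<otimes> (e2 \<otimes> t2)" using e2 by simp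
    also have "\<dots> = (inv t \<otimes> inv e \<otimes> inv (inv t)) \<otimes> e2 \<otimes> t2" using e2 et Tc by (simp add: m_assoc)
    finally have eq: "inv x = (inv t \<otimes> inv e \<otimes> inv (inv t)) \<otimes> e2 \<otimes> t2" .
    have "inv t \<otimes> inv e \<otimes> inv (inv t) \<in> E" using et Tc by (intro conjE) auto
    hence "inv t \<otimes> inv e \<otimes> inv (inv t) \<otimes> e2 \<in> E" using e2(1) by (rule E.m_closed)
    thus "inv x \<in> H" using eq e2 HI by simp
  qed
  have EH: "E \<subseteq> H"
  proof
    fix d assume d: "d \<in> E"
    obtain e t where et: "e \<in> E" "t \<in> T" "\<one> = e \<otimes> t" using S_decomp[of \<one>] by (auto simp: S_def)
    have "d = (d \<otimes> e) \<otimes> t" using d et Tc by (simp add: m_assoc flip: et(3))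
    thus "d \<in> H" using HI[of "d \<otimes> e" t] d et by simp
  qed
  have TH: "T \<subseteq> H" using HI[of \<one>] Tc by fastforce
  have "H = carrier G"
  proof (rule contranormal_freeD[OF free sH])
    fix K assume K: "K \<lhd> G" "H \<subseteq> K"
    have sK: "subgroup K G" using K by (simp add: normal_imp_subgroup)
    have "commutator_sub G A (carrier G) \<subseteq> K"
    proof (rule commutator_sub_leI[OF sK])
      fix a g assume a: "a \<in> A" and g: "g \<in> carrier G"
      obtain b t where bt: "b \<in> A" "t \<in> T" "g = b \<otimes> t" using T(3)[OF g] by blast
      have tK: "t \<in> K" using bt TH K by blast
      have "a \<otimes> t \<otimes> inv a \<in> K" using tK K(1) A_carrier[OF a] by (simp add: normal_inv_iff)
      hence "(a \<otimes> t \<otimes> inv a) \<otimes> inv t \<in> K"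
        using tK sK by (simp add: subgroup.m_closed subgroup.m_inv_closed)
      thus "a \<otimes> g \<otimes> inv a \<otimes> inv g \<in> K"
        using commutator_A_mult_transversal[OF a bt(1) Tc[OF bt(2)]] bt(3) by simp
    qed
    hence AK: "A \<subseteq> K" using prod DE EH K(2) subgroup.m_closed[OF sK] by blast
    have "g \<in> K" if g: "g \<in> carrier G" for g
    proof -
      obtain b t where bt: "b \<in> A" "t \<in> T" "g = b \<otimes> t" using T(3)[OF g] by blast
      thus ?thesis using AK TH K(2) subgroup.m_closed[OF sK, of b t] by blast
    qed
    thus "K = carrier G" using normal_subset[OF K(1)] by blast
  qed
  \<comment> \<open>A transversal element \<open>t\<close> lying in \<open>A\<close> has
    \<open>inv t = \<one> \<otimes> inv t\<close> in \<open>Y\<close>, because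
    \<open>\<one> \<in> S\<close>. Hence \<open>H\<close> meets \<open>A\<close> in
    \<open>E\<close>.\<close>
  have "A \<subseteq> E"
  proof
    fix a assume a: "a \<in> A"
    hence "a \<in> H" using \<open>H = carrier G\<close> A_carrier by blast
    then obtain e t where et: "e \<in> E" "t \<in> T" "a = e \<otimes> t" by (auto simp: H_def)
    have "inv e \<otimes> a \<in> A"
      using a subsetD[OF EA et(1)] A_subgroup by (simp add: subgroup.m_closed subgroup.m_inv_closed)
    hence "t \<in> A" using et Tc by (simp add: inv_cancel_left)
    hence "inv t \<in> A" using A_subgroup by (simp add: subgroup.m_inv_closed)
    moreover have "inv t = \<one> \<otimes> inv t" using et Tc by simp
    moreover have "(\<one>, t) \<in> S \<times> T" using et by (simp add: S_def)
    ultimately have "inv t \<in> Y" unfolding Y_def by force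
    hence "inv (inv t) \<in> E" using YE E.m_inv_closed by blast
    hence "t \<in> E" using et Tc by simp
    thus "a \<in> E" using et by simp
  qed
  thus ?thesis using EA FA \<open>finite F\<close> unfolding E_def by blast
qed

text \<open>Modulo \<open>D\<close> the assumption reads \<open>A = [A, G]\<close>, and this can be
  substituted into itself \<open>n\<close> times.\<close>

lemma prod_iter_comm:
  assumes D: "D \<lhd> G" "D \<subseteq> A"
    and prod: "\<And>a. a \<in> A \<Longrightarrow> \<exists>d\<in>D. \<exists>c\<in>commutator_sub G A (carrier G). a = d \<otimes> c"
  shows "a \<in> A \<Longrightarrow> \<exists>d\<in>D. \<exists>c\<in>iter_comm G A n. a = d \<otimes> c"
proof (induction n arbitrary: a)
  case 0
  thus ?case using A_carrier subgroup.one_closed[OF normal_imp_subgroup[OF D(1)]] by force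
next
  case (Suc n)
  let ?A = "G\<lparr>carrier := A\<rparr>" and ?C = "iter_comm G A (Suc n)"
  interpret A: comm_group ?A using A_subgroup by (simp add: comm_group_sub)
  have nC: "?C \<lhd> G" by (rule iter_comm_normal[OF A_normal])
  have CA: "?C \<subseteq> A" using iter_comm_antimono[OF A_normal, of 0 "Suc n"] by simp
  have "subgroup D ?A" "subgroup ?C ?A"
    using D nC CA A_subgroup by (simp_all add: subgroup_incl normal_imp_subgroup)
  hence "subgroup (D <#>\<^bsub>?A\<^esub> ?C) ?A" by (rule A.mult_subgroups)
  hence sub: "subgroup (D <#> ?C) G" using incl_subgroup[OF A_subgroup] by simp
  have "commutator_sub G A (carrier G) \<subseteq> D <#> ?C"
  proof (rule commutator_sub_leI[OF sub])
    fix b g assume b: "b \<in> A" and g: "g \<in> carrier G"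
    obtain d c where dc: "d \<in> D" "c \<in> iter_comm G A n" "b = d \<otimes> c" using Suc.IH[OF b] by blast
    have cA: "c \<in> A" using dc iter_comm_antimono[OF A_normal, of 0 n] by auto
    have dA: "d \<in> A" using dc D by blast
    have cc: "c \<in> carrier G" "d \<in> carrier G" using cA dA A_carrier by auto
    have k: "c \<otimes> g \<otimes> inv c \<otimes> inv g \<in> ?C" unfolding iter_comm_Suc using dc g by (intro commutator_sub_incl)
    have id: "inv d \<in> D" using dc D by (simp add: normal_imp_subgroup subgroup.m_inv_closed)
    have e: "g \<otimes> inv d \<otimes> inv g \<in> D" using id g D by (simp add: normal_inv_iff)
    have "b \<otimes> g \<otimes> inv b \<otimes> inv g = d \<otimes> ((c \<otimes> g \<otimes> inv c \<otimes> inv g) \<otimes> (g \<otimes> inv d \<otimes> inv g))"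
      unfolding dc(3) using cc g by (simp add: word_simps)
    also have "\<dots> = d \<otimes> ((g \<otimes> inv d \<otimes> inv g) \<otimes> (c \<otimes> g \<otimes> inv c \<otimes> inv g))"
      by (subst A_comm[OF subsetD[OF CA k] subsetD[OF D(2) e]]) (rule refl)
    also have "\<dots> = (d \<otimes> (g \<otimes> inv d \<otimes> inv g)) \<otimes> (c \<otimes> g \<otimes> inv c \<otimes> inv g)"
      using cc g by (simp add: m_assoc)
    finally have "b \<otimes> g \<otimes> inv b \<otimes> inv g = (d \<otimes> (g \<otimes> inv d \<otimes> inv g)) \<otimes> (c \<otimes> g \<otimes> inv c \<otimes> inv g)" .
    moreover have "d \<otimes> (g \<otimes> inv d \<otimes> inv g) \<in> D"
      using dc(1) e D by (simp add: normal_imp_subgroup subgroup.m_closed)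
    ultimately show "b \<otimes> g \<otimes> inv b \<otimes> inv g \<in> D <#> ?C" using k by (auto simp: set_mult_def)
  qed
  moreover obtain d c where dc: "d \<in> D" "c \<in> commutator_sub G A (carrier G)" "a = d \<otimes> c"
    using prod[OF Suc.prems] by blast
  ultimately obtain d' c' where dc': "d' \<in> D" "c' \<in> ?C" "c = d' \<otimes> c'" by (auto simp: set_mult_def)
  have "a = (d \<otimes> d') \<otimes> c'" using dc dc' D CA A_carrier by (simp add: m_assoc subset_iff)
  moreover have "d \<otimes> d' \<in> D" using dc dc' D by (simp add: normal_imp_subgroup subgroup.m_closed)
  ultimately show ?case using dc' by blast
qed

text \<open>If \<open>D \<noteq> A\<close>, adding generators of \<open>A\<close> modulo
  \<open>D\<close> one at a time gives a proper \<open>E\<close> and an \<open>x\<close> that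
  generate \<open>A\<close>. For \<open>M \<supseteq> E\<close> maximal avoiding \<open>x\<close>,
  the quotient \<open>A / M\<close> is finite cyclic, so \<open>core M\<close> is normal of finite
  index in \<open>G\<close>, and it contains \<open>D\<close>. Iterated commutators of
  \<open>A\<close> end in \<open>core M\<close>, and \<open>prod_iter_comm\<close> then puts
  \<open>A\<close> itself there.\<close>

lemma commutator_superfluous:
  assumes free: "contranormal_free G" and D: "D \<lhd> G" "D \<subseteq> A"
    and prod: "\<And>a. a \<in> A \<Longrightarrow> \<exists>d\<in>D. \<exists>c\<in>commutator_sub G A (carrier G). a = d \<otimes> c"
  shows "D = A"
proof (rule ccontr)
  assume "D \<noteq> A"
  let ?A = "G\<lparr>carrier := A\<rparr>"
  interpret A: endo_group ?A "conj_endos A" by (rule conj_endo_group[OF A_normal order_refl])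
  obtain F where F: "finite F" "F \<subseteq> A" "generate G (F \<union> D) = A"
    using finitely_generated_mod[OF free D prod] by blast
  have "\<exists>Y x. Y \<subseteq> F \<and> x \<in> F \<and> generate G (Y \<union> D) \<noteq> A \<and> generate G (insert x Y \<union> D) = A"
  proof (rule ccontr)
    assume no: "\<not> ?thesis"
    have "generate G (F \<union> D) \<noteq> A"
    proof (rule finite_subset_induct'[OF F(1) order_refl])
      have "generate G D \<subseteq> D" using D by (intro generate_subgroup_incl) (auto simp: normal_imp_subgroup)
      thus "generate G ({} \<union> D) \<noteq> A" using \<open>D \<noteq> A\<close> D(2) by auto
    next
      fix x Y assume "x \<in> F" "Y \<subseteq> F" "generate G (Y \<union> D) \<noteq> A"
      thus "generate G (insert x Y \<union> D) \<noteq> A" using no by blast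
    qed
    thus False using F(3) by blast
  qed
  then obtain Y x where Y: "Y \<subseteq> F" and x: "x \<in> F" and ne: "generate G (Y \<union> D) \<noteq> A"
    and gen: "generate G (insert x Y \<union> D) = A" by blast
  define E where "E = generate G (Y \<union> D)"
  have xA: "x \<in> A" using x F by blast
  have YDA: "Y \<union> D \<subseteq> A" using Y F D by blast
  have YDc: "Y \<union> D \<subseteq> carrier G" using YDA A_carrier by blast
  have sE: "subgroup E G" unfolding E_def by (rule generate_is_subgroup[OF YDc])
  have EA: "E \<subseteq> A" unfolding E_def by (rule generate_subgroup_incl[OF YDA A_subgroup])
  have YDE: "Y \<union> D \<subseteq> E" unfolding E_def by (auto intro: generate.incl)
  have xE: "x \<notin> E"
  proof
    assume "x \<in> E"
    hence "generate G (insert x Y \<union> D) \<subseteq> E" using YDE by (intro generate_subgroup_incl[OF _ sE]) auto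
    thus False using gen ne EA unfolding E_def by blast
  qed
  have sEA: "subgroup E ?A" using sE EA A_subgroup by (simp add: subgroup_incl)
  obtain M where M: "E \<subseteq> M" "A.max_avoiding x M" using A.max_avoiding_exists[OF sEA] xA xE by auto
  hence sM: "subgroup M ?A" and xM: "x \<notin> M" by (auto simp: A.max_avoiding_def)
  interpret M: subgroup M ?A by (rule sM)
  have xAc: "x \<in> carrier ?A" using xA by simp
  have "A.adjoin M x = A"
  proof
    have sub: "subgroup (A.adjoin M x) ?A" by (rule A.adjoin_subgroup[OF sM xAc])
    thus "A.adjoin M x \<subseteq> A" using subgroup.subset by fastforce
    have "insert x Y \<union> D \<subseteq> A.adjoin M x"
      using A.adjoin_incl[OF sM xAc] M(1) YDE by blast
    thus "A \<subseteq> A.adjoin M x"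
      using generate_subgroup_incl[OF _ incl_subgroup[OF A_subgroup sub]] gen by blast
  qed
  obtain s :: int where s: "s > 0" "x [^]\<^bsub>?A\<^esub> s \<in> M"
    using A.max_avoiding_torsion[OF M(2)] by blast
  define D0 where "D0 = A.core M"
  have "finite ((\<lambda>b. D0 #>\<^bsub>?A\<^esub> b) ` A)"
    unfolding D0_def
  proof (rule A.finite_core_cosets[OF sM xAc])
    fix b f assume b: "b \<in> A" and f: "f \<in> conj_endos A"
    have "f b \<in> carrier ?A" using hom_in_carrier[OF A.endo_hom[OF f]] b by simp
    hence "f b \<in> A.adjoin M x" using \<open>A.adjoin M x = A\<close> by simp
    thus "\<exists>i<nat s. f b \<otimes>\<^bsub>?A\<^esub> inv\<^bsub>?A\<^esub> (x [^]\<^bsub>?A\<^esub> i) \<in> M"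
      by (rule A.adjoin_cover[OF sM xAc s])
  qed simp
  moreover have "rcosets\<^bsub>?A\<^esub> D0 = (\<lambda>b. D0 #>\<^bsub>?A\<^esub> b) ` A" by (auto simp: RCOSETS_def)
  ultimately have finD0: "finite (rcosets\<^bsub>?A\<^esub> D0)" by simp
  have "A.invariant D0" unfolding D0_def by (rule A.core_invariant[OF sM])
  hence D0: "D0 \<lhd> G" "D0 \<subseteq> A" using invariant_iff_normal[OF A_normal order_refl] by auto
  have "subgroup D0 ?A" unfolding D0_def by (rule A.core_subgroup[OF sM])
  then obtain R where R: "finite R" "R \<subseteq> A" "\<And>a. a \<in> A \<Longrightarrow> \<exists>d\<in>D0. \<exists>r\<in>R. a = d \<otimes> r"
    using finD0 A.finite_rcosets_iff by auto
  obtain T where T: "finite T" "T \<subseteq> carrier G" "\<And>g. g \<in> carrier G \<Longrightarrow> \<exists>a\<in>A. \<exists>t\<in>T. g = a \<otimes> t"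
    by (rule finite_transversal) blast
  have "finite (rcosets D0)"
  proof -
    let ?T = "(\<lambda>(r, t). r \<otimes> t) ` (R \<times> T)"
    have "\<exists>d\<in>D0. \<exists>u\<in>?T. g = d \<otimes> u" if g: "g \<in> carrier G" for g
    proof -
      obtain a t where at: "a \<in> A" "t \<in> T" "g = a \<otimes> t" using T(3)[OF g] by blast
      obtain d r where dr: "d \<in> D0" "r \<in> R" "a = d \<otimes> r" using R(3)[OF at(1)] by blast
      have "d \<in> carrier G" "r \<in> carrier G" "t \<in> carrier G" using dr at D0 R T A_carrier by auto
      hence "g = d \<otimes> (r \<otimes> t)" using at dr by (simp add: m_assoc)
      thus ?thesis using dr at by blast
    qed
    moreover have "?T \<subseteq> carrier G" using R(2) T(2) A_carrier by (auto intro!: m_closed)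
    moreover have "finite ?T" using R T by simp
    ultimately show ?thesis using finite_rcosets_iff[OF normal_imp_subgroup[OF D0(1)]] by blast
  qed
  then obtain n where n: "lower_central G n \<subseteq> D0"
    using contranormal_free_lower_central_subset[OF free D0(1)] by blast
  have "iter_comm G A n \<subseteq> D0"
    using n iter_comm_mono[of A "carrier G" n] A_carrier by (auto simp: lower_central_eq_iter_comm)
  moreover have "D \<subseteq> D0"
  proof
    fix d assume d: "d \<in> D"
    have "f d \<in> M" if f: "f \<in> conj_endos A" for f
    proof -
      obtain g where g: "g \<in> carrier G" "f = (\<lambda>a\<in>A. g \<otimes> a \<otimes> inv g)" using f by (auto simp: conj_endos_def)
      have "g \<otimes> d \<otimes> inv g \<in> D" using D(1) d g by (simp add: normal_inv_iff)
      thus ?thesis using g d D(2) YDE M(1) by auto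
    qed
    thus "d \<in> D0" using d D(2) by (auto simp: D0_def A.core_def)
  qed
  ultimately have "A \<subseteq> D0"
    using prod_iter_comm[OF D prod, of _ n] subgroup.m_closed[OF normal_imp_subgroup[OF D0(1)]] by blast
  hence "x \<in> M" using xA A.core_subset unfolding D0_def by blast
  thus False using xM by blast
qed

end

section \<open>Central actions of prime order\<close>

context comm_group
begin

text \<open>The binomial theorem for \<open>f + 1\<close> in the endomorphism ring, in
  multiplicative notation.\<close>

lemma binomial_hom:
  assumes f: "f \<in> hom G G" and a: "a \<in> carrier G"
  shows "((\<lambda>x. f x \<otimes> x) ^^ n) a = (\<Otimes>i\<in>{..n}. (f ^^ i) a [^] (n choose i))"
proof (induction n)
  case 0
  thus ?case using a by simp
next
  case (Suc n)
  interpret f: group_hom G G f using f by (simp add: group_hom_def group_hom_axioms_def)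
  have fa: "(f ^^ i) a \<in> carrier G" for i by (induction i) (use a in auto)
  let ?F = "\<lambda>n i. (f ^^ i) a [^] (n choose i)" and ?H = "\<lambda>i. (f ^^ Suc i) a [^] (n choose i)"
  have img: "f (\<Otimes>i\<in>{..m}. ?F n i) = (\<Otimes>i\<in>{..m}. ?H i)" for m
    by (induction m) (use fa a in \<open>simp_all add: f.hom_nat_pow Pi_def\<close>)
  have "(\<Otimes>i\<in>{..Suc n}. ?F (Suc n) i) = (\<Otimes>i\<in>{..n}. ?F (Suc n) (Suc i)) \<otimes> ?F (Suc n) 0"
    using fa by (intro finprod_Suc2) auto
  also have "(\<Otimes>i\<in>{..n}. ?F (Suc n) (Suc i)) = (\<Otimes>i\<in>{..n}. ?H i \<otimes> ?F n (Suc i))"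
    using fa by (intro finprod_cong') (auto simp: nat_pow_mult)
  also have "\<dots> = (\<Otimes>i\<in>{..n}. ?H i) \<otimes> (\<Otimes>i\<in>{..n}. ?F n (Suc i))"
    using fa by (intro finprod_multf) auto
  also have "\<dots> \<otimes> ?F (Suc n) 0 = (\<Otimes>i\<in>{..n}. ?H i) \<otimes> ((\<Otimes>i\<in>{..n}. ?F n (Suc i)) \<otimes> ?F n 0)"
    using fa a by (simp add: m_assoc Pi_def del: funpow.simps)
  also have "(\<Otimes>i\<in>{..n}. ?F n (Suc i)) \<otimes> ?F n 0 = (\<Otimes>i\<in>{..Suc n}. ?F n i)"
    using fa by (intro finprod_Suc2[symmetric]) auto
  also have "\<dots> = (\<Otimes>i\<in>{..n}. ?F n i)"
    using fa a by (subst finprod_Suc) (auto simp: Pi_def binomial_eq_0)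
  finally show ?case using Suc.IH img[of n] by simp
qed

text \<open>Additively, \<open>(f + 1)^p = f^p + 1 + p (...)\<close>: the inner binomial
  coefficients are divisible by the prime \<open>p\<close>.\<close>

lemma hom_pow_prime:
  assumes f: "f \<in> hom G G" and a: "a \<in> carrier G" and p: "Factorial_Ring.prime p"
  shows "\<exists>w\<in>carrier G. ((\<lambda>x. f x \<otimes> x) ^^ p) a = (f ^^ p) a \<otimes> (a \<otimes> w [^] p)"
proof -
  have fc: "f x \<in> carrier G" if "x \<in> carrier G" for x using f that by (rule hom_in_carrier)
  have fa: "(f ^^ i) a \<in> carrier G" for i by (induction i) (use a fc in auto)
  let ?F = "\<lambda>i. (f ^^ i) a [^] (p choose i)"
  have part: "\<exists>w\<in>carrier G. (\<Otimes>i\<in>{..m}. ?F i) = a \<otimes> w [^] p" if "m < p" for m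
    using that
  proof (induction m)
    case 0
    show ?case using a by (intro bexI[of _ \<one>]) auto
  next
    case (Suc m)
    then obtain w where w: "w \<in> carrier G" "(\<Otimes>i\<in>{..m}. ?F i) = a \<otimes> w [^] p" by auto
    have "p dvd (p choose Suc m)" using p Suc.prems by (intro dvd_choose_prime) auto
    then obtain q where q: "p choose Suc m = p * q" by (rule dvdE)
    let ?u = "(f ^^ Suc m) a [^] q"
    have uc: "?u \<in> carrier G" by (rule nat_pow_closed[OF fa])
    have "(\<Otimes>i\<in>{..Suc m}. ?F i) = ?F (Suc m) \<otimes> (\<Otimes>i\<in>{..m}. ?F i)"
      using fa by (intro finprod_Suc) auto
    also have "?F (Suc m) = ?u [^] p" using fa[of "Suc m"] by (simp only: q nat_pow_pow mult.commute)
    also have "?u [^] p \<otimes> (\<Otimes>i\<in>{..m}. ?F i) = a \<otimes> (?u \<otimes> w) [^] p"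
      unfolding w(2) nat_pow_distrib[OF uc w(1)] using uc a w(1) by (simp add: m_lcomm del: funpow.simps)
    finally show ?case using uc w(1) by blast
  qed
  obtain q where q: "p = Suc q" using prime_gt_0_nat[OF p] by (cases p) auto
  obtain w where w: "w \<in> carrier G" "(\<Otimes>i\<in>{..q}. ?F i) = a \<otimes> w [^] p" using part[of q] q by auto
  have "((\<lambda>x. f x \<otimes> x) ^^ p) a = (\<Otimes>i\<in>{..p}. ?F i)" by (rule binomial_hom[OF f a])
  also have "\<dots> = ?F p \<otimes> (\<Otimes>i\<in>{..q}. ?F i)"
    unfolding q using fa by (intro finprod_Suc) (auto simp del: funpow.simps)
  finally show ?thesis using w fa[of p] by (intro bexI[of _ w]) simp_all
qed

end

context virtually_abelian
begin

text \<open>Because \<open>\<psi>\<close> commutes with conjugation, it maps the commutator of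
  \<open>x\<close> and \<open>g\<close> to that of \<open>\<psi> x\<close> and
  \<open>g\<close>.\<close>

lemma equivariant_iter_comm:
  assumes K: "K \<lhd> G" "K \<subseteq> A" and \<psi>: "\<psi> \<in> hom (G\<lparr>carrier := A\<rparr>) (G\<lparr>carrier := A\<rparr>)"
    and eq: "\<And>g a. \<lbrakk>g \<in> carrier G; a \<in> A\<rbrakk> \<Longrightarrow> \<psi> (g \<otimes> a \<otimes> inv g) = g \<otimes> \<psi> a \<otimes> inv g"
  shows "iter_comm G (\<psi> ` K) n \<subseteq> \<psi> ` iter_comm G K n"
proof (induction n)
  case (Suc n)
  let ?A = "G\<lparr>carrier := A\<rparr>"
  interpret A: group ?A by (rule subgroup_imp_group[OF A_subgroup])
  interpret \<psi>: group_hom ?A ?A \<psi> using \<psi> by (simp add: group_hom_def group_hom_axioms_def)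
  have N: "iter_comm G K n \<lhd> G" "iter_comm G K (Suc n) \<lhd> G" by (rule iter_comm_normal[OF K(1)])+
  have NA: "iter_comm G K n \<subseteq> A" "iter_comm G K (Suc n) \<subseteq> A"
    using iter_comm_antimono[OF K(1), of 0] K(2) by (metis iter_comm_0 le0 order_trans)+
  have "subgroup (iter_comm G K (Suc n)) ?A"
    using N NA A_subgroup by (simp add: subgroup_incl normal_imp_subgroup)
  hence sub: "subgroup (\<psi> ` iter_comm G K (Suc n)) G"
    using incl_subgroup[OF A_subgroup \<psi>.subgroup_img_is_subgroup] by blast
  have "commutator_sub G (\<psi> ` iter_comm G K n) (carrier G) \<subseteq> \<psi> ` iter_comm G K (Suc n)"
  proof (rule commutator_sub_leI[OF sub])
    fix y g assume "y \<in> \<psi> ` iter_comm G K n" and g: "g \<in> carrier G"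
    then obtain x where x: "x \<in> iter_comm G K n" "y = \<psi> x" by blast
    have xA: "x \<in> A" using x NA by blast
    have ix: "inv x \<in> A" using xA A_subgroup by (simp add: subgroup.m_inv_closed)
    have pA: "\<psi> x \<in> A" "\<psi> (inv x) \<in> A" using \<psi>.hom_closed xA ix by auto
    have pi: "\<psi> (inv x) = inv (\<psi> x)"
      using \<psi>.hom_inv[of x] xA pA m_inv_consistent[OF A_subgroup] by simp
    have cA: "g \<otimes> inv x \<otimes> inv g \<in> A" by (rule A_conj[OF g ix])
    have c: "x \<in> carrier G" "\<psi> x \<in> carrier G" using xA pA A_carrier by auto
    have "\<psi> (x \<otimes> g \<otimes> inv x \<otimes> inv g) = \<psi> (x \<otimes> (g \<otimes> inv x \<otimes> inv g))" using c g by (simp add: m_assoc)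
    also have "\<dots> = \<psi> x \<otimes> (g \<otimes> inv (\<psi> x) \<otimes> inv g)" using \<psi>.hom_mult[of x "g \<otimes> inv x \<otimes> inv g"] xA cA eq[OF g ix] pi by simp
    also have "\<dots> = y \<otimes> g \<otimes> inv y \<otimes> inv g" using c g x by (simp add: m_assoc)
    finally have "y \<otimes> g \<otimes> inv y \<otimes> inv g = \<psi> (x \<otimes> g \<otimes> inv x \<otimes> inv g)" by simp
    moreover have "x \<otimes> g \<otimes> inv x \<otimes> inv g \<in> iter_comm G K (Suc n)"
      unfolding iter_comm_Suc using x g by (intro commutator_sub_incl)
    ultimately show "y \<otimes> g \<otimes> inv y \<otimes> inv g \<in> \<psi> ` iter_comm G K (Suc n)" by blast
  qed
  moreover have "iter_comm G (\<psi> ` K) (Suc n) \<subseteq> commutator_sub G (\<psi> ` iter_comm G K n) (carrier G)"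
    unfolding iter_comm_Suc by (rule commutator_sub_mono[OF Suc.IH order_refl])
  ultimately show ?case by blast
qed simp

end

text \<open>In the acting group \<open>G / centr G A\<close>, the image of \<open>z\<close> is
  central and has trivial \<open>p\<close>-th power.\<close>

locale central_prime_action = virtually_abelian +
  fixes z and p :: nat
  assumes free: "contranormal_free G"
    and z: "z \<in> carrier G"
    and central: "\<And>g. g \<in> carrier G \<Longrightarrow> z \<otimes> g \<otimes> inv z \<otimes> inv g \<in> centr G A"
    and p: "Factorial_Ring.prime p"
    and zp: "z [^] p \<in> centr G A"
begin

text \<open>The endomorphism \<open>z - 1\<close> of \<open>A\<close> in additive notation, so that
  \<open>\<phi> x \<otimes> x\<close> is conjugation by \<open>z\<close>.\<close>

definition \<phi> where "\<phi> a = (z \<otimes> a \<otimes> inv z) \<otimes> inv a"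

abbreviation "GA \<equiv> G\<lparr>carrier := A\<rparr>"

sublocale A: endo_group GA "conj_endos A"
  by (rule conj_endo_group[OF A_normal order_refl])

lemma inv_A: "a \<in> A \<Longrightarrow> inv a \<in> A"
  using A_subgroup by (simp add: subgroup.m_inv_closed)

lemma mult_A: "\<lbrakk>a \<in> A; b \<in> A\<rbrakk> \<Longrightarrow> a \<otimes> b \<in> A"
  using A_subgroup by (simp add: subgroup.m_closed)

lemma \<phi>_A: "a \<in> A \<Longrightarrow> \<phi> a \<in> A"
  unfolding \<phi>_def using A_conj[OF z] inv_A mult_A by blast

lemma \<phi>_mult:
  assumes "a \<in> A" "b \<in> A"
  shows "\<phi> (a \<otimes> b) = \<phi> a \<otimes> \<phi> b"
proof -
  have c: "a \<in> carrier G" "b \<in> carrier G" using assms A_carrier by auto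
  have "\<phi> (a \<otimes> b) = (z \<otimes> a \<otimes> inv z) \<otimes> ((z \<otimes> b \<otimes> inv z) \<otimes> inv b) \<otimes> inv a"
    unfolding \<phi>_def using c z by (simp add: word_simps)
  also have "\<dots> = (z \<otimes> a \<otimes> inv z) \<otimes> (\<phi> b \<otimes> inv a)"
    using c z unfolding \<phi>_def by (simp add: m_assoc)
  also have "\<phi> b \<otimes> inv a = inv a \<otimes> \<phi> b" using A_comm \<phi>_A assms inv_A by blast
  finally show ?thesis unfolding \<phi>_def using c z by (simp add: m_assoc)
qed

lemma \<phi>_hom: "\<phi> \<in> hom GA GA"
  using \<phi>_A \<phi>_mult by (auto simp: hom_def)

sublocale \<phi>: group_hom GA GA \<phi>
  using \<phi>_hom by (simp add: group_hom_def group_hom_axioms_def)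

lemma \<phi>_inv: "a \<in> A \<Longrightarrow> \<phi> (inv a) = inv (\<phi> a)"
  using \<phi>.hom_inv[of a] m_inv_consistent[OF A_subgroup] \<phi>_A by simp

text \<open>Interchanging \<open>z\<close> and \<open>g\<close> produces a factor \<open>w\<close>
  in \<open>centr G A\<close>, which has no effect on \<open>A\<close>.\<close>

lemma \<phi>_conj:
  assumes g: "g \<in> carrier G" and a: "a \<in> A"
  shows "\<phi> (g \<otimes> a \<otimes> inv g) = g \<otimes> \<phi> a \<otimes> inv g"
proof -
  have ac: "a \<in> carrier G" using a A_carrier by blast
  define w where "w = z \<otimes> g \<otimes> inv z \<otimes> inv g"
  have w: "w \<in> centr G A" "w \<in> carrier G" using central[OF g] by (auto simp: w_def centr_def)
  have "z \<otimes> (g \<otimes> a \<otimes> inv g) \<otimes> inv z = w \<otimes> (g \<otimes> (z \<otimes> a \<otimes> inv z) \<otimes> inv g) \<otimes> inv w"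
    unfolding w_def using g z ac by (simp add: word_simps)
  also have "\<dots> = g \<otimes> (z \<otimes> a \<otimes> inv z) \<otimes> inv g"
    using w A_conj[OF g A_conj[OF z a]] by (simp add: centr_def)
  finally have "z \<otimes> (g \<otimes> a \<otimes> inv g) \<otimes> inv z = g \<otimes> (z \<otimes> a \<otimes> inv z) \<otimes> inv g" .
  thus ?thesis unfolding \<phi>_def using g z ac by (simp add: word_simps)
qed

lemma \<phi>_image_normal: "\<phi> ` A \<lhd> G"
proof (rule normal_invI)
  have "subgroup (\<phi> ` carrier GA) GA" by (rule \<phi>.img_is_subgroup)
  thus "subgroup (\<phi> ` A) G" using incl_subgroup[OF A_subgroup] by simp
  fix g b assume g: "g \<in> carrier G" and "b \<in> \<phi> ` A"
  then obtain a where a: "a \<in> A" "b = \<phi> a" by blast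
  have "g \<otimes> b \<otimes> inv g = \<phi> (g \<otimes> a \<otimes> inv g)" using \<phi>_conj[OF g a(1)] a by simp
  thus "g \<otimes> b \<otimes> inv g \<in> \<phi> ` A" using A_conj[OF g a(1)] by blast
qed

lemma \<phi>_image_subset: "\<phi> ` A \<subseteq> A"
  using \<phi>_A by blast

lemma GA_pow: "a \<in> A \<Longrightarrow> a [^]\<^bsub>GA\<^esub> (n::nat) = a [^] n"
  by (simp add: nat_pow_def)

lemma z_pow_conj:
  assumes a: "a \<in> A"
  shows "((\<lambda>x. \<phi> x \<otimes>\<^bsub>GA\<^esub> x) ^^ n) a = z [^] n \<otimes> a \<otimes> inv (z [^] n)"
proof (induction n)
  case 0
  thus ?case using a A_carrier by simp
next
  case (Suc n)
  let ?b = "z [^] n \<otimes> a \<otimes> inv (z [^] n)"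
  have b: "?b \<in> A" using A_conj a z by simp
  have ac: "a \<in> carrier G" using a A_carrier by blast
  have "\<phi> ?b \<otimes> ?b = z \<otimes> ?b \<otimes> inv z" unfolding \<phi>_def using A_carrier[OF b] z by (simp add: m_assoc)
  also have "\<dots> = z [^] Suc n \<otimes> a \<otimes> inv (z [^] Suc n)"
    using conj_conj[OF z _ ac, of "z [^] n"] z by (simp only: nat_pow_Suc2 nat_pow_closed)
  finally show ?case using Suc.IH by simp
qed

text \<open>\<open>z [^] p\<close> acts trivially, so expanding \<open>(\<phi> + 1)^p\<close> by
  \<open>hom_pow_prime\<close> cancels \<open>a\<close> and leaves the value of
  \<open>\<phi> ^^ p\<close> as the inverse of a \<open>p\<close>-th power.\<close>

lemma \<phi>_p_eq_pow:
  assumes a: "a \<in> A"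
  shows "\<exists>w\<in>A. (\<phi> ^^ p) a = w [^] p"
proof -
  have fa: "(\<phi> ^^ i) a \<in> A" for i by (induction i) (use a \<phi>_A in auto)
  obtain w where w: "w \<in> A" "((\<lambda>x. \<phi> x \<otimes>\<^bsub>GA\<^esub> x) ^^ p) a = (\<phi> ^^ p) a \<otimes> (a \<otimes> w [^]\<^bsub>GA\<^esub> p)"
    using A.hom_pow_prime[OF \<phi>_hom _ p, of a] a by auto
  have wp: "w [^] p \<in> A" using subgroup_nat_pow_closed[OF A_subgroup w(1)] .
  have c: "a \<in> carrier G" "w \<in> carrier G" "(\<phi> ^^ p) a \<in> carrier G" using a w fa A_carrier by auto
  have "z [^] p \<otimes> a \<otimes> inv (z [^] p) = a" using zp a by (simp add: centr_def)
  hence "a = (\<phi> ^^ p) a \<otimes> (a \<otimes> w [^] p)" using w z_pow_conj[OF a, of p] GA_pow by simp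
  also have "a \<otimes> w [^] p = w [^] p \<otimes> a" by (rule A_comm[OF a wp])
  finally have "a = ((\<phi> ^^ p) a \<otimes> w [^] p) \<otimes> a" using c by (simp add: m_assoc)
  hence "(\<phi> ^^ p) a \<otimes> w [^] p = \<one>" using c by (metis r_cancel_one' m_closed nat_pow_closed)
  hence "(\<phi> ^^ p) a = inv (w [^] p)" using c by (metis inv_equality nat_pow_closed)
  also have "\<dots> = (inv w) [^] p" using c by (simp add: nat_pow_inv)
  finally show ?thesis using inv_A[OF w(1)] by blast
qed

text \<open>The norm of the cyclic group generated by \<open>z\<close>: \<open>v\<close> is the product of the first \<open>n\<close>
  conjugates of \<open>b\<close>, and \<open>\<phi> v\<close> telescopes.\<close>

lemma norm_decomposition:
  fixes n :: nat
  assumes b: "b \<in> A"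
  shows "\<exists>v\<in>A. \<exists>c\<in>commutator_sub G A (carrier G).
    \<phi> v = (z [^] n \<otimes> b \<otimes> inv (z [^] n)) \<otimes> inv b \<and> b [^] n = v \<otimes> c"
proof -
  have bc: "b \<in> carrier G" using b A_carrier by blast
  have sC: "subgroup (commutator_sub G A (carrier G)) G"
    using normal_subset[OF A_normal] by (intro commutator_sub_subgroup) auto
  have CA: "commutator_sub G A (carrier G) \<subseteq> A" by (rule commutator_sub_le_left[OF A_normal order_refl])
  show ?thesis
  proof (induction n)
    case 0
    have "\<phi> \<one> = \<one>" using \<phi>.hom_one by simp
    thus ?case using bc subgroup.one_closed[OF sC] subgroup.one_closed[OF A_subgroup] by force
  next
    case (Suc n)
    then obtain v c where v: "v \<in> A" and c: "c \<in> commutator_sub G A (carrier G)"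
      and \<phi>v: "\<phi> v = (z [^] n \<otimes> b \<otimes> inv (z [^] n)) \<otimes> inv b" and bn: "b [^] n = v \<otimes> c" by blast
    let ?u = "z [^] n \<otimes> b \<otimes> inv (z [^] n)"
    have u: "?u \<in> A" using A_conj b z by simp
    have uc: "?u \<in> carrier G" using u A_carrier by blast
    have cA: "c \<in> A" using c CA by blast
    have vc: "v \<in> carrier G" "c \<in> carrier G" using v cA A_carrier by auto
    \<comment> \<open>The conjugate \<open>?u\<close> equals \<open>b\<close> up to a commutator
      with \<open>z [^] n\<close>; these commutators accumulate in \<open>c\<close>, so
      \<open>v\<close> agrees with the power of \<open>b\<close> modulo
      \<open>[A, G]\<close>.\<close>
    let ?k = "b \<otimes> (z [^] n) \<otimes> inv b \<otimes> inv (z [^] n)"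
    have k: "?k \<in> commutator_sub G A (carrier G)" using b z by (intro commutator_sub_incl) auto
    have kA: "?k \<in> A" using k CA by blast
    have kc: "?k \<in> carrier G" using kA A_carrier by blast
    have "\<phi> (v \<otimes> ?u) = \<phi> v \<otimes> \<phi> ?u" by (rule \<phi>_mult[OF v u])
    also have "\<dots> = inv b \<otimes> ?u \<otimes> \<phi> ?u" using \<phi>v A_comm[OF u inv_A[OF b]] by simp
    also have "\<dots> = inv b \<otimes> (?u \<otimes> \<phi> ?u)" using uc bc A_carrier[OF \<phi>_A[OF u]] by (simp add: m_assoc)
    also have "?u \<otimes> \<phi> ?u = \<phi> ?u \<otimes> ?u" by (rule A_comm[OF u \<phi>_A[OF u]])
    also have "\<phi> ?u \<otimes> ?u = z [^] Suc n \<otimes> b \<otimes> inv (z [^] Suc n)"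
      using z_pow_conj[OF b, of n] z_pow_conj[OF b, of "Suc n"] by simp
    also have "inv b \<otimes> (z [^] Suc n \<otimes> b \<otimes> inv (z [^] Suc n)) = (z [^] Suc n \<otimes> b \<otimes> inv (z [^] Suc n)) \<otimes> inv b"
      using b z by (intro A_comm inv_A A_conj nat_pow_closed)
    finally have 1: "\<phi> (v \<otimes> ?u) = (z [^] Suc n \<otimes> b \<otimes> inv (z [^] Suc n)) \<otimes> inv b" .
    have "?u \<otimes> ?k = ?k \<otimes> ?u" by (rule A_comm[OF u kA])
    also have "\<dots> = b" using bc z by (simp add: word_simps)
    finally have uk: "?u \<otimes> ?k = b" .
    have "b [^] Suc n = v \<otimes> (c \<otimes> (?u \<otimes> ?k))" using bn uk vc bc by (simp add: m_assoc)
    also have "c \<otimes> (?u \<otimes> ?k) = (c \<otimes> ?u) \<otimes> ?k" using vc uc kc by (simp only: m_assoc)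
    also have "c \<otimes> ?u = ?u \<otimes> c" by (rule A_comm[OF cA u])
    also have "v \<otimes> (?u \<otimes> c \<otimes> ?k) = (v \<otimes> ?u) \<otimes> (c \<otimes> ?k)" using vc uc kc by (simp only: m_assoc m_closed)
    finally have 2: "b [^] Suc n = (v \<otimes> ?u) \<otimes> (c \<otimes> ?k)" .
    show ?case using 1 2 mult_A[OF v u] subgroup.m_closed[OF sC c k] by blast
  qed
qed

lemma \<phi>_image_superfluous: "superfluous_pth_powers (G\<lparr>carrier := \<phi> ` A\<rparr>) (conj_endos (\<phi> ` A)) p"
proof -
  let ?B = "\<phi> ` A"
  interpret B: endo_group "G\<lparr>carrier := ?B\<rparr>" "conj_endos ?B"
    by (rule conj_endo_group[OF \<phi>_image_normal \<phi>_image_subset])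
  show ?thesis
  proof (unfold_locales, rule p)
    fix D
    assume inv: "B.invariant D"
      and prod: "\<And>b. b \<in> carrier (G\<lparr>carrier := ?B\<rparr>) \<Longrightarrow>
        \<exists>d\<in>D. \<exists>e\<in>carrier (G\<lparr>carrier := ?B\<rparr>). b = d \<otimes>\<^bsub>G\<lparr>carrier := ?B\<rparr>\<^esub> e [^]\<^bsub>G\<lparr>carrier := ?B\<rparr>\<^esub> p"
    have D: "D \<lhd> G" "D \<subseteq> ?B"
      using inv invariant_iff_normal[OF \<phi>_image_normal \<phi>_image_subset] by auto
    have sD: "subgroup D G" using D by (simp add: normal_imp_subgroup)
    define D' where "D' = {a \<in> A. \<phi> a \<in> D}"
    have sD': "subgroup D' G"
    proof (rule subgroup.intro)
      show "D' \<subseteq> carrier G" using A_carrier by (auto simp: D'_def)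
      show "\<one> \<in> D'" using \<phi>.hom_one subgroup.one_closed[OF sD] subgroup.one_closed[OF A_subgroup] by (simp add: D'_def)
      show "x \<otimes> y \<in> D'" if "x \<in> D'" "y \<in> D'" for x y
        using that \<phi>_mult mult_A subgroup.m_closed[OF sD] by (simp add: D'_def)
      show "inv x \<in> D'" if "x \<in> D'" for x
        using that \<phi>_inv inv_A subgroup.m_inv_closed[OF sD] by (simp add: D'_def)
    qed
    have nD': "D' \<lhd> G"
    proof (rule normal_invI[OF sD'])
      fix g a assume "g \<in> carrier G" "a \<in> D'"
      thus "g \<otimes> a \<otimes> inv g \<in> D'" using \<phi>_conj A_conj D(1) by (simp add: D'_def normal_inv_iff)
    qed
    have "D' = A"
    proof (rule commutator_superfluous[OF free nD'])
      show "D' \<subseteq> A" by (auto simp: D'_def)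
      fix a assume a: "a \<in> A"
      obtain d e where de: "d \<in> D" "e \<in> ?B" "\<phi> a = d \<otimes> e [^] p"
        using prod[of "\<phi> a"] a by (auto simp: nat_pow_def)
      obtain d' where d': "d' \<in> A" "d = \<phi> d'" using de D by blast
      obtain b where b: "b \<in> A" "e = \<phi> b" using de by blast
      obtain v c where vc: "v \<in> A" "c \<in> commutator_sub G A (carrier G)"
        "\<phi> v = (z [^] p \<otimes> b \<otimes> inv (z [^] p)) \<otimes> inv b" "b [^] p = v \<otimes> c"
        using norm_decomposition[OF b(1), of p] by blast
      have "\<phi> v = b \<otimes> inv b" using vc(3) zp b(1) by (simp add: centr_def)
      hence \<phi>v: "\<phi> v = \<one>" using b A_carrier by simp
      have bp: "b [^] p \<in> A" using subgroup_nat_pow_closed[OF A_subgroup b(1)] .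
      have "\<phi> (b [^] p) = e [^] p"
        using \<phi>.hom_nat_pow[of b p] b GA_pow[OF b(1)] GA_pow[OF \<phi>_A[OF b(1)]] by simp
      hence \<phi>a: "\<phi> a = \<phi> (d' \<otimes> b [^] p)" using de d' \<phi>_mult[OF d'(1) bp] by simp
      define k where "k = a \<otimes> inv (d' \<otimes> b [^] p)"
      have m: "d' \<otimes> b [^] p \<in> A" using mult_A d' bp by blast
      have kA: "k \<in> A" unfolding k_def using mult_A a inv_A[OF m] by blast
      have "\<phi> k = \<phi> a \<otimes> inv (\<phi> (d' \<otimes> b [^] p))" unfolding k_def using \<phi>_mult a inv_A[OF m] \<phi>_inv[OF m] by simp
      hence \<phi>k: "\<phi> k = \<one>" using \<phi>a A_carrier[OF \<phi>_A[OF m]] by simp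
      have cc: "a \<in> carrier G" "d' \<in> carrier G" "b [^] p \<in> carrier G" "k \<in> carrier G" "v \<in> carrier G"
        using a d' bp kA vc A_carrier by auto
      have "c \<in> A" using vc commutator_sub_le_left[OF A_normal order_refl] by blast
      hence "c \<in> carrier G" by (rule A_carrier)
      have "a = k \<otimes> (d' \<otimes> b [^] p)" unfolding k_def using cc by (simp add: m_assoc)
      also have "\<dots> = (k \<otimes> d' \<otimes> v) \<otimes> c" unfolding vc(4) using cc \<open>c \<in> carrier G\<close> by (simp add: m_assoc)
      finally have "a = (k \<otimes> d' \<otimes> v) \<otimes> c" .
      moreover have "k \<in> D'" "d' \<in> D'" "v \<in> D'"
        using kA \<phi>k d' de vc \<phi>v subgroup.one_closed[OF sD] by (auto simp: D'_def)
      hence "k \<otimes> d' \<otimes> v \<in> D'" using subgroup.m_closed[OF sD'] by blast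
      ultimately show "\<exists>d\<in>D'. \<exists>c\<in>commutator_sub G A (carrier G). a = d \<otimes> c" using vc(2) by blast
    qed
    hence "?B \<subseteq> D" by (auto simp: D'_def)
    thus "D = carrier (G\<lparr>carrier := ?B\<rparr>)" using D by auto
  qed
qed

lemma \<phi>_nilpotent: "\<exists>m. \<forall>a\<in>A. (\<phi> ^^ m) a = \<one>"
proof -
  have \<phi>i: "(\<phi> ^^ i) a \<in> A" if "a \<in> A" for a i using that by (induction i) (use \<phi>_A in auto)
  obtain k where k: "\<And>b. b \<in> \<phi> ` A \<Longrightarrow> b [^] (p ^ k) = \<one>"
    using superfluous_pth_powers.bounded_exponent[OF \<phi>_image_superfluous] by (auto simp: nat_pow_def)
  have pow: "(\<phi> ^^ i) (w [^] n) = ((\<phi> ^^ i) w) [^] n" if w: "w \<in> A" for w i and n :: nat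
  proof (induction i)
    case (Suc i)
    have "\<phi> (((\<phi> ^^ i) w) [^] n) = \<phi> ((\<phi> ^^ i) w) [^] n"
      using \<phi>.hom_nat_pow[of "(\<phi> ^^ i) w" n] GA_pow \<phi>i[OF w] \<phi>_A by simp
    thus ?case using Suc by simp
  qed simp
  have "\<exists>w\<in>A. (\<phi> ^^ (p * j)) a = w [^] (p ^ j)" if a: "a \<in> A" for a j
  proof (induction j)
    case 0
    show ?case using a A_carrier by (intro bexI[of _ a]) auto
  next
    case (Suc j)
    then obtain w where w: "w \<in> A" "(\<phi> ^^ (p * j)) a = w [^] (p ^ j)" by blast
    obtain w' where w': "w' \<in> A" "(\<phi> ^^ p) w = w' [^] p" using \<phi>_p_eq_pow[OF w(1)] by blast
    have "(\<phi> ^^ (p * Suc j)) a = (\<phi> ^^ p) ((\<phi> ^^ (p * j)) a)" by (simp add: funpow_add)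
    also have "\<dots> = (w' [^] p) [^] (p ^ j)" using w w' pow by simp
    also have "\<dots> = w' [^] (p ^ Suc j)" using A_carrier[OF w'(1)] by (simp add: nat_pow_pow)
    finally show ?case using w' by blast
  qed
  \<comment> \<open>The extra \<open>\<phi>\<close> is there because \<open>p ^ k\<close> is known
    to be an exponent of the image of \<open>\<phi>\<close>, not of \<open>A\<close>.\<close>
  hence "(\<phi> ^^ Suc (p * k)) a = \<one>" if a: "a \<in> A" for a
  proof -
    obtain w where w: "w \<in> A" "(\<phi> ^^ (p * k)) a = w [^] (p ^ k)"
      using \<open>\<And>j a. a \<in> A \<Longrightarrow> \<exists>w\<in>A. (\<phi> ^^ (p * j)) a = w [^] (p ^ j)\<close>[OF a] by blast
    have "(\<phi> ^^ Suc (p * k)) a = (\<phi> w) [^] (p ^ k)" using w pow[OF w(1), of 1] by simp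
    thus ?thesis using k w by simp
  qed
  thus ?thesis by blast
qed

text \<open>\<open>\<phi>\<close> commutes with the action, so \<open>n\<close> further commutators
  take the image of \<open>\<phi> ^^ j\<close> into the image of \<open>\<phi> ^^ Suc j\<close>;
  nilpotency of \<open>\<phi>\<close> ends this.\<close>

lemma iter_comm_trivial:
  assumes n: "iter_comm G A n \<subseteq> \<phi> ` A"
  shows "\<exists>m. iter_comm G A m \<subseteq> {\<one>}"
proof -
  have hom: "(\<phi> ^^ j) \<in> hom GA GA" for j
  proof (induction j)
    case (Suc j)
    thus ?case using \<phi>_hom by (auto simp: hom_def Pi_def)
  qed (auto simp: hom_def)
  have \<phi>i: "(\<phi> ^^ i) a \<in> A" if "a \<in> A" for a i using that by (induction i) (use \<phi>_A in auto)
  have equiv: "(\<phi> ^^ j) (g \<otimes> a \<otimes> inv g) = g \<otimes> (\<phi> ^^ j) a \<otimes> inv g" if "g \<in> carrier G" "a \<in> A" for g a j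
    by (induction j) (use that \<phi>_conj \<phi>i in auto)
  have "iter_comm G A (j * n) \<subseteq> (\<phi> ^^ j) ` A" for j
  proof (induction j)
    case (Suc j)
    have "iter_comm G A (Suc j * n) = iter_comm G (iter_comm G A (j * n)) n"
      by (simp add: iter_comm_add[symmetric] add.commute)
    also have "\<dots> \<subseteq> iter_comm G ((\<phi> ^^ j) ` A) n" by (rule iter_comm_mono[OF Suc.IH])
    also have "\<dots> \<subseteq> (\<phi> ^^ j) ` iter_comm G A n"
      by (rule equivariant_iter_comm[OF A_normal order_refl hom equiv])
    also have "\<dots> \<subseteq> (\<phi> ^^ j) ` \<phi> ` A" using n by (rule image_mono)
    also have "\<dots> = (\<phi> ^^ Suc j) ` A" by (simp add: funpow_swap1 image_image)
    finally show ?case .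
  qed simp
  moreover obtain m where "\<forall>a\<in>A. (\<phi> ^^ m) a = \<one>" using \<phi>_nilpotent by blast
  ultimately show ?thesis by (intro exI[of _ "m * n"]) fastforce
qed

end

section \<open>Nilpotency\<close>

context virtually_abelian
begin

lemma virtually_abelian_Mod:
  assumes B: "B \<lhd> G"
  shows "virtually_abelian (G Mod B) ((\<lambda>x. B #> x) ` A)"
proof -
  interpret B: normal B G by fact
  interpret h: group_hom G "G Mod B" "\<lambda>x. B #> x" by (rule B.Mod_group_hom)
  show ?thesis
  proof (rule virtually_abelian.intro[OF B.factorgroup_is_group virtually_abelian_axioms.intro])
    fix x y assume "x \<in> (\<lambda>x. B #> x) ` A" "y \<in> (\<lambda>x. B #> x) ` A"
    then obtain a b where ab: "a \<in> A" "b \<in> A" "x = B #> a" "y = B #> b" by blast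
    show "x \<otimes>\<^bsub>G Mod B\<^esub> y = y \<otimes>\<^bsub>G Mod B\<^esub> x"
      using h.hom_mult[of a b] h.hom_mult[of b a] ab A_carrier A_comm[OF ab(1,2)] by simp
  qed (rule B.Mod_image_normal[OF A_normal], rule B.finite_rcosets_Mod[OF A_subgroup A_index])
qed

lemma pow_mem_normal_above_A:
  assumes C: "C \<lhd> G" "A \<subseteq> C" and x: "x \<in> carrier G"
  shows "\<exists>m>0. x [^] (m::nat) \<in> C"
proof -
  interpret C: normal A G by (rule A_normal)
  interpret Q: group "G Mod A" by (rule C.factorgroup_is_group)
  have fin: "finite (carrier (G Mod A))" using A_index by (simp add: FactGroup_def)
  have "A #> x \<in> carrier (G Mod A)" using x by (auto simp: carrier_FactGroup)
  hence "(A #> x) [^]\<^bsub>G Mod A\<^esub> order (G Mod A) = A"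
    using Q.pow_order_eq_1 by simp
  hence "A #> (x [^] order (G Mod A)) = A" using C.FactGroup_pow[OF x] by simp
  hence "x [^] order (G Mod A) \<in> A" using C.rcos_eq_one_iff x by simp
  moreover have "order (G Mod A) > 0" using fin Q.order_gt_0_iff_finite by simp
  ultimately show ?thesis using C(2) by blast
qed

text \<open>Take \<open>y\<close> outside \<open>C\<close> in the last term of the lower central
  series not contained in \<open>C\<close>; its commutators with \<open>G\<close> lie in
  \<open>C\<close>. If \<open>m\<close> is the least positive exponent with
  \<open>y [^] m \<in> C\<close> and \<open>m = p * r\<close> with \<open>p\<close> prime, then
  \<open>z = y [^] r\<close> has the required properties.\<close>

lemma central_prime_element:
  assumes C: "C \<lhd> G" "A \<subseteq> C" "C \<noteq> carrier G" and c: "lower_central G c \<subseteq> C"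
  obtains z and p :: nat where "z \<in> carrier G" "z \<notin> C" "Factorial_Ring.prime p" "z [^] p \<in> C"
    "\<And>g. g \<in> carrier G \<Longrightarrow> z \<otimes> g \<otimes> inv z \<otimes> inv g \<in> C"
proof -
  define j where "j = (LEAST j. lower_central G j \<subseteq> C)"
  have j: "lower_central G j \<subseteq> C" unfolding j_def using c by (rule LeastI)
  have "j \<noteq> 0"
  proof
    assume "j = 0"
    thus False using j C(3) normal_subset[OF C(1)] by auto
  qed
  then obtain i where i: "j = Suc i" by (cases j) auto
  have "\<not> lower_central G i \<subseteq> C" using not_less_Least[of i "\<lambda>j. lower_central G j \<subseteq> C"] i by (simp add: j_def)
  then obtain y where y: "y \<in> lower_central G i" "y \<notin> C" by blast
  have nL: "lower_central G i \<lhd> G" unfolding lower_central_eq_iter_comm by (rule iter_comm_normal[OF normal_self])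
  have yc: "y \<in> carrier G" using y normal_subset[OF nL] by blast
  define m where "m = (LEAST m. m > 0 \<and> y [^] (m::nat) \<in> C)"
  have m: "m > 0 \<and> y [^] m \<in> C"
    unfolding m_def using pow_mem_normal_above_A[OF C(1,2) yc] by (rule LeastI_ex)
  have "m \<noteq> 1" using m y yc by (metis nat_pow_eone)
  then obtain p where p: "Factorial_Ring.prime p" "p dvd m" using prime_factor_nat by blast
  then obtain r where r: "m = p * r" by blast
  define z where "z = y [^] r"
  have zc: "z \<in> carrier G" unfolding z_def using yc by simp
  have "r > 0" using m r by (cases r) auto
  moreover have "r < m" unfolding r by (rule n_less_m_mult_n[OF _ prime_gt_1_nat[OF p(1), unfolded One_nat_def]]) fact
  ultimately have "z \<notin> C" unfolding z_def using not_less_Least[of r "\<lambda>m. m > 0 \<and> y [^] m \<in> C"] by (simp add: m_def)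
  moreover have "z [^] p \<in> C" unfolding z_def using m r yc by (simp add: nat_pow_pow mult.commute)
  moreover have "z \<otimes> g \<otimes> inv z \<otimes> inv g \<in> C" if g: "g \<in> carrier G" for g
  proof -
    have "z \<in> lower_central G i" unfolding z_def using subgroup_nat_pow_closed[OF normal_imp_subgroup[OF nL] y(1)] .
    hence "z \<otimes> g \<otimes> inv z \<otimes> inv g \<in> lower_central G (Suc i)" using g by (auto intro: commutator_sub_incl)
    thus ?thesis using j i by blast
  qed
  ultimately show thesis using that[OF zc _ p(1)] by blast
qed

text \<open>The target is \<open>B = {\<one>}\<close>; a general \<open>B\<close> makes the
  induction possible. In \<open>G Mod B\<close>, the image of \<open>\<phi>\<close> for a suitable
  \<open>z\<close> has a preimage \<open>B'\<close> in \<open>G\<close>. Modulo \<open>B'\<close>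
  also \<open>z\<close> acts trivially on \<open>A\<close>, so the kernel \<open>C B'\<close> is
  larger. The induction hypothesis brings \<open>A\<close> into \<open>B'\<close>, and
  \<open>iter_comm_trivial\<close> in \<open>G Mod B\<close> brings it into
  \<open>B\<close>.\<close>

lemma iter_comm_subset_normal:
  assumes free: "contranormal_free G" and B: "B \<lhd> G" "B \<subseteq> A"
  shows "\<exists>n. iter_comm G A n \<subseteq> B"
proof -
  obtain c where c: "lower_central G c \<subseteq> A"
    using contranormal_free_lower_central_subset[OF free A_normal A_index] by blast
  obtain T where T: "finite T" "T \<subseteq> carrier G" "\<And>g. g \<in> carrier G \<Longrightarrow> \<exists>a\<in>A. \<exists>t\<in>T. g = a \<otimes> t"
    by (rule finite_transversal) blast
  define C where "C B = centr_mod G A B" for B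
  have C_normal: "C B \<lhd> G" if "B \<lhd> G" for B unfolding C_def by (rule centr_mod_normal[OF A_normal that])
  have C_iff: "g \<in> C B \<longleftrightarrow> (\<forall>a\<in>A. g \<otimes> a \<otimes> inv g \<otimes> inv a \<in> B)" if "g \<in> carrier G" for B g
    using that by (simp add: C_def centr_mod_def)
  have A_C: "A \<subseteq> C B" if B: "B \<lhd> G" for B
  proof
    fix a assume a: "a \<in> A"
    have "a \<otimes> b \<otimes> inv a \<otimes> inv b \<in> B" if "b \<in> A" for b
      using conj_A_trivial[OF a that] A_carrier[OF that] subgroup.one_closed[OF normal_imp_subgroup[OF B]] by simp
    thus "a \<in> C B" using C_iff[OF A_carrier[OF a]] by blast
  qed
  show ?thesis using B
  proof (induction "card (T - C B)" arbitrary: B rule: less_induct)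
    case less
    note nB = less.prems(1) and BA = less.prems(2)
    interpret B: normal B G by (rule nB)
    show ?case
    proof (cases "C B = carrier G")
      case True
      have "commutator_sub G A (carrier G) \<subseteq> B"
      proof (rule commutator_sub_leI[OF B.is_subgroup])
        fix a g assume a: "a \<in> A" and g: "g \<in> carrier G"
        have "g \<otimes> a \<otimes> inv g \<otimes> inv a \<in> B" using True C_iff[OF g] g a by blast
        hence "inv (g \<otimes> a \<otimes> inv g \<otimes> inv a) \<in> B" by (rule B.m_inv_closed)
        thus "a \<otimes> g \<otimes> inv a \<otimes> inv g \<in> B" using g A_carrier[OF a] by (simp add: word_simps)
      qed
      thus ?thesis by (intro exI[of _ 1]) (simp add: iter_comm_Suc[of _ _ 0, simplified])
    next
      case False
      have cC: "lower_central G c \<subseteq> C B" using c A_C[OF nB] by blast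
      obtain z and p :: nat where z: "z \<in> carrier G" "z \<notin> C B" and p: "Factorial_Ring.prime p" and zp: "z [^] p \<in> C B"
        and central: "\<And>g. g \<in> carrier G \<Longrightarrow> z \<otimes> g \<otimes> inv z \<otimes> inv g \<in> C B"
        by (rule central_prime_element[OF C_normal[OF nB] A_C[OF nB] False cC]) blast
      interpret h: group_hom G "G Mod B" "\<lambda>x. B #> x" by (rule B.Mod_group_hom)
      interpret Q: virtually_abelian "G Mod B" "(\<lambda>x. B #> x) ` A" by (rule virtually_abelian_Mod[OF nB])
      interpret Q: central_prime_action "G Mod B" "(\<lambda>x. B #> x) ` A" "B #> z" p
      proof
        show "contranormal_free (G Mod B)" by (rule B.contranormal_free_Mod[OF free])
        show "B #> z \<in> carrier (G Mod B)" using z(1) by (rule h.hom_closed)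
        show "Factorial_Ring.prime p" by (rule p)
        show "(B #> z) [^]\<^bsub>G Mod B\<^esub> p \<in> centr (G Mod B) ((\<lambda>x. B #> x) ` A)"
          using zp B.FactGroup_pow[OF z(1), of p] B.rcos_mem_centr_iff[OF normal_subset[OF A_normal], of "z [^] p"] z(1)
          by (simp add: C_def)
        fix q assume "q \<in> carrier (G Mod B)"
        then obtain g where g: "g \<in> carrier G" "q = B #> g" by (auto simp: carrier_FactGroup)
        have "(B #> z) \<otimes>\<^bsub>G Mod B\<^esub> q \<otimes>\<^bsub>G Mod B\<^esub> inv\<^bsub>G Mod B\<^esub> (B #> z) \<otimes>\<^bsub>G Mod B\<^esub> inv\<^bsub>G Mod B\<^esub> q
          = B #> (z \<otimes> g \<otimes> inv z \<otimes> inv g)"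
          unfolding g(2) using g(1) z(1) by (simp only: h.hom_mult h.hom_inv m_closed inv_closed)
        thus "(B #> z) \<otimes>\<^bsub>G Mod B\<^esub> q \<otimes>\<^bsub>G Mod B\<^esub> inv\<^bsub>G Mod B\<^esub> (B #> z) \<otimes>\<^bsub>G Mod B\<^esub> inv\<^bsub>G Mod B\<^esub> q
          \<in> centr (G Mod B) ((\<lambda>x. B #> x) ` A)" using central[OF g(1)] g(1) z(1)
            B.rcos_mem_centr_iff[OF normal_subset[OF A_normal], of "z \<otimes> g \<otimes> inv z \<otimes> inv g"] by (simp add: C_def)
      qed
      let ?I = "Q.\<phi> ` (\<lambda>x. B #> x) ` A"
      define B' where "B' = {x \<in> carrier G. B #> x \<in> ?I}"
      have nB': "B' \<lhd> G" unfolding B'_def by (rule B.Mod_preimage_normal[OF Q.\<phi>_image_normal])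
      have sB': "subgroup B' G" using nB' by (rule normal_imp_subgroup)
      have BB': "B \<subseteq> B'"
      proof
        fix b assume b: "b \<in> B"
        have "B #> b = \<one>\<^bsub>G Mod B\<^esub>" using B.rcos_eq_one_iff[of b] b by simp
        moreover have "\<one>\<^bsub>G Mod B\<^esub> \<in> ?I" using normal_imp_subgroup[OF Q.\<phi>_image_normal] by (rule subgroup.one_closed)
        ultimately show "b \<in> B'" using b by (simp add: B'_def)
      qed
      have B'A: "B' \<subseteq> A"
      proof
        fix x assume "x \<in> B'"
        hence x: "x \<in> carrier G" "B #> x \<in> (\<lambda>x. B #> x) ` A" using Q.\<phi>_image_subset by (auto simp: B'_def)
        then obtain a where a: "a \<in> A" "B #> x = B #> a" by blast
        have ac: "a \<in> carrier G" using a A_carrier by blast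
        have "x \<otimes> inv a \<in> A" using subgroup_rcos_eq_iff[OF B.is_subgroup x(1) ac] a BA by blast
        hence "x \<otimes> inv a \<otimes> a \<in> A" using a A_subgroup by (simp add: subgroup.m_closed)
        thus "x \<in> A" using x ac by (simp add: m_assoc)
      qed
      have CC': "C B \<subseteq> C B'"
      proof
        fix g assume g: "g \<in> C B"
        hence gc: "g \<in> carrier G" by (simp add: C_def centr_mod_def)
        show "g \<in> C B'" using g BB' C_iff[OF gc] C_iff[OF gc] by blast
      qed
      have zC': "z \<in> C B'"
      proof -
        have "z \<otimes> a \<otimes> inv z \<otimes> inv a \<in> B'" if a: "a \<in> A" for a
        proof -
          have ac: "a \<in> carrier G" using a A_carrier by blast
          have "B #> (z \<otimes> a \<otimes> inv z \<otimes> inv a) = Q.\<phi> (B #> a)"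
            unfolding Q.\<phi>_def using ac z(1) by (simp only: h.hom_mult h.hom_inv m_closed inv_closed)
          thus ?thesis using a ac z(1) by (simp add: B'_def)
        qed
        thus ?thesis using C_iff[OF z(1)] by blast
      qed
      \<comment> \<open>The measure counts elements of \<open>T\<close>, so \<open>z\<close> is
        replaced by its representative \<open>t\<close>; both kernels contain \<open>A\<close>, so
        membership does not change.\<close>
      obtain a t where at: "a \<in> A" "t \<in> T" "z = a \<otimes> t" using T(3)[OF z(1)] by blast
      have ac: "a \<in> carrier G" "t \<in> carrier G" using at A_carrier T by auto
      have aC: "a \<in> C B" using at A_C[OF nB] by blast
      have "t \<notin> C B"
      proof
        assume "t \<in> C B"
        hence "a \<otimes> t \<in> C B" using aC subgroup.m_closed[OF normal_imp_subgroup[OF C_normal[OF nB]]] by blast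
        thus False using at z by blast
      qed
      moreover have "t \<in> C B'"
      proof -
        have s: "subgroup (C B') G" by (rule normal_imp_subgroup[OF C_normal[OF nB']])
        have "inv a \<otimes> z \<in> C B'" using aC CC' zC' subgroup.m_inv_closed[OF s] subgroup.m_closed[OF s] by blast
        thus ?thesis using at ac by (simp add: inv_cancel_left)
      qed
      ultimately have "T - C B' \<subset> T - C B" using at CC' by blast
      hence "card (T - C B') < card (T - C B)" using T(1) by (simp add: psubset_card_mono)
      then obtain n where n: "iter_comm G A n \<subseteq> B'" using less.hyps[of B'] nB' B'A by blast
      have "iter_comm (G Mod B) ((\<lambda>x. B #> x) ` A) n \<subseteq> ?I"
        using n unfolding B.iter_comm_Mod[OF A_normal] by (auto simp: B'_def)
      then obtain m where m: "iter_comm (G Mod B) ((\<lambda>x. B #> x) ` A) m \<subseteq> {\<one>\<^bsub>G Mod B\<^esub>}"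
        using Q.iter_comm_trivial by blast
      hence "iter_comm (G Mod B) ((\<lambda>x. B #> x) ` A) m = {\<one>\<^bsub>G Mod B\<^esub>}"
        using subgroup.one_closed[OF normal_imp_subgroup[OF group.iter_comm_normal[OF B.factorgroup_is_group Q.A_normal]]] by blast
      hence "iter_comm G A m \<subseteq> B" using B.iter_comm_Mod_trivial_iff[OF A_normal] by blast
      thus ?thesis by blast
    qed
  qed
qed

lemma lower_central_trivial:
  assumes free: "contranormal_free G"
  shows "\<exists>n. lower_central G n = {\<one>}"
proof -
  obtain c where c: "lower_central G c \<subseteq> A"
    using contranormal_free_lower_central_subset[OF free A_normal A_index] by blast
  obtain n where n: "iter_comm G A n \<subseteq> {\<one>}"
    using iter_comm_subset_normal[OF free one_is_normal] subgroup.one_closed[OF A_subgroup] by blast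
  have "lower_central G (c + n) \<subseteq> iter_comm G A n"
    unfolding lower_central_eq_iter_comm iter_comm_add
    using c by (intro iter_comm_mono) (simp add: lower_central_eq_iter_comm)
  moreover have "\<one> \<in> lower_central G (c + n)"
    unfolding lower_central_eq_iter_comm by (intro subgroup.one_closed normal_imp_subgroup iter_comm_normal normal_self)
  ultimately show ?thesis using n by blast
qed

end

section \<open>The three subgroup lemma and Hall's criterion\<close>

context group
begin

text \<open>The three subgroup lemma for normal subgroups: modulo \<open>M\<close>, conjugation by \<open>g\<close> moves \<open>x\<close> by
  an element centralizing \<open>L\<close> and \<open>y\<close> by an element centralizing \<open>K\<close>, so it fixes \<open>[x, y]\<close>.\<close>

lemma three_subgroups:
  assumes K: "K \<lhd> G" and L: "L \<lhd> G" and M: "M \<lhd> G" and N: "N \<lhd> G"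
    and KL: "commutator_sub G (commutator_sub G K N) L \<subseteq> M"
    and LK: "commutator_sub G K (commutator_sub G L N) \<subseteq> M"
  shows "commutator_sub G (commutator_sub G K L) N \<subseteq> M"
proof -
  interpret M: normal M G by (rule M)
  interpret Q: group "G Mod M" by (rule M.factorgroup_is_group)
  interpret h: group_hom G "G Mod M" "\<lambda>x. M #> x" by (rule M.Mod_group_hom)
  have c: "k \<in> carrier G" if "k \<in> K \<or> k \<in> L \<or> k \<in> N" for k
    using that normal_subset[OF K] normal_subset[OF L] normal_subset[OF N] by blast
  have comm: "M #> (x \<otimes> y) = M #> (y \<otimes> x)" if "x \<in> carrier G" "y \<in> carrier G" "x \<otimes> y \<otimes> inv x \<otimes> inv y \<in> M" for x y
    using that subgroup_rcos_eq_iff[OF M.is_subgroup, of "x \<otimes> y" "y \<otimes> x"] by (simp add: word_simps)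
  let ?C = "centr_mod G N M"
  have C_iff: "x \<in> ?C \<longleftrightarrow> (\<forall>g\<in>N. M #> (g \<otimes> x \<otimes> inv g) = M #> x)" if x: "x \<in> carrier G" for x
  proof -
    have "x \<otimes> g \<otimes> inv x \<otimes> inv g \<in> M \<longleftrightarrow> M #> x = M #> (g \<otimes> x \<otimes> inv g)" if "g \<in> N" for g
      using x c[of g] that subgroup_rcos_eq_iff[OF M.is_subgroup, of x "g \<otimes> x \<otimes> inv g"] by (simp add: word_simps)
    thus ?thesis using x by (auto simp: centr_mod_def)
  qed
  have hm: "M #> (x \<otimes> y) = (M #> x) \<otimes>\<^bsub>G Mod M\<^esub> (M #> y)" if "x \<in> carrier G" "y \<in> carrier G" for x y
    by (rule h.hom_mult[OF that])
  have sC: "subgroup ?C G" by (rule normal_imp_subgroup[OF centr_mod_normal[OF N M]])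
  have "commutator_sub G K L \<subseteq> ?C"
  proof (rule commutator_sub_leI[OF sC])
    fix x y assume x: "x \<in> K" and y: "y \<in> L"
    have xc: "x \<in> carrier G" "y \<in> carrier G" using c x y by auto
    have "M #> (g \<otimes> (x \<otimes> y \<otimes> inv x \<otimes> inv y) \<otimes> inv g) = M #> (x \<otimes> y \<otimes> inv x \<otimes> inv y)" if g: "g \<in> N" for g
    proof -
      have gc: "g \<in> carrier G" using c g by blast
      define u where "u = g \<otimes> x \<otimes> inv g \<otimes> inv x"
      define v where "v = g \<otimes> y \<otimes> inv g \<otimes> inv y"
      have u: "u \<in> commutator_sub G K N"
        unfolding u_def commutator_sub_commute[OF normal_subset[OF K] normal_subset[OF N]]
        using g x by (rule commutator_sub_incl)
      have v: "v \<in> commutator_sub G L N"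
        unfolding v_def commutator_sub_commute[OF normal_subset[OF L] normal_subset[OF N]]
        using g y by (rule commutator_sub_incl)
      have uc: "u \<in> carrier G" "v \<in> carrier G" unfolding u_def v_def using gc xc by auto
      have u_L: "M #> (u \<otimes> l) = M #> (l \<otimes> u)" if l: "l \<in> L" for l
        using comm[of u l] uc c l KL commutator_sub_incl[OF u l] by blast
      have v_K: "M #> (k \<otimes> v) = M #> (v \<otimes> k)" if k: "k \<in> K" for k
        using comm[of k v] uc c k LK commutator_sub_incl[OF k v] by blast
      define l where "l = x \<otimes> (v \<otimes> y) \<otimes> inv x"
      have "v \<otimes> y = g \<otimes> y \<otimes> inv g" unfolding v_def using gc xc by (simp add: m_assoc)
      hence "v \<otimes> y \<in> L" using L gc y by (simp add: normal_inv_iff)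
      hence l: "l \<in> L" unfolding l_def using L xc by (simp add: normal_inv_iff)
      have lc: "l \<in> carrier G" using l c by blast
      \<comment> \<open>Conjugation by \<open>g\<close> sends \<open>x\<close> to
        \<open>u \<otimes> x\<close> and \<open>y\<close> to \<open>v \<otimes> y\<close>, so the
        left side is the commutator of these two; \<open>l\<close> is an element of \<open>L\<close>
        and hence commutes with \<open>u\<close> modulo \<open>M\<close>.\<close>
      have "g \<otimes> (x \<otimes> y \<otimes> inv x \<otimes> inv y) \<otimes> inv g = u \<otimes> l \<otimes> inv u \<otimes> inv (v \<otimes> y)"
        unfolding l_def u_def v_def using gc xc by (simp add: word_simps)
      hence "M #> (g \<otimes> (x \<otimes> y \<otimes> inv x \<otimes> inv y) \<otimes> inv g) = (M #> (u \<otimes> l)) \<otimes>\<^bsub>G Mod M\<^esub> (M #> (inv u \<otimes> inv (v \<otimes> y)))"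
        using uc lc xc by (simp add: m_assoc flip: hm del: mult_FactGroup)
      also have "\<dots> = (M #> (l \<otimes> u)) \<otimes>\<^bsub>G Mod M\<^esub> (M #> (inv u \<otimes> inv (v \<otimes> y)))" using u_L[OF l] by simp
      also have "\<dots> = M #> (l \<otimes> inv (v \<otimes> y))"
        using uc lc xc by (simp add: word_simps flip: hm del: mult_FactGroup)
      \<comment> \<open>Modulo \<open>M\<close>, \<open>v\<close> commutes with \<open>x\<close> and
        with the commutator of \<open>x\<close> and \<open>y\<close>, both in \<open>K\<close>, and
        so it finally cancels against \<open>inv v\<close>.\<close>
      also have "l \<otimes> inv (v \<otimes> y) = (x \<otimes> v) \<otimes> (y \<otimes> inv x \<otimes> inv y \<otimes> inv v)"
        unfolding l_def using uc xc by (simp add: word_simps)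
      also have "M #> \<dots> = (M #> (v \<otimes> x)) \<otimes>\<^bsub>G Mod M\<^esub> (M #> (y \<otimes> inv x \<otimes> inv y \<otimes> inv v))"
        using uc xc v_K[OF x] by (simp add: hm del: mult_FactGroup)
      also have "\<dots> = M #> (v \<otimes> (x \<otimes> y \<otimes> inv x \<otimes> inv y) \<otimes> inv v)"
        using uc xc by (simp add: m_assoc flip: hm del: mult_FactGroup)
      also have "\<dots> = (M #> (v \<otimes> (x \<otimes> y \<otimes> inv x \<otimes> inv y))) \<otimes>\<^bsub>G Mod M\<^esub> (M #> inv v)"
        using uc xc by (simp add: hm del: mult_FactGroup)
      also have "M #> (v \<otimes> (x \<otimes> y \<otimes> inv x \<otimes> inv y)) = M #> ((x \<otimes> y \<otimes> inv x \<otimes> inv y) \<otimes> v)"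
      proof (rule v_K[symmetric])
        have "y \<otimes> inv x \<otimes> inv y \<in> K" using K xc x by (simp add: normal_inv_iff normal_imp_subgroup subgroup.m_inv_closed)
        hence "x \<otimes> (y \<otimes> inv x \<otimes> inv y) \<in> K" using x K by (simp add: normal_imp_subgroup subgroup.m_closed)
        thus "x \<otimes> y \<otimes> inv x \<otimes> inv y \<in> K" using xc by (simp add: m_assoc)
      qed
      also have "(M #> ((x \<otimes> y \<otimes> inv x \<otimes> inv y) \<otimes> v)) \<otimes>\<^bsub>G Mod M\<^esub> (M #> inv v) = M #> (x \<otimes> y \<otimes> inv x \<otimes> inv y)"
        using uc xc by (subst hm[symmetric]) (simp_all add: m_assoc)
      finally show ?thesis .
    qed
    thus "x \<otimes> y \<otimes> inv x \<otimes> inv y \<in> ?C" using xc C_iff by simp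
  qed
  thus ?thesis
    by (intro commutator_sub_leI[OF M.is_subgroup]) (auto simp: centr_mod_def)
qed

text \<open>A Leibniz rule: by the three subgroup lemma, a commutator of \<open>[K_i, L_j]\<close>
  with \<open>G\<close> falls into the group generated by \<open>[K_(i+1), L_j]\<close> and
  \<open>[K_i, L_(j+1)]\<close>. So \<open>P n\<close>, generated by all terms with
  \<open>i + j = n\<close>, contains the \<open>n\<close>-th iterate.\<close>

lemma iter_comm_commutator_sub:
  assumes K: "K \<lhd> G" and L: "L \<lhd> G" and M: "M \<lhd> G"
    and bound: "\<And>i j. i + j = n \<Longrightarrow> commutator_sub G (iter_comm G K i) (iter_comm G L j) \<subseteq> M"
  shows "iter_comm G (commutator_sub G K L) n \<subseteq> M"
proof -
  define S where "S n = (\<Union>i\<le>n. commutator_sub G (iter_comm G K i) (iter_comm G L (n - i)))" for n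
  define P where "P n = generate G (S n)" for n
  have nKL: "commutator_sub G (iter_comm G K i) (iter_comm G L j) \<lhd> G" for i j
    by (intro commutator_sub_normal iter_comm_normal K L)
  have Sc: "S n \<subseteq> carrier G" for n using normal_subset[OF nKL] by (auto simp: S_def)
  have nP: "P n \<lhd> G" for n
    unfolding P_def
  proof (rule normal_generateI[OF Sc])
    fix h g assume "h \<in> S n" "g \<in> carrier G"
    thus "g \<otimes> h \<otimes> inv g \<in> S n" using nKL unfolding S_def normal_inv_iff by blast
  qed
  have SP: "S n \<subseteq> P n" for n unfolding P_def by (auto intro: generate.incl)
  have memP: "commutator_sub G (iter_comm G K i) (iter_comm G L j) \<subseteq> P (i + j)" for i j
  proof
    fix x assume "x \<in> commutator_sub G (iter_comm G K i) (iter_comm G L j)"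
    hence "x \<in> S (i + j)" unfolding S_def by (intro UN_I[of i]) simp_all
    thus "x \<in> P (i + j)" using SP by blast
  qed
  have step: "commutator_sub G (P m) (carrier G) \<subseteq> P (Suc m)" for m
  proof -
    have "S m \<subseteq> centr_mod G (carrier G) (P (Suc m))"
    proof
      fix x assume x: "x \<in> S m"
      then obtain i where i: "i \<le> m" "x \<in> commutator_sub G (iter_comm G K i) (iter_comm G L (m - i))"
        by (auto simp: S_def)
      have "commutator_sub G (commutator_sub G (iter_comm G K i) (iter_comm G L (m - i))) (carrier G) \<subseteq> P (Suc m)"
      proof (rule three_subgroups)
        show "commutator_sub G (commutator_sub G (iter_comm G K i) (carrier G)) (iter_comm G L (m - i)) \<subseteq> P (Suc m)"
          using memP[of "Suc i" "m - i"] i by (simp add: iter_comm_Suc)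
        show "commutator_sub G (iter_comm G K i) (commutator_sub G (iter_comm G L (m - i)) (carrier G)) \<subseteq> P (Suc m)"
          using memP[of i "Suc (m - i)"] i by (simp add: iter_comm_Suc)
      qed (intro iter_comm_normal K L nP normal_self)+
      thus "x \<in> centr_mod G (carrier G) (P (Suc m))"
        using commutator_sub_incl[OF i(2)] subsetD[OF Sc x] by (auto simp: centr_mod_def)
    qed
    hence "P m \<subseteq> centr_mod G (carrier G) (P (Suc m))"
      unfolding P_def[of m]
      by (intro generate_subgroup_incl normal_imp_subgroup centr_mod_normal normal_self nP)
    thus ?thesis
      by (intro commutator_sub_leI normal_imp_subgroup nP) (auto simp: centr_mod_def)
  qed
  have "iter_comm G (commutator_sub G K L) m \<subseteq> P m" for m
  proof (induction m)
    case 0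
    show ?case using memP[of 0 0] by simp
  next
    case (Suc m)
    thus ?case using step[of m] commutator_sub_mono[OF Suc.IH order_refl, of "carrier G"] unfolding iter_comm_Suc by blast
  qed
  moreover have "P n \<subseteq> M"
    unfolding P_def
  proof (rule generate_subgroup_incl[OF _ normal_imp_subgroup[OF M]])
    show "S n \<subseteq> M" unfolding S_def by (intro UN_least bound) simp
  qed
  ultimately show ?thesis by blast
qed

text \<open>Let \<open>\<Gamma>\<close> be the lower central series of \<open>N\<close>. If
  \<open>a\<close> commutators with \<open>G\<close> take \<open>\<Gamma> i\<close> into
  \<open>\<Gamma> (Suc i)\<close>, then \<open>a + b\<close> of them take
  \<open>\<Gamma> (Suc i) = [\<Gamma> i, N]\<close> into the next term, since
  \<open>r + s = a + b\<close> forces \<open>r \<ge> a\<close> or \<open>s \<ge> b\<close>.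
  Nilpotency of \<open>N\<close> leaves finitely many layers.\<close>

lemma hall_criterion:
  assumes N: "N \<lhd> G" and nil: "nilpotent_group (G\<lparr>carrier := N\<rparr>)"
    and b: "iter_comm G N b \<subseteq> commutator_sub G N N"
  shows "\<exists>n. iter_comm G N n \<subseteq> {\<one>}"
proof -
  let ?N = "G\<lparr>carrier := N\<rparr>"
  have sN: "subgroup N G" using N by (rule normal_imp_subgroup)
  interpret N: group ?N by (rule subgroup_imp_group[OF sN])
  \<comment> \<open>Commutator subgroups formed inside \<open>N\<close> agree with those formed in
    \<open>G\<close>; this makes the terms of the lower central series of \<open>N\<close> normal in
    \<open>G\<close>.\<close>
  have comm_eq: "commutator_sub ?N H K = commutator_sub G H K" if "H \<subseteq> N" "K \<subseteq> N" for H K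
  proof -
    have "h \<otimes> k \<otimes> inv\<^bsub>?N\<^esub> h \<otimes> inv\<^bsub>?N\<^esub> k = h \<otimes> k \<otimes> inv h \<otimes> inv k" if "h \<in> H" "k \<in> K" for h k
    proof -
      have "h \<in> N" "k \<in> N" using that \<open>H \<subseteq> N\<close> \<open>K \<subseteq> N\<close> by auto
      thus ?thesis using m_inv_consistent[OF sN] by simp
    qed
    hence "(\<exists>h k. x = h \<otimes> k \<otimes> inv\<^bsub>?N\<^esub> h \<otimes> inv\<^bsub>?N\<^esub> k \<and> h \<in> H \<and> k \<in> K) \<longleftrightarrow>
      (\<exists>h k. x = h \<otimes> k \<otimes> inv h \<otimes> inv k \<and> h \<in> H \<and> k \<in> K)" for x by metis
    hence "{h \<otimes> k \<otimes> inv\<^bsub>?N\<^esub> h \<otimes> inv\<^bsub>?N\<^esub> k |h k. h \<in> H \<and> k \<in> K} = {h \<otimes> k \<otimes> inv h \<otimes> inv k |h k. h \<in> H \<and> k \<in> K}"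
      by (rule Collect_cong)
    moreover have "{h \<otimes> k \<otimes> inv h \<otimes> inv k |h k. h \<in> H \<and> k \<in> K} \<subseteq> N"
      using that sN by (auto intro!: subgroup.m_closed[OF sN] subgroup.m_inv_closed[OF sN])
    ultimately show ?thesis unfolding commutator_sub_def using generate_consistent[OF _ sN] by simp
  qed
  define \<Gamma> where "\<Gamma> i = lower_central ?N i" for i
  have \<Gamma>: "\<Gamma> i \<lhd> G \<and> \<Gamma> i \<subseteq> N \<and> \<Gamma> (Suc i) = commutator_sub G (\<Gamma> i) N" for i
  proof (induction i)
    case 0
    show ?case using N comm_eq[of N N] by (simp add: \<Gamma>_def)
  next
    case (Suc i)
    have "\<Gamma> (Suc i) \<lhd> G" using Suc N by (simp add: commutator_sub_normal)
    moreover have "\<Gamma> (Suc i) \<subseteq> N"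
      using Suc commutator_sub_le_left[of "\<Gamma> i" N] normal_subset[OF N] by auto
    ultimately show ?case using comm_eq[of "\<Gamma> (Suc i)" N] by (simp add: \<Gamma>_def)
  qed
  have \<Gamma>n: "\<Gamma> i \<lhd> G" and \<Gamma>S: "\<Gamma> (Suc i) = commutator_sub G (\<Gamma> i) N" for i using \<Gamma> by auto
  have \<Gamma>0: "\<Gamma> 0 = N" by (simp add: \<Gamma>_def)
  have \<Gamma>c: "\<Gamma> i \<subseteq> carrier G" for i using normal_subset[OF \<Gamma>n] .
  \<comment> \<open>For the case in which the second factor has dropped from \<open>N\<close> into
    \<open>[N, N] = \<Gamma> 1\<close>: a commutator with it lowers \<open>\<Gamma> i\<close> by two
    terms.\<close>
  have \<Gamma>1: "commutator_sub G (\<Gamma> i) (\<Gamma> 1) \<subseteq> \<Gamma> (Suc (Suc i))" for i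
  proof -
    have e: "commutator_sub G N (\<Gamma> i) = \<Gamma> (Suc i)"
      unfolding \<Gamma>S by (rule commutator_sub_commute[OF normal_subset[OF N] \<Gamma>c])
    have "commutator_sub G (commutator_sub G N N) (\<Gamma> i) \<subseteq> \<Gamma> (Suc (Suc i))"
    proof (rule three_subgroups[OF N N \<Gamma>n \<Gamma>n])
      show "commutator_sub G (commutator_sub G N (\<Gamma> i)) N \<subseteq> \<Gamma> (Suc (Suc i))"
        unfolding e by (simp add: \<Gamma>S)
      show "commutator_sub G N (commutator_sub G N (\<Gamma> i)) \<subseteq> \<Gamma> (Suc (Suc i))"
        unfolding e using commutator_sub_commute[OF normal_subset[OF N] \<Gamma>c, of "Suc i"] \<Gamma>S[of "Suc i"] by simp
    qed
    moreover have "\<Gamma> 1 = commutator_sub G N N" using \<Gamma>S[of 0] \<Gamma>0 by simp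
    ultimately show ?thesis using commutator_sub_commute[OF \<Gamma>c \<Gamma>c, of i 1] by simp
  qed
  have b1: "iter_comm G N b \<subseteq> \<Gamma> 1" using b \<Gamma>S[of 0] \<Gamma>0 by simp
  have step: "\<exists>k. iter_comm G (\<Gamma> i) k \<subseteq> \<Gamma> (Suc i)" for i
  proof (induction i)
    case 0
    show ?case using b1 \<Gamma>0 by auto
  next
    case (Suc i)
    then obtain a where a: "iter_comm G (\<Gamma> i) a \<subseteq> \<Gamma> (Suc i)" by blast
    have "iter_comm G (commutator_sub G (\<Gamma> i) N) (a + b) \<subseteq> \<Gamma> (Suc (Suc i))"
    proof (rule iter_comm_commutator_sub[OF \<Gamma>n N \<Gamma>n])
      fix r s assume rs: "r + s = a + b"
      show "commutator_sub G (iter_comm G (\<Gamma> i) r) (iter_comm G N s) \<subseteq> \<Gamma> (Suc (Suc i))"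
      proof (cases "r \<ge> a")
        case True
        have "iter_comm G (\<Gamma> i) r \<subseteq> \<Gamma> (Suc i)" using iter_comm_antimono[OF \<Gamma>n True] a by blast
        moreover have "iter_comm G N s \<subseteq> N" using iter_comm_antimono[OF N, of 0 s] by simp
        ultimately show ?thesis unfolding \<Gamma>S[of "Suc i"] by (rule commutator_sub_mono)
      next
        case False
        hence "b \<le> s" using rs by linarith
        hence "iter_comm G N s \<subseteq> \<Gamma> 1" using iter_comm_antimono[OF N] b1 by blast
        moreover have "iter_comm G (\<Gamma> i) r \<subseteq> \<Gamma> i" using iter_comm_antimono[OF \<Gamma>n, of 0 r] by simp
        ultimately have "commutator_sub G (iter_comm G (\<Gamma> i) r) (iter_comm G N s) \<subseteq> commutator_sub G (\<Gamma> i) (\<Gamma> 1)"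
          by (intro commutator_sub_mono)
        thus ?thesis using \<Gamma>1 by blast
      qed
    qed
    thus ?case using \<Gamma>S[of i] by auto
  qed
  have "\<exists>n. iter_comm G N n \<subseteq> \<Gamma> i" for i
  proof (induction i)
    case 0
    show ?case using \<Gamma>0 by (intro exI[of _ 0]) simp
  next
    case (Suc i)
    then obtain n where n: "iter_comm G N n \<subseteq> \<Gamma> i" by blast
    obtain k where k: "iter_comm G (\<Gamma> i) k \<subseteq> \<Gamma> (Suc i)" using step by blast
    have "iter_comm G N (n + k) \<subseteq> \<Gamma> (Suc i)"
      using iter_comm_mono[OF n, of k] k by (simp add: iter_comm_add)
    thus ?case by blast
  qed
  moreover obtain m where "\<Gamma> m = {\<one>}" using nil by (auto simp: nilpotent_group_def \<Gamma>_def)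
  ultimately show ?thesis by metis
qed

end

theorem theoremA:
  fixes G :: "('a, 'b) monoid_scheme" and N :: "'a set"
  assumes "group G"
    and "N \<lhd> G"
    and "nilpotent_group (G\<lparr>carrier := N\<rparr>)"
    and "finite (rcosets\<^bsub>G\<^esub> N)"
    and "\<And>H. contranormal H G \<Longrightarrow> H = carrier G"
  shows "nilpotent_group G"
proof -
  interpret group G by fact
  have free: "contranormal_free G" using assms(5) by (simp add: contranormal_free_def)
  have sN: "subgroup N G" using assms(2) by (rule normal_imp_subgroup)
  define D where "D = commutator_sub G N N"
  have nD: "D \<lhd> G" unfolding D_def by (rule commutator_sub_normal[OF assms(2,2)])
  interpret D: normal D G by (rule nD)
  interpret h: group_hom G "G Mod D" "\<lambda>x. D #>\<^bsub>G\<^esub> x" by (rule D.Mod_group_hom)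
  have "virtually_abelian (G Mod D) ((\<lambda>x. D #>\<^bsub>G\<^esub> x) ` N)"
  proof (rule virtually_abelian.intro[OF D.factorgroup_is_group virtually_abelian_axioms.intro])
    fix x y assume "x \<in> (\<lambda>x. D #>\<^bsub>G\<^esub> x) ` N" "y \<in> (\<lambda>x. D #>\<^bsub>G\<^esub> x) ` N"
    then obtain a b where ab: "a \<in> N" "b \<in> N" "x = D #>\<^bsub>G\<^esub> a" "y = D #>\<^bsub>G\<^esub> b" by blast
    have c: "a \<in> carrier G" "b \<in> carrier G" using ab normal_subset[OF assms(2)] by auto
    have "a \<otimes>\<^bsub>G\<^esub> b \<otimes>\<^bsub>G\<^esub> inv\<^bsub>G\<^esub> a \<otimes>\<^bsub>G\<^esub> inv\<^bsub>G\<^esub> b \<in> D" unfolding D_def using ab by (intro commutator_sub_incl)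
    hence "(a \<otimes>\<^bsub>G\<^esub> b) \<otimes>\<^bsub>G\<^esub> inv\<^bsub>G\<^esub> (b \<otimes>\<^bsub>G\<^esub> a) \<in> D" using c by (simp add: word_simps)
    hence "D #>\<^bsub>G\<^esub> (a \<otimes>\<^bsub>G\<^esub> b) = D #>\<^bsub>G\<^esub> (b \<otimes>\<^bsub>G\<^esub> a)"
      using c by (intro iffD2[OF subgroup_rcos_eq_iff[OF D.is_subgroup]] m_closed)
    thus "x \<otimes>\<^bsub>G Mod D\<^esub> y = y \<otimes>\<^bsub>G Mod D\<^esub> x"
      using h.hom_mult[OF c] h.hom_mult[OF c(2,1)] ab by simp
  qed (rule D.Mod_image_normal[OF assms(2)], rule D.finite_rcosets_Mod[OF sN assms(4)])
  then obtain b where "lower_central (G Mod D) b = {\<one>\<^bsub>G Mod D\<^esub>}"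
    using virtually_abelian.lower_central_trivial D.contranormal_free_Mod[OF free] by blast
  hence "iter_comm (G Mod D) ((\<lambda>x. D #>\<^bsub>G\<^esub> x) ` carrier G) b = {\<one>\<^bsub>G Mod D\<^esub>}"
    by (simp add: lower_central_eq_iter_comm carrier_FactGroup)
  hence "iter_comm G (carrier G) b \<subseteq> D" using D.iter_comm_Mod_trivial_iff[OF normal_self] by blast
  \<comment> \<open>Nilpotency of \<open>G Mod D\<close> enters \<open>hall_criterion\<close>
    through this bound on the series starting at \<open>N\<close>.\<close>
  hence "iter_comm G N b \<subseteq> D" using iter_comm_mono[OF normal_subset[OF assms(2)], of b] by blast
  then obtain n where n: "iter_comm G N n \<subseteq> {\<one>\<^bsub>G\<^esub>}"
    using hall_criterion[OF assms(2,3)] unfolding D_def by blast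
  obtain c where c: "lower_central G c \<subseteq> N"
    using contranormal_free_lower_central_subset[OF free assms(2,4)] by blast
  have "lower_central G (c + n) \<subseteq> {\<one>\<^bsub>G\<^esub>}"
    using c n iter_comm_mono[of "iter_comm G (carrier G) c" N n] by (auto simp: lower_central_eq_iter_comm iter_comm_add)
  moreover have "\<one>\<^bsub>G\<^esub> \<in> lower_central G (c + n)"
    unfolding lower_central_eq_iter_comm by (intro subgroup.one_closed normal_imp_subgroup iter_comm_normal normal_self)
  ultimately have "lower_central G (c + n) = {\<one>\<^bsub>G\<^esub>}" by blast
  thus ?thesis unfolding nilpotent_group_def using assms(1) by blast
qed

end
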